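(* Let $X$ be a complete median space, and let $G$ be a locally compact second countable group with Kazhdan's Property (T) that acts ergodically by a measure-preserving action on a standard probability space $\Omega$. Then for any cocycle $\alpha:G\times\Omega\to\mathrm{Isom}(X)$ there exists an $\alpha$-invariant field of bounded subsets, i.e. an $\alpha$-invariant section $f:\Omega\to \mathrm{Bdd}(X)$ such that $\{(\omega,x)\in\Omega\times X : x\in f(\omega)\}$ is measurable.
   Context: A metric space $(X,d)$ is a median space if for all $x,y,z\in X$ the intersection $[x,y]\cap[x,z]\cap[y,z]$ is a single point, where $[a,b]=\{c\in X: d(a,b)=d(a,c)+d(c,b)\}$. $\mathrm{Isom}(X)$ carries the topology of pointwise convergence and its Borel structure. A (measurable, strict) cocycle is a measurable map $\alpha:G\times\Omega\to \mathrm{Isom}(X)$ such that $\alpha(g_1g_2,\omega)=\alpha(g_1,g_2.\omega)\circ\alpha(g_2,\omega)$ for all $g_1,g_2\in G$, $\omega\in\Omega$. $\mathrm{Bdd}(X)$ is the set of nonempty bounded subsets of $X$. A section $f:\Omega\to\mathrm{Bdd}(X)$ is $\alpha$-invariant if for all $g\in G$, $\alpha(g,\omega)f(\omega)=f(g.\omega)$ for almost all $\omega\in\Omega$. *)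

theory Defs
  imports "HOL-Probability.Probability_Measure" "HOL-Algebra.Module"
begin

section \<open>Median spaces and their isometries\<close>

definition metric_interval :: "'x::metric_space \<Rightarrow> 'x \<Rightarrow> 'x set" where
  "metric_interval a b = {c. dist a b = dist a c + dist c b}"

definition median_space :: "'x::metric_space itself \<Rightarrow> bool" where
  "median_space _ \<longleftrightarrow> (\<forall>x y z :: 'x. \<exists>m.
     metric_interval x y \<inter> metric_interval x z \<inter> metric_interval y z = {m})"

definition isometries :: "('x::metric_space \<Rightarrow> 'x) set" where
  "isometries = {\<phi>. bij \<phi> \<and> (\<forall>x y. dist (\<phi> x) (\<phi> y) = dist x y)}"

text \<open>The function type carries the product topology, that is, the topology of pointwise
  convergence. Hence the sigma-algebra below is the Borel sigma-algebra of the subspace topology on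
  the isometry group.\<close>

definition isometries_borel :: "('x::metric_space \<Rightarrow> 'x) measure" where
  "isometries_borel = restrict_space borel isometries"

definition Bdd :: "'x::metric_space set set" where
  "Bdd = {A. A \<noteq> {} \<and> bounded A}"


section \<open>Property (T)\<close>

text \<open>Groups are written additively, as the type class \<open>topological_group_add\<close> prescribes;
  commutativity is not part of that class.\<close>

definition complex_ring :: "complex ring" where
  "complex_ring = \<lparr>carrier = UNIV, mult = (*), one = 1, zero = 0, add = (+)\<rparr>"

definition ip_norm :: "('h \<Rightarrow> 'h \<Rightarrow> complex) \<Rightarrow> 'h \<Rightarrow> real" where
  "ip_norm ip x = sqrt (Re (ip x x))"

locale complex_hilbert_space =
  fixes V :: "(complex, 'h) module" (structure)
    and ip :: "'h \<Rightarrow> 'h \<Rightarrow> complex"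
  assumes module: "Module.module complex_ring V"
    and ip_add_left: "\<lbrakk>x \<in> carrier V; y \<in> carrier V; z \<in> carrier V\<rbrakk>
          \<Longrightarrow> ip (x \<oplus> y) z = ip x z + ip y z"
    and ip_smult_left: "\<lbrakk>x \<in> carrier V; y \<in> carrier V\<rbrakk> \<Longrightarrow> ip (c \<odot> x) y = c * ip x y"
    and ip_commute: "\<lbrakk>x \<in> carrier V; y \<in> carrier V\<rbrakk> \<Longrightarrow> ip x y = cnj (ip y x)"
    and ip_pos: "\<lbrakk>x \<in> carrier V; x \<noteq> \<zero>\<rbrakk> \<Longrightarrow> Re (ip x x) > 0"
    and complete: "\<lbrakk>\<And>n. s n \<in> carrier V;
          \<forall>e>0. \<exists>N. \<forall>m\<ge>N. \<forall>n\<ge>N. ip_norm ip (s m \<ominus> s n) < e\<rbrakk>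
          \<Longrightarrow> \<exists>l\<in>carrier V. (\<lambda>n. ip_norm ip (s n \<ominus> l)) \<longlonglongrightarrow> 0"

locale unitary_representation = complex_hilbert_space V ip
  for V :: "(complex, 'h) module" (structure)
    and ip :: "'h \<Rightarrow> 'h \<Rightarrow> complex" +
  fixes \<pi> :: "'g::topological_group_add \<Rightarrow> 'h \<Rightarrow> 'h"
  assumes unitary_bij: "bij_betw (\<pi> g) (carrier V) (carrier V)"
    and unitary_add: "\<lbrakk>x \<in> carrier V; y \<in> carrier V\<rbrakk> \<Longrightarrow> \<pi> g (x \<oplus> y) = \<pi> g x \<oplus> \<pi> g y"
    and unitary_smult: "x \<in> carrier V \<Longrightarrow> \<pi> g (c \<odot> x) = c \<odot> \<pi> g x"
    and unitary_ip: "\<lbrakk>x \<in> carrier V; y \<in> carrier V\<rbrakk> \<Longrightarrow> ip (\<pi> g x) (\<pi> g y) = ip x y"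
    and rep_mult: "x \<in> carrier V \<Longrightarrow> \<pi> (g + h) x = \<pi> g (\<pi> h x)"
    and strongly_continuous:
      "x \<in> carrier V \<Longrightarrow> ((\<lambda>h. ip_norm ip (\<pi> h x \<ominus> \<pi> g x)) \<longlongrightarrow> 0) (at g)"

text \<open>Inside a formula one cannot quantify over Hilbert spaces of arbitrary type, so all Hilbert
  spaces whose points form a subset of \<open>nat \<Rightarrow> complex\<close> are taken (with arbitrary operations and
  inner product, unrelated to the pointwise ones). Up to isomorphism these include every separable
  Hilbert space. Nothing is lost for second countable groups: a vector that is almost invariant
  under K generates a separable closed invariant subspace.\<close>

definition kazhdan_pair ::
  "'g::{topological_group_add, second_countable_topology} set \<Rightarrow> real \<Rightarrow> bool" where
  "kazhdan_pair K \<epsilon> \<longleftrightarrow>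
     (\<forall>(V :: (complex, nat \<Rightarrow> complex) module) ip (\<pi> :: 'g \<Rightarrow> _).
        unitary_representation V ip \<pi> \<longrightarrow>
        (\<exists>v\<in>carrier V. v \<noteq> \<zero>\<^bsub>V\<^esub> \<and>
           (\<forall>k\<in>K. ip_norm ip (\<pi> k v \<ominus>\<^bsub>V\<^esub> v) < \<epsilon> * ip_norm ip v)) \<longrightarrow>
        (\<exists>v\<in>carrier V. v \<noteq> \<zero>\<^bsub>V\<^esub> \<and> (\<forall>g. \<pi> g v = v)))"

definition property_T ::
  "'g::{topological_group_add, second_countable_topology} itself \<Rightarrow> bool" where
  "property_T _ \<longleftrightarrow> (\<exists>(K :: 'g set) \<epsilon>. compact K \<and> \<epsilon> > 0 \<and> kazhdan_pair K \<epsilon>)"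


section \<open>Actions and cocycles\<close>

definition standard_borel :: "'w measure \<Rightarrow> bool" where
  "standard_borel \<Omega> \<longleftrightarrow> (\<exists>T. completely_metrizable_space T \<and> second_countable T \<and>
     topspace T = space \<Omega> \<and> sets \<Omega> = sigma_sets (space \<Omega>) {U. openin T U})"

definition standard_probability_space :: "'w measure \<Rightarrow> bool" where
  "standard_probability_space \<Omega> \<longleftrightarrow> prob_space \<Omega> \<and> standard_borel \<Omega>"

definition mp_action :: "'w measure \<Rightarrow> ('g::topological_group_add \<Rightarrow> 'w \<Rightarrow> 'w) \<Rightarrow> bool" where
  "mp_action \<Omega> act \<longleftrightarrow>
     (\<lambda>(g, \<omega>). act g \<omega>) \<in> borel \<Otimes>\<^sub>M \<Omega> \<rightarrow>\<^sub>M \<Omega> \<and>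
     (\<forall>\<omega>\<in>space \<Omega>. act 0 \<omega> = \<omega>) \<and>
     (\<forall>g h. \<forall>\<omega>\<in>space \<Omega>. act (g + h) \<omega> = act g (act h \<omega>)) \<and>
     (\<forall>g. distr \<Omega> \<Omega> (act g) = \<Omega>)"

definition ergodic_action :: "'w measure \<Rightarrow> ('g \<Rightarrow> 'w \<Rightarrow> 'w) \<Rightarrow> bool" where
  "ergodic_action \<Omega> act \<longleftrightarrow>
     (\<forall>A\<in>sets \<Omega>. (\<forall>g. act g -` A \<inter> space \<Omega> = A) \<longrightarrow>
        measure \<Omega> A = 0 \<or> measure \<Omega> A = 1)"

definition isom_cocycle ::
  "'w measure \<Rightarrow> ('g::topological_group_add \<Rightarrow> 'w \<Rightarrow> 'w) \<Rightarrow>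
    ('g \<Rightarrow> 'w \<Rightarrow> 'x::metric_space \<Rightarrow> 'x) \<Rightarrow> bool" where
  "isom_cocycle \<Omega> act \<alpha> \<longleftrightarrow>
     (\<lambda>(g, \<omega>). \<alpha> g \<omega>) \<in> borel \<Otimes>\<^sub>M \<Omega> \<rightarrow>\<^sub>M isometries_borel \<and>
     (\<forall>g h. \<forall>\<omega>\<in>space \<Omega>. \<alpha> (g + h) \<omega> = \<alpha> g (act h \<omega>) \<circ> \<alpha> h \<omega>)"

definition invariant_section ::
  "'w measure \<Rightarrow> ('g \<Rightarrow> 'w \<Rightarrow> 'w) \<Rightarrow> ('g \<Rightarrow> 'w \<Rightarrow> 'x \<Rightarrow> 'x) \<Rightarrow> ('w \<Rightarrow> 'x set) \<Rightarrow> bool" where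
  "invariant_section \<Omega> act \<alpha> f \<longleftrightarrow> (\<forall>g. AE \<omega> in \<Omega>. \<alpha> g \<omega> ` f \<omega> = f (act g \<omega>))"

end

theory Submission
  imports Defs "HOL-Probability.Probability" "HOL-Real_Asymp.Real_Asymp" "HOL-Library.Poly_Mapping"
begin

text \<open>
  The proof produces an almost invariant assignment of functions \<open>u \<omega> : X \<rightarrow> \<complex>\<close> that tend to 0 at
  infinity, and takes for \<open>f \<omega>\<close> a level set of \<open>|u \<omega>|\<close>.

  On a median space the kernel \<open>exp (- t * d x y)\<close> is positive definite for every \<open>t \<ge> 0\<close>
  (\<open>exp_neg_dist_posdef\<close>). Fix a base point \<open>x0\<close> and let \<open>orb g \<omega> = \<alpha> g (act (- g) \<omega>) x0\<close>, so
  that \<open>\<alpha> g \<omega> (orb h \<omega>) = orb (g + h) (act g \<omega>)\<close>. For an almost invariant set \<open>E \<subseteq> \<Omega>\<close>, averaging the kernel over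
  the random orbit gives the function \<open>\<phi> g = \<integral>\<^sub>E exp (- t * d (x0, orb g \<omega>)) d\<omega>\<close> on \<open>G\<close>, which is again
  positive definite. As \<open>t\<close> tends to 0 these functions increase to the measure of \<open>E\<close>; if that measure is
  positive, then by compactness the cyclic vector of the GNS representation of \<open>\<phi>\<close> is \<open>(K, \<epsilon>)\<close>-invariant
  for some small \<open>t\<close>. Property (T) yields a nonzero invariant vector. In terms of the group this is a
  sequence of finitely supported coefficients \<open>f i : G \<rightarrow> \<complex>\<close> that is Cauchy and asymptotically
  invariant, but not null, for the form given by \<open>\<phi>\<close> (\<open>kazhdan_invariant_coefficients\<close>).

  Along a fast subsequence the sums \<open>\<Sum>h. f i h * exp (- t * d (orb h \<omega>, y))\<close> converge, for almost every
  \<open>\<omega> \<in> E\<close> and uniformly in \<open>y\<close>, to the required function \<open>u \<omega> y\<close>. The estimate behind this is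
  \<open>U_le_Q\<close>: such a sum is at every point \<open>y\<close> bounded by the seminorm of the coefficients, because the
  kernel remains positive definite when \<open>y\<close> is added to the orbit. Being a uniform limit of functions
  that tend to 0 at infinity, \<open>u \<omega>\<close> has bounded level sets; asymptotic invariance of the coefficients makes
  \<open>u\<close> equivariant; and as the coefficients are not null, \<open>u \<omega>\<close> does not vanish on the orbit for a set of \<open>\<omega>\<close>
  of positive measure. Cutting \<open>|u \<omega>|\<close> at half its supremum over the orbit gives bounded nonempty sets on an
  almost invariant part of \<open>E\<close> of positive measure (\<open>field_on_positive_part\<close>), and countably many such
  parts exhaust \<open>\<Omega>\<close> (\<open>carries_field_full\<close>).

  Two points need care since \<open>X\<close> may be nonseparable and the cocycle is merely measurable. First, \<open>\<phi>\<close> has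
  to be continuous for its GNS representation to be strongly continuous. The function
  \<open>\<tau> g = \<integral> min 1 (d (x0, orb g \<omega>)) d\<omega>\<close> is subadditive, so by the theorem of Pettis (\<open>pettis\<close>) it is
  small near the identity as soon as its sublevel sets are not meager. If one of them were meager, a Cantor
  scheme would give a measurable uncountable family in \<open>G\<close> whose differences avoid it; but a measurable
  function on a standard probability space cannot keep uncountably many of its sections uniformly apart.
  Second, this last step and the measurability of the graph of \<open>f\<close> rest on
  \<open>essentially_separably_valued\<close>: a Borel map from a standard probability space to any metric space
  almost surely takes its values in a separable subset.
\<close>


section \<open>The exponential kernel of a median space\<close>

text \<open>
  Membership in an interval is written as a ternary relation because most arguments chain
  several intervals.
\<close>

definition between :: "'x::metric_space \<Rightarrow> 'x \<Rightarrow> 'x \<Rightarrow> bool" where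
  "between a c b \<longleftrightarrow> dist a b = dist a c + dist c b"

lemma between_commute: "between a c b \<longleftrightarrow> between b c a"
  unfolding between_def by (auto simp: dist_commute)

lemma between_chain:
  assumes "between a x c" "between x y c"
  shows "between a x y" "between a y c"
  using assms dist_triangle[of a y x] dist_triangle[of a c y] unfolding between_def by linarith+

lemma between_ends [simp]: "between a a b" "between a b b"
  by (auto simp: between_def)

definition median :: "'x::metric_space \<Rightarrow> 'x \<Rightarrow> 'x \<Rightarrow> 'x" where
  "median x y z = (THE m. between x m y \<and> between x m z \<and> between y m z)"

lemma median_ex1:
  assumes "median_space TYPE('x::metric_space)"
  shows "\<exists>!m::'x. between x m y \<and> between x m z \<and> between y m z"
proof -
  obtain m where "metric_interval x y \<inter> metric_interval x z \<inter> metric_interval y z = {m}"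
    using assms unfolding median_space_def by blast
  then have "\<forall>c. (between x c y \<and> between x c z \<and> between y c z) \<longleftrightarrow> c = m"
    unfolding metric_interval_def between_def by blast
  then show ?thesis by metis
qed

context
  assumes med: "median_space TYPE('x::metric_space)"
begin

lemma median_between:
  "between x (median x y z) y" "between x (median x y z) z" "between y (median x y (z::'x)) z"
  using theI'[OF median_ex1[OF med, of x y z]] unfolding median_def by auto

lemma median_unique:
  "between x m y \<Longrightarrow> between x m z \<Longrightarrow> between y m (z::'x) \<Longrightarrow> median x y z = m"
  using median_ex1[OF med, of x y z] median_between[where x=x and y=y and z=z] by blast

text \<open>
  The points \<open>a\<close>, \<open>i\<close>, \<open>b\<close>, \<open>j\<close> are the corners of a rectangle with diagonals \<open>a\<close>, \<open>b\<close> and \<open>i\<close>, \<open>j\<close>.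
  Applied at both \<open>i\<close> and \<open>j\<close>, the lemma puts the median of \<open>a\<close>, \<open>b\<close>, \<open>n\<close> on the intervals from \<open>n\<close>
  to \<open>i\<close> and to \<open>j\<close>; as \<open>n\<close> is itself between \<open>i\<close> and \<open>j\<close>, that median is \<open>n\<close>, which is
  \<open>rectangle_between\<close>.
\<close>

lemma rectangle_half:
  fixes a b i j n :: 'x
  assumes r: "between a i b" "between a j b" "between i a j" "between i b j" "between i n j"
  shows "between i (median a b n) n"
proof -
  define a1 where "a1 = median i a n"
  define b1 where "b1 = median i b n"
  define t where "t = median a1 b1 j"
  note A = median_between[where x=i and y=a and z=n, folded a1_def]
  note B = median_between[where x=i and y=b and z=n, folded b1_def]
  note T = median_between[where x=a1 and y=b1 and z=j, folded t_def]
  have a1j: "between a1 n j" and ia1j: "between i a1 j"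
    using between_chain[of j n i a1] A(2) r(5) by (auto simp: between_commute)
  have b1j: "between b1 n j" and ib1j: "between i b1 j"
    using between_chain[of j n i b1] B(2) r(5) by (auto simp: between_commute)
  have ab1: "between a1 i b" "between a a1 b"
    using between_chain[of b i a a1] A(1) r(1) by (auto simp: between_commute)
  have ab2: "between a1 b1 b"
    using between_chain[of a1 i b b1] ab1 B(1) by (auto simp: between_commute)
  have tab: "between a t b"
    using between_chain[of b b1 a1 t] ab2 T(1) between_chain(2)[of a a1 b t] ab1
    by (auto simp: between_commute)
  \<comment> \<open>The median of \<open>a1\<close>, \<open>b1\<close> and \<open>n\<close> is also the median of \<open>a1\<close>, \<open>b1\<close> and \<open>j\<close>.\<close>
  define t' where "t' = median a1 b1 n"
  note T' = median_between[where x=a1 and y=b1 and z=n, folded t'_def]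
  have "between a1 t' j" using between_chain(2)[of j n a1 t'] a1j T'(2) by (auto simp: between_commute)
  moreover have "between b1 t' j" using between_chain(2)[of j n b1 t'] b1j T'(3) by (auto simp: between_commute)
  ultimately have "t' = t" using T'(1) median_unique unfolding t_def by metis
  then have "between a1 t n" "between b1 t n" using T' by auto
  moreover have "between a t n"
    using between_chain(2)[of a a1 n t] A(3) \<open>between a1 t n\<close> by auto
  moreover have "between b t n"
    using between_chain(2)[of b b1 n t] B(3) \<open>between b1 t n\<close> by auto
  moreover have "between i t n"
    using between_chain(2)[of i a1 n t] A(2) \<open>between a1 t n\<close> by auto
  ultimately show ?thesis using tab median_unique by metis
qed

lemma rectangle_between:
  fixes a b i j n :: 'x
  assumes r: "between a i b" "between a j b" "between i a j" "between i b j" "between i n j"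
  shows "between a n b"
proof -
  have 1: "between i (median a b n) n" by (rule rectangle_half[OF r])
  have 2: "between j (median a b n) n"
    by (rule rectangle_half[of a j b i]) (use r in \<open>auto simp: between_commute\<close>)
  have "dist (median a b n) n = 0"
    using 1 2 r(5) dist_triangle[of i j "median a b n"] zero_le_dist[of "median a b n" n]
    unfolding between_def by (simp add: dist_commute)
  then show ?thesis using median_between(1)[where x=a and y=b and z=n] by auto
qed

text \<open>
  The median \<open>n\<close> of \<open>i\<close>, \<open>j\<close>, \<open>v\<close> is between \<open>i\<close> and \<open>j\<close>, hence also between \<open>a\<close> and \<open>b\<close>. A route
  through \<open>n\<close> shows that the sum for the diagonal \<open>a\<close>, \<open>b\<close> is at most that for \<open>i\<close>, \<open>j\<close>, and the
  diagonals may be exchanged.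
\<close>

lemma rectangle_dist:
  fixes a b i j v :: 'x
  assumes r: "between a i b" "between a j b" "between i a j" "between i b j"
  shows "dist i v + dist j v = dist a v + dist b v"
proof -
  have le: "dist a v + dist b v \<le> dist i v + dist j v"
    if r: "between a i b" "between a j b" "between i a j" "between i b j" for a b i j :: 'x
  proof -
    define n where "n = median i j v"
    note N = median_between[where x=i and y=j and z=v, folded n_def]
    have "between a n b" using rectangle_between[OF r N(1)] .
    then show ?thesis
      using N r dist_triangle[of a v n] dist_triangle[of b v n] unfolding between_def
      by (simp add: dist_commute)
  qed
  show ?thesis using le[OF r] le[OF r(3,4,1,2)] by linarith
qed

text \<open>
  A median space is ordered from each root \<open>p\<close>: \<open>x\<close> is below \<open>y\<close> when \<open>x\<close> lies between \<open>p\<close> and \<open>y\<close>.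
  The median with \<open>p\<close> is the meet of this order.
\<close>

definition meet :: "'x \<Rightarrow> 'x \<Rightarrow> 'x \<Rightarrow> 'x" where "meet p x y = median p x y"

lemma meet_below: "between p (meet p x y) x" "between p (meet p x y) y" "between x (meet p x y) y"
  unfolding meet_def by (rule median_between)+

lemma meet_greatest:
  assumes "between p z x" "between p z y"
  shows "between p z (meet p x y)"
proof -
  define m where "m = median z x y"
  note M = median_between[where x=z and y=x and z=y, folded m_def]
  have "between p z m" "between p m x" using between_chain[OF assms(1) M(1)] by auto
  moreover have "between p m y" using between_chain[OF assms(2) M(2)] by auto
  ultimately show ?thesis using M(3) median_unique unfolding meet_def by metis
qed

lemma between_antisym: "between p x y \<Longrightarrow> between p y x \<Longrightarrow> x = (y::'x)"
  unfolding between_def by (metis add_cancel_left_right add_le_same_cancel1 dist_commute dist_eq_0_iff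
      dist_le_zero_iff le_add_same_cancel1 zero_le_dist)

lemma between_trans: "between p x y \<Longrightarrow> between p y z \<Longrightarrow> between p x (z::'x)"
  using between_chain(2)[of z y p x] by (simp add: between_commute)

lemma between_meet_iff: "between p z (meet p x y) \<longleftrightarrow> between p z x \<and> between p z y"
  using meet_below[where p=p and x=x and y=y] meet_greatest between_trans by blast

lemma semilattice_meet: "semilattice (meet p)"
proof
  show "meet p (meet p a b) c = meet p a (meet p b c)" for a b c
    by (rule between_antisym[of p]) (meson between_meet_iff between_ends)+
  show "meet p a b = meet p b a" for a b
    by (rule between_antisym[of p]) (meson between_meet_iff between_ends)+
  show "meet p a a = a" for a
    by (rule between_antisym[of p]) (meson between_meet_iff between_ends)+
qed

text \<open>
  Thus the distance from \<open>p\<close> to the meet is the Gromov product of \<open>x\<close> and \<open>y\<close> at \<open>p\<close>.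
\<close>

lemma dist_meet: "dist x y = dist p x + dist p y - 2 * dist p (meet p x y)"
  using meet_below[where p=p and x=x and y=y] dist_commute[of "meet p x y" x] unfolding between_def by linarith

text \<open>
  Two elements with a common upper bound have a join \<open>j\<close>, and \<open>a\<close>, \<open>b\<close> are opposite corners of a rectangle
  whose other corners are their meet and \<open>j\<close>. Modularity of the Gromov product follows from
  \<open>rectangle_dist\<close>.
\<close>

lemma ex_join_distrib:
  assumes "between p a z" "between p b z"
  obtains j where "between p a j" "between p b j" "between p j z"
    "\<And>u. dist p (meet p j u) = dist p (meet p a u) + dist p (meet p b u) - dist p (meet p (meet p a b) u)"
proof -
  define j where "j = median a b z"
  note J = median_between[where x=a and y=b and z=z, folded j_def]
  define i where "i = meet p a b"
  note I = meet_below[where p=p and x=a and y=b, folded i_def]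
  have aj: "between p a j" "between p j z" using between_chain[OF assms(1) J(2)] by auto
  have bj: "between p b j" using between_chain[OF assms(2) J(3)] by auto
  have "between i a j" using between_chain(1)[of j a p i] aj I by (simp add: between_commute)
  moreover have "between i b j" using between_chain(1)[of j b p i] bj I by (simp add: between_commute)
  ultimately have rd: "dist i v + dist j v = dist a v + dist b v" for v
    using rectangle_dist[OF I(3) J(1)] by blast
  have "dist p (meet p j u) = dist p (meet p a u) + dist p (meet p b u) - dist p (meet p i u)" for u
    using rd[of u] rd[of p] dist_meet[of j u p] dist_meet[of a u p] dist_meet[of b u p] dist_meet[of i u p]
    by (simp add: dist_commute)
  then show ?thesis using that[of j] aj bj unfolding i_def by blast
qed

text \<open>
  Finitely generated semilattices are finite: adjoining \<open>x\<close> to a finite meet-closed set \<open>S\<close> adds only \<open>x\<close>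
  and the meets of \<open>x\<close> with elements of \<open>S\<close>.
\<close>

lemma finite_meet_closure:
  assumes "finite P"
  shows "\<exists>S. finite S \<and> P \<subseteq> S \<and> (\<forall>x\<in>S. \<forall>y\<in>S. meet p x y \<in> S)"
  using assms
proof induction
  case (insert x P)
  interpret semilattice "meet p" by (rule semilattice_meet)
  obtain S where S: "finite S" "P \<subseteq> S" "\<And>x y. x \<in> S \<Longrightarrow> y \<in> S \<Longrightarrow> meet p x y \<in> S"
    using insert by blast
  define S' where "S' = S \<union> {x} \<union> (\<lambda>s. meet p s x) ` S"
  have a: "meet p (meet p s x) (meet p t x) = meet p (meet p s t) x" for s t
    by (simp add: assoc left_commute)
  have b: "meet p (meet p s x) t = meet p (meet p s t) x" for s t
    by (simp add: assoc commute[of x])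
  have "meet p u v \<in> S'" if "u \<in> S'" "v \<in> S'" for u v
  proof -
    have S'_iff: "y \<in> S' \<longleftrightarrow> y \<in> S \<or> y = x \<or> (\<exists>s\<in>S. y = meet p s x)" for y
      by (auto simp: S'_def)
    have c: "meet p x s = meet p s x" "meet p (meet p s x) x = meet p s x" for s
      by (rule commute) (simp add: assoc)
    have d: "meet p t (meet p s x) = meet p (meet p t s) x" for s t by (simp add: assoc)
    have m: "meet p s x \<in> S'" if "s \<in> S" for s using that S'_iff by blast
    have l: "meet p s v \<in> S'" if "s \<in> S" for s
      using \<open>v \<in> S'\<close>[unfolded S'_iff] that S(3) m d by (auto simp: S'_iff)
    have r: "meet p x v \<in> S'"
      using \<open>v \<in> S'\<close>[unfolded S'_iff] c m by (auto simp: S'_iff)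
    have "meet p (meet p s x) v \<in> S'" if "s \<in> S" for s
      using \<open>v \<in> S'\<close>[unfolded S'_iff]
    proof (elim disjE bexE)
      assume "v \<in> S" then show ?thesis using b m S(3) that by simp
    next
      assume "v = x" then show ?thesis using c m that by simp
    next
      fix t assume "t \<in> S" "v = meet p t x" then show ?thesis using a m S(3) that by simp
    qed
    then show ?thesis using \<open>u \<in> S'\<close>[unfolded S'_iff] l r by auto
  qed
  moreover have "finite S'" "insert x P \<subseteq> S'" using S by (auto simp: S'_def)
  ultimately show ?case by blast
qed auto

text \<open>
  Moebius inversion on a finite set: distribute the distance from \<open>p\<close> over the elements below a point. The
  masses are chosen inductively, the element farthest from \<open>p\<close> last, since it is below no other one.
\<close>

lemma ex_moebius:
  assumes "finite T"
  shows "\<exists>g. \<forall>x\<in>T. dist p (x::'x) = (\<Sum>w | w \<in> T \<and> between p w x. g w)"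
  using assms
proof (induction "card T" arbitrary: T)
  case (Suc n T)
  then have ne: "T \<noteq> {}" "finite T" by auto
  obtain x where x: "x \<in> T" "\<And>w. w \<in> T \<Longrightarrow> dist p w \<le> dist p x"
  proof -
    have "Max (dist p ` T) \<in> dist p ` T" using ne by (intro Max_in) auto
    then obtain x where "x \<in> T" "Max (dist p ` T) = dist p x" by auto
    moreover have "dist p w \<le> Max (dist p ` T)" if "w \<in> T" for w using ne that by (intro Max_ge) auto
    ultimately show ?thesis using that by metis
  qed
  have mx: "w = x" if "w \<in> T" "between p x w" for w
    using x(2)[OF that(1)] that(2) zero_le_dist[of x w] unfolding between_def by simp
  obtain g where g: "\<forall>y\<in>T-{x}. dist p y = (\<Sum>w | w \<in> T-{x} \<and> between p w y. g w)"
  proof -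
    have "n = card (T - {x})" "finite (T - {x})" using Suc.hyps(2) x(1) ne(2) by auto
    from Suc.hyps(1)[OF this] show ?thesis using that by blast
  qed
  define g' where "g' = g(x := dist p x - (\<Sum>w | w \<in> T-{x} \<and> between p w x. g w))"
  have "dist p y = (\<Sum>w | w \<in> T \<and> between p w y. g' w)" if "y \<in> T" for y
  proof (cases "y = x")
    case True
    have "{w. w \<in> T \<and> between p w x} = insert x {w. w \<in> T-{x} \<and> between p w x}" using x by auto
    then have "(\<Sum>w | w \<in> T \<and> between p w x. g' w) = g' x + (\<Sum>w | w \<in> T-{x} \<and> between p w x. g' w)"
      using ne by simp
    also have "(\<Sum>w | w \<in> T-{x} \<and> between p w x. g' w) = (\<Sum>w | w \<in> T-{x} \<and> between p w x. g w)"
      by (rule sum.cong) (auto simp: g'_def)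
    finally show ?thesis using True by (simp add: g'_def)
  next
    case False
    then have "{w. w \<in> T \<and> between p w y} = {w. w \<in> T-{x} \<and> between p w y}" using mx that by blast
    moreover have "(\<Sum>w | w \<in> T-{x} \<and> between p w y. g' w) = (\<Sum>w | w \<in> T-{x} \<and> between p w y. g w)"
      by (rule sum.cong) (auto simp: g'_def)
    ultimately show ?thesis using g that False by simp
  qed
  then show ?case by blast
qed auto

text \<open>
  The mass of the elements that are below \<open>u\<close> and below some member of \<open>V\<close> is computed by
  inclusion and exclusion; bounded subsets have joins, and modularity lets the join \<open>j\<close> of \<open>V\<close> account for the
  union of the down-sets.
\<close>

lemma moebius_union:
  assumes S: "finite S" "\<And>x y. x \<in> S \<Longrightarrow> y \<in> S \<Longrightarrow> meet p x y \<in> S"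
    and g: "\<And>x. x \<in> S \<Longrightarrow> dist p (x::'x) = (\<Sum>w | w \<in> S \<and> between p w x. g w)"
    and V: "finite V" "V \<subseteq> S" "\<And>v. v \<in> V \<Longrightarrow> between p v z"
  shows "\<exists>j. between p j z \<and> (\<forall>u\<in>S. (\<Sum>w | w \<in> S \<and> between p w u \<and> (\<exists>v\<in>V. between p w v). g w) = dist p (meet p j u))"
  using V
proof (induction V)
  case empty
  have "meet p p u = p" for u unfolding meet_def by (rule median_unique) auto
  then show ?case by (intro exI[of _ p]) auto
next
  case (insert v V)
  interpret semilattice "meet p" by (rule semilattice_meet)
  obtain j where j: "between p j z" "\<And>u. u \<in> S \<Longrightarrow>
      (\<Sum>w | w \<in> S \<and> between p w u \<and> (\<exists>v\<in>V. between p w v). g w) = dist p (meet p j u)"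
    using insert by auto
  have v: "between p v z" "v \<in> S" using insert by auto
  obtain j' where j': "between p j' z" "\<And>u. dist p (meet p j' u) =
      dist p (meet p j u) + dist p (meet p v u) - dist p (meet p (meet p j v) u)"
    using ex_join_distrib[OF j(1) v(1)] by metis
  have "(\<Sum>w | w \<in> S \<and> between p w u \<and> (\<exists>v\<in>insert v V. between p w v). g w) = dist p (meet p j' u)"
    if u: "u \<in> S" for u
  proof -
    let ?A = "{w \<in> S. between p w u \<and> (\<exists>v\<in>V. between p w v)}"
    let ?B = "{w \<in> S. between p w (meet p v u)}"
    have "{w \<in> S. between p w u \<and> (\<exists>v\<in>insert v V. between p w v)} = ?A \<union> ?B"
      by (auto simp: between_meet_iff)
    moreover have "?A \<inter> ?B = {w \<in> S. between p w (meet p v u) \<and> (\<exists>v\<in>V. between p w v)}"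
      by (auto simp: between_meet_iff)
    moreover have "sum g (?A \<union> ?B) = sum g ?A + sum g ?B - sum g (?A \<inter> ?B)"
      using S(1) by (simp add: sum_Un)
    moreover have "sum g ?A = dist p (meet p j u)" using j(2)[OF u] by simp
    moreover have "sum g ?B = dist p (meet p v u)" using g[OF S(2)[OF v(2) u]] by simp
    moreover have "sum g {w \<in> S. between p w (meet p v u) \<and> (\<exists>v\<in>V. between p w v)} = dist p (meet p (meet p j v) u)"
      using j(2)[OF S(2)[OF v(2) u]] by (simp add: assoc)
    ultimately show ?thesis using j'(2)[of u] by simp
  qed
  then show ?case using j'(1) by blast
qed

text \<open>
  The mass strictly below \<open>z\<close> is the distance from \<open>p\<close> to some point below \<open>z\<close>, so it does not exceed the
  distance from \<open>p\<close> to \<open>z\<close>; the difference of the two is \<open>g z\<close>.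
\<close>

lemma moebius_nonneg:
  assumes S: "finite S" "\<And>x y. x \<in> S \<Longrightarrow> y \<in> S \<Longrightarrow> meet p x y \<in> S"
    and g: "\<And>x. x \<in> S \<Longrightarrow> dist p (x::'x) = (\<Sum>w | w \<in> S \<and> between p w x. g w)"
    and z: "z \<in> S"
  shows "0 \<le> g z"
proof -
  define V where "V = {v \<in> S. between p v z \<and> v \<noteq> z}"
  obtain j where j: "between p j z" "(\<Sum>w | w \<in> S \<and> between p w z \<and> (\<exists>v\<in>V. between p w v). g w) = dist p (meet p j z)"
  proof -
    have "finite V" "V \<subseteq> S" "\<And>v. v \<in> V \<Longrightarrow> between p v z" using S(1) by (auto simp: V_def)
    from moebius_union[OF S g this] show ?thesis using z that by blast
  qed
  have e: "{w \<in> S. between p w z \<and> (\<exists>v\<in>V. between p w v)} = V"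
  proof -
    have "w \<noteq> z" if "between p w v" "v \<in> V" for w v
      using that between_antisym[of p v z] unfolding V_def by auto
    then show ?thesis unfolding V_def by auto
  qed
  have "{w \<in> S. between p w z} = insert z V" using z by (auto simp: V_def)
  moreover have "finite V" "z \<notin> V" using S by (auto simp: V_def)
  ultimately have "dist p z = g z + sum g V" using g[OF z] by simp
  moreover have "dist p (meet p j z) \<le> dist p z"
    using meet_below(2)[where p=p and x=j and y=z] unfolding between_def by simp
  ultimately show ?thesis using j(2) e by simp
qed

text \<open>
  Up to factors that depend on one variable, the kernel is \<open>exp (2 * t * dist p (meet p x y))\<close>. Writing the
  exponent as the total mass of the \<open>w\<close> below both points turns this into the product over \<open>w\<close> of
  \<open>1 + e w * [w below x] * [w below y]\<close> with \<open>e w = exp (2 * t * g w) - 1 \<ge> 0\<close>. Expanded, it is a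
  nonnegative combination of kernels of rank one.
\<close>

lemma exp_neg_dist_posdef:
  fixes q :: "'i \<Rightarrow> 'x" and c :: "'i \<Rightarrow> complex" and t :: real
  assumes I: "finite I" and t: "0 \<le> t"
  shows "0 \<le> Re (\<Sum>i\<in>I. \<Sum>j\<in>I. c i * cnj (c j) * of_real (exp (- t * dist (q i) (q j))))"
proof (cases "I = {}")
  case False
  define p where "p = q (SOME i. i \<in> I)"
  from finite_meet_closure[OF finite_imageI[OF I, of q], of p]
  obtain S where S0: "finite S \<and> q ` I \<subseteq> S \<and> (\<forall>x\<in>S. \<forall>y\<in>S. meet p x y \<in> S)" ..
  then have S: "finite S" "q ` I \<subseteq> S" "\<And>x y. x \<in> S \<Longrightarrow> y \<in> S \<Longrightarrow> meet p x y \<in> S"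
    by simp_all
  obtain g where g: "\<And>x. x \<in> S \<Longrightarrow> dist p x = (\<Sum>w | w \<in> S \<and> between p w x. g w)"
    using ex_moebius[OF S(1)] by metis
  define e where "e w = exp (2 * t * g w) - 1" for w
  have e0: "0 \<le> e w" if "w \<in> S" for w
    using moebius_nonneg[OF S(1) S(3) g that] t by (simp add: e_def)
  define ind :: "'x set \<Rightarrow> 'x \<Rightarrow> real" where "ind A x = (\<Prod>w\<in>A. of_bool (between p w x))" for A x
  define E where "E A = (\<Prod>w\<in>A. e w)" for A
  have E0: "0 \<le> E A" if "A \<subseteq> S" for A using that e0 unfolding E_def by (auto intro: prod_nonneg)
  have k: "exp (- t * dist x y) = (\<Sum>A\<in>Pow S. E A * (exp (-t * dist p x) * ind A x) * (exp (-t * dist p y) * ind A y))"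
    if "x \<in> S" "y \<in> S" for x y
  proof -
    have "exp (2 * t * dist p (meet p x y)) = exp (\<Sum>w\<in>S. 2 * t * g w * of_bool (between p w x \<and> between p w y))"
      using g[OF S(3)[OF that]] S(1)
      by (simp add: between_meet_iff sum_distrib_left of_bool_def if_distrib sum.If_cases Int_def cong: if_cong)
    also have "\<dots> = (\<Prod>w\<in>S. exp (2 * t * g w * of_bool (between p w x \<and> between p w y)))"
      using S(1) by (rule exp_sum)
    also have "\<dots> = (\<Prod>w\<in>S. e w * of_bool (between p w x) * of_bool (between p w y) + 1)"
      by (rule prod.cong) (auto simp: e_def)
    also have "\<dots> = (\<Sum>A\<in>Pow S. E A * ind A x * ind A y)"
      using S(1) by (simp add: prod_add E_def ind_def prod.distrib)
    finally have "exp (2 * t * dist p (meet p x y)) = (\<Sum>A\<in>Pow S. E A * ind A x * ind A y)" .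
    moreover have "exp (- t * dist x y) = exp (-t * dist p x) * exp (-t * dist p y) * exp (2 * t * dist p (meet p x y))"
      unfolding mult_exp_exp dist_meet[of x y p] by (simp add: algebra_simps)
    ultimately show ?thesis by (simp add: sum_distrib_left mult_ac)
  qed
  define b where "b A i = c i * of_real (exp (-t * dist p (q i)) * ind A (q i))" for A i
  define B where "B A = (\<Sum>i\<in>I. b A i)" for A
  have BB: "(\<Sum>i\<in>I. \<Sum>j\<in>I. b A i * cnj (b A j)) = B A * cnj (B A)" for A
    unfolding B_def cnj_sum sum_product ..
  have "(\<Sum>i\<in>I. \<Sum>j\<in>I. c i * cnj (c j) * of_real (exp (- t * dist (q i) (q j))))
      = (\<Sum>i\<in>I. \<Sum>j\<in>I. \<Sum>A\<in>Pow S. of_real (E A) * (b A i * cnj (b A j)))"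
  proof (intro sum.cong refl)
    fix i j assume "i \<in> I" "j \<in> I"
    then have "q i \<in> S" "q j \<in> S" using S by auto
    show "c i * cnj (c j) * of_real (exp (- t * dist (q i) (q j))) = (\<Sum>A\<in>Pow S. of_real (E A) * (b A i * cnj (b A j)))"
      unfolding k[OF \<open>q i \<in> S\<close> \<open>q j \<in> S\<close>] b_def of_real_sum sum_distrib_left by (intro sum.cong refl) simp
  qed
  also have "\<dots> = (\<Sum>A\<in>Pow S. \<Sum>i\<in>I. \<Sum>j\<in>I. of_real (E A) * (b A i * cnj (b A j)))"
    by (subst sum.swap[of _ I "Pow S"], intro sum.cong refl, rule sum.swap)
  also have "\<dots> = (\<Sum>A\<in>Pow S. of_real (E A) * (B A * cnj (B A)))"
    unfolding BB[symmetric] sum_distrib_left ..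
  finally have eq: "(\<Sum>i\<in>I. \<Sum>j\<in>I. c i * cnj (c j) * of_real (exp (- t * dist (q i) (q j))))
      = (\<Sum>A\<in>Pow S. of_real (E A) * (B A * cnj (B A)))" .
  have "Re (of_real (E A) * (B A * cnj (B A))) = E A * (cmod (B A))\<^sup>2" for A
    unfolding complex_norm_square[symmetric] by simp
  moreover have "0 \<le> (\<Sum>A\<in>Pow S. E A * (cmod (B A))\<^sup>2)"
    using E0 by (intro sum_nonneg mult_nonneg_nonneg) auto
  ultimately show ?thesis unfolding eq Re_sum by (simp only:)
qed simp

end


section \<open>Completing a pre-Hilbert space inside the complex sequences\<close>

text \<open>
  The record type of modules extends that of rings, but a vector space has no multiplication or unit;
  these fields stay unspecified.
\<close>

definition function_module :: "('i \<Rightarrow> complex) set \<Rightarrow> (complex, 'i \<Rightarrow> complex) module" where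
  "function_module C = \<lparr>carrier = C, mult = undefined, one = undefined, zero = (\<lambda>_. 0),
     add = (\<lambda>f g i. f i + g i), smult = (\<lambda>c f i. c * f i)\<rparr>"

lemma function_module_simps [simp]:
  "carrier (function_module C) = C" "\<zero>\<^bsub>function_module C\<^esub> = (\<lambda>_. 0)"
  "f \<oplus>\<^bsub>function_module C\<^esub> g = (\<lambda>i. f i + g i)" "c \<odot>\<^bsub>function_module C\<^esub> f = (\<lambda>i. c * f i)"
  by (simp_all add: function_module_def)

lemma complex_ring_simps [simp]:
  "carrier complex_ring = UNIV" "\<zero>\<^bsub>complex_ring\<^esub> = 0" "\<one>\<^bsub>complex_ring\<^esub> = 1"
  "x \<oplus>\<^bsub>complex_ring\<^esub> y = x + y" "x \<otimes>\<^bsub>complex_ring\<^esub> y = x * y"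
  by (simp_all add: complex_ring_def)

lemma cring_complex_ring: "cring complex_ring"
proof (rule cringI)
  show "abelian_group complex_ring"
    by (rule abelian_groupI) (auto simp: algebra_simps intro: exI[of _ "- x" for x :: complex] left_minus)
  show "comm_monoid complex_ring" by (rule comm_monoidI) (auto simp: algebra_simps)
qed (auto simp: algebra_simps)

lemma function_module:
  assumes C0: "(\<lambda>_. 0) \<in> C" and Ca: "\<And>f g. f \<in> C \<Longrightarrow> g \<in> C \<Longrightarrow> (\<lambda>i. f i + g i) \<in> C"
    and Cs: "\<And>c f. f \<in> C \<Longrightarrow> (\<lambda>i. c * f i) \<in> C"
  shows "Module.module complex_ring (function_module C)"
    and "f \<in> C \<Longrightarrow> g \<in> C \<Longrightarrow> f \<ominus>\<^bsub>function_module C\<^esub> g = (\<lambda>i. f i - g i)"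
proof -
  have ab: "abelian_group (function_module C)"
  proof (rule abelian_groupI)
    fix f assume "f \<in> carrier (function_module C)"
    then have "(\<lambda>i. - f i) \<in> C" using Cs[of f "-1"] by simp
    then show "\<exists>y\<in>carrier (function_module C). y \<oplus>\<^bsub>function_module C\<^esub> f = \<zero>\<^bsub>function_module C\<^esub>"
      by (intro bexI[of _ "\<lambda>i. - f i"]) auto
  qed (use C0 Ca in \<open>auto simp: algebra_simps\<close>)
  show "Module.module complex_ring (function_module C)"
    by (rule Module.moduleI[OF cring_complex_ring ab]) (use Cs in \<open>auto simp: algebra_simps\<close>)
  assume fg: "f \<in> C" "g \<in> C"
  have "\<ominus>\<^bsub>function_module C\<^esub> g = (\<lambda>i. - g i)"
    using fg Cs[of g "-1"] by (intro abelian_group.minus_equality[OF ab]) auto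
  then show "f \<ominus>\<^bsub>function_module C\<^esub> g = (\<lambda>i. f i - g i)" by (simp add: a_minus_def)
qed

text \<open>
  The form may be degenerate, so that \<open>q\<close> below is only a seminorm. No quotient is taken: null vectors
  disappear in the completion.
\<close>

locale pre_hilbert =
  fixes sm :: "complex \<Rightarrow> 'v::ab_group_add \<Rightarrow> 'v" and B :: "'v \<Rightarrow> 'v \<Rightarrow> complex"
  assumes B_add: "B (x + y) z = B x z + B y z"
    and B_sm: "B (sm c x) y = c * B x y"
    and B_comm: "B x y = cnj (B y x)"
    and B_pos: "0 \<le> Re (B x x)"
begin

definition q :: "'v \<Rightarrow> real" where "q x = sqrt (Re (B x x))"

lemma B_zero: "B 0 y = 0" using B_add[of 0 0 y] by simp
lemma B_uminus: "B (- x) y = - B x y" using B_add[of x "- x" y] B_zero by (simp add: eq_neg_iff_add_eq_0 add.commute)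
lemma B_diff: "B (x - y) z = B x z - B y z" using B_add[of x "- y" z] B_uminus by simp
lemma B_add2: "B z (x + y) = B z x + B z y" using B_add B_comm by (metis complex_cnj_add)
lemma B_uminus2: "B y (- x) = - B y x" using B_uminus B_comm by (metis complex_cnj_minus)
lemma B_diff2: "B z (x - y) = B z x - B z y" using B_diff B_comm by (metis complex_cnj_diff)
lemma B_sm2: "B x (sm c y) = cnj c * B x y" using B_sm B_comm by (metis complex_cnj_mult)

lemma B_self: "B x x = of_real ((q x)\<^sup>2)"
proof -
  have "Im (B x x) = 0" using arg_cong[OF B_comm[of x x], of Im] by simp
  then show ?thesis using B_pos by (simp add: complex_eq_iff q_def)
qed

lemma q_nonneg [simp]: "0 \<le> q x" by (simp add: q_def B_pos)

lemma q_uminus [simp]: "q (- x) = q x" by (simp add: q_def B_uminus B_uminus2)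
lemma q_commute: "q (x - y) = q (y - x)" using q_uminus[of "x - y"] by simp
lemma q_zero [simp]: "q 0 = 0" by (simp add: q_def B_zero)

lemma cauchy_schwarz: "cmod (B x y) \<le> q x * q y"
proof -
  define c where "c = B x y"
  \<comment> \<open>The quadratic polynomial in the real parameter \<open>s\<close> that arises from \<open>x - s * B x y * y\<close>.\<close>
  have main: "0 \<le> (q x)\<^sup>2 - 2 * s * (cmod c)\<^sup>2 + s\<^sup>2 * (cmod c)\<^sup>2 * (q y)\<^sup>2" for s :: real
  proof -
    define t where "t = of_real s * c"
    have "B (x - sm t y) (x - sm t y) = B x x - cnj t * c - t * cnj c + t * cnj t * B y y"
      using B_comm[of y x] by (simp add: B_diff B_diff2 B_sm B_sm2 c_def algebra_simps)
    also have "\<dots> = of_real ((q x)\<^sup>2 - 2 * s * (cmod c)\<^sup>2 + s\<^sup>2 * (cmod c)\<^sup>2 * (q y)\<^sup>2)"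
    proof -
      have cc: "c * cnj c = of_real ((cmod c)\<^sup>2)" by (rule complex_norm_square[symmetric])
      have "cnj t * c = of_real (s * (cmod c)\<^sup>2)" "t * cnj c = of_real (s * (cmod c)\<^sup>2)"
        "t * cnj t = of_real (s\<^sup>2 * (cmod c)\<^sup>2)"
        unfolding t_def of_real_mult cc[symmetric] by (simp_all add: power2_eq_square mult_ac)
      then show ?thesis unfolding B_self by simp
    qed
    finally show ?thesis using B_pos[of "x - sm t y"] by simp
  qed
  have "(cmod c)\<^sup>2 \<le> (q x)\<^sup>2 * (q y)\<^sup>2"
  proof (cases "q y = 0")
    case True
    have "(cmod c)\<^sup>2 = 0"
    proof (rule ccontr)
      assume "(cmod c)\<^sup>2 \<noteq> 0"
      then have "0 < (cmod c)\<^sup>2" by simp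
      then show False using main[of "((q x)\<^sup>2 + 1) / (2 * (cmod c)\<^sup>2)"] True by (simp add: field_simps)
    qed
    then show ?thesis using True by simp
  next
    case False
    then have p: "0 < (q y)\<^sup>2" by simp
    have "(1 / Y)\<^sup>2 * C * Y = C / Y" if "0 < Y" for Y C :: real using that by (simp add: power2_eq_square)
    from this[OF p, of "(cmod c)\<^sup>2"] have "0 \<le> (q x)\<^sup>2 - (cmod c)\<^sup>2 / (q y)\<^sup>2"
      using main[of "1 / (q y)\<^sup>2"] by simp
    then show ?thesis using p by (simp add: field_simps)
  qed
  then have "(cmod c)\<^sup>2 \<le> (q x * q y)\<^sup>2" by (simp add: power_mult_distrib)
  then show ?thesis unfolding c_def by (rule power2_le_imp_le) simp
qed

lemma q_triangle: "q (x + y) \<le> q x + q y"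
proof (rule power2_le_imp_le)
  have "(q (x + y))\<^sup>2 = (q x)\<^sup>2 + (q y)\<^sup>2 + 2 * Re (B x y)"
  proof -
    have "of_real ((q (x + y))\<^sup>2) = of_real ((q x)\<^sup>2) + of_real ((q y)\<^sup>2) + (B x y + cnj (B x y))"
      using B_comm[of y x] unfolding B_self[symmetric] by (simp add: B_add B_add2)
    then have "complex_of_real ((q (x + y))\<^sup>2) = of_real ((q x)\<^sup>2 + (q y)\<^sup>2 + 2 * Re (B x y))"
      by (simp add: complex_add_cnj)
    then show ?thesis unfolding of_real_eq_iff .
  qed
  also have "\<dots> \<le> (q x)\<^sup>2 + (q y)\<^sup>2 + 2 * (q x * q y)"
    using cauchy_schwarz[of x y] complex_Re_le_cmod[of "B x y"] by linarith
  finally show "(q (x + y))\<^sup>2 \<le> (q x + q y)\<^sup>2" by (simp add: power2_sum)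
qed simp

lemma q_diff_triangle: "q (x - z) \<le> q (x - y) + q (y - z)"
  using q_triangle[of "x - y" "y - z"] by simp

lemma q_sm: "q (sm c x) = cmod c * q x"
proof -
  have "complex_of_real ((q (sm c x))\<^sup>2) = (c * cnj c) * B x x"
    unfolding B_self[symmetric] by (simp add: B_sm B_sm2)
  also have "\<dots> = of_real ((cmod c * q x)\<^sup>2)"
    unfolding B_self complex_norm_square[symmetric] by (simp add: power_mult_distrib)
  finally have "(q (sm c x))\<^sup>2 = (cmod c * q x)\<^sup>2" unfolding of_real_eq_iff .
  then show ?thesis by (simp add: power2_eq_iff_nonneg)
qed

definition cau :: "(nat \<Rightarrow> 'v) \<Rightarrow> bool" where
  "cau X \<longleftrightarrow> (\<forall>e>0. \<exists>N. \<forall>m\<ge>N. \<forall>n\<ge>N. q (X m - X n) < e)"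

lemma cau_bounded: assumes "cau X" obtains M where "0 < M" "\<And>i. q (X i) \<le> M"
proof -
  obtain N where N: "\<And>m n. m \<ge> N \<Longrightarrow> n \<ge> N \<Longrightarrow> q (X m - X n) < 1"
    using assms unfolding cau_def by (metis zero_less_one)
  define M where "M = (\<Sum>i\<le>N. q (X i)) + 1"
  have "0 < M" unfolding M_def by (simp add: add_nonneg_pos sum_nonneg)
  moreover have "q (X i) \<le> M" for i
  proof (cases "i \<le> N")
    case True
    then have "q (X i) \<le> (\<Sum>i\<le>N. q (X i))" by (intro member_le_sum) auto
    then show ?thesis by (simp add: M_def)
  next
    case False
    then have "q (X i) \<le> 1 + q (X N)" using N[of i N] q_triangle[of "X i - X N" "X N"] by simp
    moreover have "q (X N) \<le> (\<Sum>i\<le>N. q (X i))" by (intro member_le_sum) auto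
    ultimately show ?thesis by (simp add: M_def)
  qed
  ultimately show ?thesis using that by blast
qed

lemma cau_add: assumes "cau X" "cau Y" shows "cau (\<lambda>i. X i + Y i)"
  unfolding cau_def
proof (intro allI impI)
  fix e :: real assume "0 < e"
  then obtain N1 N2 where N: "\<And>m n. m \<ge> N1 \<Longrightarrow> n \<ge> N1 \<Longrightarrow> q (X m - X n) < e / 2"
    "\<And>m n. m \<ge> N2 \<Longrightarrow> n \<ge> N2 \<Longrightarrow> q (Y m - Y n) < e / 2"
    using assms unfolding cau_def by (metis half_gt_zero)
  have "q (X m + Y m - (X n + Y n)) < e" if "m \<ge> max N1 N2" "n \<ge> max N1 N2" for m n
    using q_triangle[of "X m - X n" "Y m - Y n"] N(1)[of m n] N(2)[of m n] that by (simp add: algebra_simps)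
  then show "\<exists>N. \<forall>m\<ge>N. \<forall>n\<ge>N. q (X m + Y m - (X n + Y n)) < e" by blast
qed

lemma cau_uminus: "cau X \<Longrightarrow> cau (\<lambda>i. - X i)"
proof -
  have "- X m - - X n = - (X m - X n)" for m n by simp
  then show "cau X \<Longrightarrow> cau (\<lambda>i. - X i)" unfolding cau_def by (simp only: q_uminus)
qed

lemma cau_diff: "cau X \<Longrightarrow> cau Y \<Longrightarrow> cau (\<lambda>i. X i - Y i)"
  using cau_add[OF _ cau_uminus, of X Y] by simp

lemma cau_const: "cau (\<lambda>_. x)" unfolding cau_def by simp

lemma B_cau_convergent: assumes X: "cau X" and Y: "cau Y" shows "convergent (\<lambda>i. B (X i) (Y i))"
proof -
  obtain M where M: "0 < M" "\<And>i. q (X i) \<le> M" using cau_bounded[OF X] by metis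
  obtain L where L: "0 < L" "\<And>i. q (Y i) \<le> L" using cau_bounded[OF Y] by metis
  have "Cauchy (\<lambda>i. B (X i) (Y i))"
  proof (rule metric_CauchyI)
    fix e :: real assume e: "0 < e"
    have "0 < e / (2 * L)" "0 < e / (2 * M)" using e L M by auto
    then obtain N1 N2 where N: "\<And>m n. m \<ge> N1 \<Longrightarrow> n \<ge> N1 \<Longrightarrow> q (X m - X n) < e / (2 * L)"
      "\<And>m n. m \<ge> N2 \<Longrightarrow> n \<ge> N2 \<Longrightarrow> q (Y m - Y n) < e / (2 * M)"
      using X Y unfolding cau_def by metis
    have "dist (B (X m) (Y m)) (B (X n) (Y n)) < e" if mn: "m \<ge> max N1 N2" "n \<ge> max N1 N2" for m n
    proof -
      have "B (X m) (Y m) - B (X n) (Y n) = B (X m - X n) (Y m) + B (X n) (Y m - Y n)"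
        by (simp add: B_diff B_diff2)
      then have "dist (B (X m) (Y m)) (B (X n) (Y n)) \<le> q (X m - X n) * q (Y m) + q (X n) * q (Y m - Y n)"
        unfolding dist_norm using norm_triangle_le cauchy_schwarz by (metis add_mono)
      also have "\<dots> \<le> q (X m - X n) * L + M * q (Y m - Y n)"
        using L M by (intro add_mono mult_left_mono mult_right_mono) auto
      also have "\<dots> < e / (2 * L) * L + M * (e / (2 * M))"
        using N(1)[of m n] N(2)[of m n] mn L(1) M(1) by (intro add_strict_mono mult_strict_right_mono mult_strict_left_mono) auto
      also have "\<dots> = e" using L(1) M(1) by (simp add: field_simps)
      finally show ?thesis .
    qed
    then show "\<exists>K. \<forall>m\<ge>K. \<forall>n\<ge>K. dist (B (X m) (Y m)) (B (X n) (Y n)) < e" by blast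
  qed
  then show ?thesis by (simp add: Cauchy_convergent_iff)
qed

end

text \<open>
  Property (T) is formulated for Hilbert spaces whose points are complex sequences, so the completion has to
  live there. For this it suffices that countably many vectors \<open>e n\<close> test Cauchy sequences for weak
  convergence to 0. A Cauchy sequence \<open>X\<close> is then determined, up to null sequences, by its weak coordinates
  \<open>\<lambda>n. lim B (X i) (e n)\<close>, and these serve as the points of the completion.
\<close>

locale pre_hilbert_tested = pre_hilbert sm B
  for sm :: "complex \<Rightarrow> 'v::ab_group_add \<Rightarrow> 'v" and B :: "'v \<Rightarrow> 'v \<Rightarrow> complex" +
  fixes e :: "nat \<Rightarrow> 'v"
  assumes tested: "cau Z \<Longrightarrow> (\<And>n. (\<lambda>i. B (Z i) (e n)) \<longlonglongrightarrow> 0) \<Longrightarrow> (\<lambda>i. B (Z i) v) \<longlonglongrightarrow> 0"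
begin

definition reps :: "(nat \<Rightarrow> 'v) \<Rightarrow> (nat \<Rightarrow> complex) \<Rightarrow> bool" where
  "reps X F \<longleftrightarrow> cau X \<and> (\<forall>n. (\<lambda>i. B (X i) (e n)) \<longlonglongrightarrow> F n)"

definition H :: "(nat \<Rightarrow> complex) set" where "H = {F. \<exists>X. reps X F}"

definition repr :: "(nat \<Rightarrow> complex) \<Rightarrow> nat \<Rightarrow> 'v" where "repr F = (SOME X. reps X F)"

definition inner :: "(nat \<Rightarrow> complex) \<Rightarrow> (nat \<Rightarrow> complex) \<Rightarrow> complex" where
  "inner F G = lim (\<lambda>i. B (repr F i) (repr G i))"

lemma reps_repr: "F \<in> H \<Longrightarrow> reps (repr F) F"
  unfolding H_def repr_def mem_Collect_eq by (rule someI_ex[of "\<lambda>X. reps X F"])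

lemma cau_reps: "cau X \<Longrightarrow> \<exists>F. reps X F"
proof -
  assume X: "cau X"
  have "\<forall>n. \<exists>l. (\<lambda>i. B (X i) (e n)) \<longlonglongrightarrow> l"
    using B_cau_convergent[OF X cau_const] unfolding convergent_def by blast
  from choice[OF this] show ?thesis unfolding reps_def using X by blast
qed

text \<open>
  \<open>q (Z i)\<^sup>2 = B (Z i) (Z i - Z N) + B (Z i) (Z N)\<close>: the first summand is small by the Cauchy property and the
  second one tends to 0 weakly.
\<close>

lemma reps_zero_null:
  assumes "cau Z" "\<And>n. (\<lambda>i. B (Z i) (e n)) \<longlonglongrightarrow> 0"
  shows "(\<lambda>i. q (Z i)) \<longlonglongrightarrow> 0"
proof -
  obtain M where M: "0 < M" "\<And>i. q (Z i) \<le> M" using cau_bounded[OF assms(1)] by metis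
  have "(\<lambda>i. (q (Z i))\<^sup>2) \<longlonglongrightarrow> 0"
  proof (rule LIMSEQ_I)
    fix s :: real assume s: "0 < s"
    then have "0 < s / (2 * M)" using M by simp
    then obtain N where N: "\<And>m n. m \<ge> N \<Longrightarrow> n \<ge> N \<Longrightarrow> q (Z m - Z n) < s / (2 * M)"
      using assms(1) unfolding cau_def by metis
    obtain N' where N': "\<And>i. i \<ge> N' \<Longrightarrow> cmod (B (Z i) (Z N)) < s / 2"
      using LIMSEQ_D[OF tested[OF assms, of "Z N"], of "s / 2"] s by auto
    have "(q (Z i))\<^sup>2 < s" if i: "i \<ge> max N N'" for i
    proof -
      have "(q (Z i))\<^sup>2 = cmod (B (Z i) (Z i))" by (simp add: B_self norm_power)
      also have "B (Z i) (Z i) = B (Z i) (Z i - Z N) + B (Z i) (Z N)" by (simp add: B_diff2)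
      also have "cmod \<dots> \<le> q (Z i) * q (Z i - Z N) + cmod (B (Z i) (Z N))"
        using norm_triangle_le[of "B (Z i) (Z i - Z N)" "B (Z i) (Z N)"] cauchy_schwarz[of "Z i" "Z i - Z N"] by simp
      also have "\<dots> \<le> M * q (Z i - Z N) + cmod (B (Z i) (Z N))"
        using M by (intro add_mono mult_right_mono) auto
      also have "\<dots> < M * (s / (2 * M)) + s / 2"
        using N[of i N] N'[of i] i M(1) by (intro add_strict_mono mult_strict_left_mono) auto
      also have "\<dots> = s" using M(1) by (simp add: field_simps)
      finally show ?thesis .
    qed
    then show "\<exists>no. \<forall>n\<ge>no. norm ((q (Z n))\<^sup>2 - 0) < s" by (intro exI[of _ "max N N'"]) auto
  qed
  then have "(\<lambda>i. sqrt ((q (Z i))\<^sup>2)) \<longlonglongrightarrow> sqrt 0" by (intro tendsto_intros)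
  then show ?thesis by simp
qed

lemma reps_diff: "reps X F \<Longrightarrow> reps Y G \<Longrightarrow> reps (\<lambda>i. X i - Y i) (\<lambda>n. F n - G n)"
  unfolding reps_def by (auto intro: cau_diff tendsto_diff simp: B_diff)

lemma reps_add: "reps X F \<Longrightarrow> reps Y G \<Longrightarrow> reps (\<lambda>i. X i + Y i) (\<lambda>n. F n + G n)"
  unfolding reps_def by (auto intro: cau_add tendsto_add simp: B_add)

lemma cau_sm: assumes "cau X" shows "cau (\<lambda>i. sm c (X i))"
proof -
  have "q (sm c x - sm c y) = cmod c * q (x - y)" for x y
  proof -
    have "B (sm c x - sm c y) (sm c x - sm c y) = B (sm c (x - y)) (sm c (x - y))"
      by (simp add: B_diff B_diff2 B_sm B_sm2 algebra_simps)
    then have "q (sm c x - sm c y) = q (sm c (x - y))" unfolding q_def by simp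
    then show ?thesis by (simp add: q_sm)
  qed
  moreover have "\<exists>N. \<forall>m\<ge>N. \<forall>n\<ge>N. cmod c * q (X m - X n) < s" if "0 < s" for s
  proof -
    have "0 < s / (cmod c + 1)" using that by (simp add: add_nonneg_pos)
    then obtain N where N: "\<And>m n. m \<ge> N \<Longrightarrow> n \<ge> N \<Longrightarrow> q (X m - X n) < s / (cmod c + 1)"
      using assms unfolding cau_def by metis
    have "cmod c * q (X m - X n) < s" if "m \<ge> N" "n \<ge> N" for m n
    proof -
      have "cmod c * q (X m - X n) \<le> (cmod c + 1) * q (X m - X n)" by (intro mult_right_mono) auto
      also have "\<dots> < (cmod c + 1) * (s / (cmod c + 1))" using N[OF that] by (intro mult_strict_left_mono) (auto simp: add_nonneg_pos)
      also have "\<dots> = s" by (simp add: add_nonneg_eq_0_iff)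
      finally show ?thesis .
    qed
    then show ?thesis by blast
  qed
  ultimately show ?thesis unfolding cau_def by simp
qed

lemma reps_sm: "reps X F \<Longrightarrow> reps (\<lambda>i. sm c (X i)) (\<lambda>n. c * F n)"
  unfolding reps_def by (auto intro: cau_sm tendsto_mult_left simp: B_sm)

lemma reps_const: "reps (\<lambda>_. x) (\<lambda>n. B x (e n))"
  unfolding reps_def by (auto intro: cau_const)

lemma reps_same: "reps X F \<Longrightarrow> reps Y F \<Longrightarrow> (\<lambda>i. q (X i - Y i)) \<longlonglongrightarrow> 0"
  using reps_diff[of X F Y F] reps_zero_null unfolding reps_def by simp

text \<open>
  The inner product does not depend on the chosen representatives.
\<close>

lemma inner_lim:
  assumes X: "reps X F" and Y: "reps Y G"
  shows "(\<lambda>i. B (X i) (Y i)) \<longlonglongrightarrow> inner F G"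
proof -
  have FG: "reps (repr F) F" "reps (repr G) G" using X Y by (auto intro!: reps_repr simp: H_def)
  then have c: "(\<lambda>i. B (repr F i) (repr G i)) \<longlonglongrightarrow> inner F G"
    unfolding inner_def using B_cau_convergent by (metis reps_def convergent_LIMSEQ_iff)
  obtain M where M: "0 < M" "\<And>i. q (Y i) \<le> M" using cau_bounded[of Y] Y unfolding reps_def by metis
  obtain L where L: "0 < L" "\<And>i. q (repr F i) \<le> L" using cau_bounded[of "repr F"] FG(1) unfolding reps_def by metis
  have lim: "(\<lambda>i. q (X i - repr F i) * M + L * q (Y i - repr G i)) \<longlonglongrightarrow> 0"
    using tendsto_add[OF tendsto_mult_right[OF reps_same[OF X FG(1)], of M] tendsto_mult_left[OF reps_same[OF Y FG(2)], of L]] by simp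
  have bd: "cmod (B (X i) (Y i) - B (repr F i) (repr G i)) \<le> q (X i - repr F i) * M + L * q (Y i - repr G i)" for i
  proof -
    have "B (X i) (Y i) - B (repr F i) (repr G i) = B (X i - repr F i) (Y i) + B (repr F i) (Y i - repr G i)"
      by (simp add: B_diff B_diff2)
    then have "cmod (B (X i) (Y i) - B (repr F i) (repr G i)) \<le> q (X i - repr F i) * q (Y i) + q (repr F i) * q (Y i - repr G i)"
      using norm_triangle_le cauchy_schwarz by (metis add_mono)
    also have "\<dots> \<le> q (X i - repr F i) * M + L * q (Y i - repr G i)"
      using L M by (intro add_mono mult_left_mono mult_right_mono) auto
    finally show ?thesis .
  qed
  have "(\<lambda>i. B (X i) (Y i) - B (repr F i) (repr G i)) \<longlonglongrightarrow> 0"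
    by (rule Lim_null_comparison[OF always_eventually[OF allI[OF bd]] lim])
  from tendsto_add[OF this c] show ?thesis by simp
qed

lemma norm_lim: assumes X: "reps X F" shows "(\<lambda>i. q (X i)) \<longlonglongrightarrow> ip_norm inner F"
proof -
  have "(\<lambda>i. sqrt (Re (B (X i) (X i)))) \<longlonglongrightarrow> sqrt (Re (inner F F))"
    using inner_lim[OF X X] by (intro tendsto_intros)
  then show ?thesis unfolding q_def ip_norm_def .
qed

lemma norm_le: "reps X F \<Longrightarrow> (\<And>i. N \<le> i \<Longrightarrow> q (X i) \<le> c) \<Longrightarrow> ip_norm inner F \<le> c"
  using LIMSEQ_le_const2[OF norm_lim] by blast

lemma norm_ge: "reps X F \<Longrightarrow> 0 \<le> ip_norm inner F"
  using LIMSEQ_le_const[OF norm_lim] q_nonneg by blast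

lemma H_closed: "(\<lambda>_. 0) \<in> H" "F \<in> H \<Longrightarrow> G \<in> H \<Longrightarrow> (\<lambda>n. F n + G n) \<in> H" "F \<in> H \<Longrightarrow> (\<lambda>n. c * F n) \<in> H"
proof -
  show "(\<lambda>_. 0) \<in> H" using reps_const[of 0] by (auto simp: H_def B_zero)
qed (auto simp: H_def intro: reps_add reps_sm)

lemma H_minus: "f \<in> H \<Longrightarrow> g \<in> H \<Longrightarrow> f \<ominus>\<^bsub>function_module H\<^esub> g = (\<lambda>n. f n - g n)"
  by (rule function_module(2)) (simp_all add: H_closed)

lemma H_hilbert: "complex_hilbert_space (function_module H) inner"
proof (rule complex_hilbert_space.intro)
  show "Module.module complex_ring (function_module H)" by (rule function_module[OF H_closed])
next
  fix x y z
  assume "x \<in> carrier (function_module H)" "y \<in> carrier (function_module H)" "z \<in> carrier (function_module H)"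
  then have x: "reps (repr x) x" and y: "reps (repr y) y" and z: "reps (repr z) z" by (auto intro: reps_repr)
  have "(\<lambda>i. B (repr x i) (repr z i) + B (repr y i) (repr z i)) \<longlonglongrightarrow> inner (\<lambda>n. x n + y n) z"
    using inner_lim[OF reps_add[OF x y] z] by (simp add: B_add)
  then show "inner (x \<oplus>\<^bsub>function_module H\<^esub> y) z = inner x z + inner y z"
    using tendsto_add[OF inner_lim[OF x z] inner_lim[OF y z]] LIMSEQ_unique by auto
next
  fix x y c
  assume "x \<in> carrier (function_module H)" "y \<in> carrier (function_module H)"
  then have x: "reps (repr x) x" and y: "reps (repr y) y" by (auto intro: reps_repr)
  have "(\<lambda>i. c * B (repr x i) (repr y i)) \<longlonglongrightarrow> inner (\<lambda>n. c * x n) y"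
    using inner_lim[OF reps_sm[OF x] y, of c] by (simp add: B_sm)
  then show "inner (c \<odot>\<^bsub>function_module H\<^esub> x) y = c * inner x y"
    using tendsto_mult_left[OF inner_lim[OF x y], of c] LIMSEQ_unique by auto
next
  fix x y
  assume "x \<in> carrier (function_module H)" "y \<in> carrier (function_module H)"
  then have x: "reps (repr x) x" and y: "reps (repr y) y" by (auto intro: reps_repr)
  have "(\<lambda>i. cnj (B (repr y i) (repr x i))) \<longlonglongrightarrow> inner x y"
    using inner_lim[OF x y] unfolding B_comm[of "repr x _"] .
  then show "inner x y = cnj (inner y x)"
    using tendsto_cnj[OF inner_lim[OF y x]] LIMSEQ_unique by blast
next
  fix x assume "x \<in> carrier (function_module H)" and nz: "x \<noteq> \<zero>\<^bsub>function_module H\<^esub>"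
  then have x: "reps (repr x) x" by (auto intro: reps_repr)
  have "Re (inner x x) \<noteq> 0"
  proof
    assume "Re (inner x x) = 0"
    then have l: "(\<lambda>i. q (repr x i)) \<longlonglongrightarrow> 0" using norm_lim[OF x] by (simp add: ip_norm_def)
    have "x n = 0" for n
    proof -
      have "(\<lambda>i. q (repr x i) * q (e n)) \<longlonglongrightarrow> 0" using tendsto_mult_right[OF l, of "q (e n)"] by simp
      then have "(\<lambda>i. B (repr x i) (e n)) \<longlonglongrightarrow> 0"
        by (rule Lim_null_comparison[OF always_eventually[OF allI[OF cauchy_schwarz]]])
      moreover have "(\<lambda>i. B (repr x i) (e n)) \<longlonglongrightarrow> x n" using x by (simp add: reps_def)
      ultimately show ?thesis using LIMSEQ_unique by blast
    qed
    then show False using nz by auto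
  qed
  moreover have "0 \<le> Re (inner x x)"
    using norm_ge[OF x] unfolding ip_norm_def by simp
  ultimately show "0 < Re (inner x x)" by simp
next
  fix s :: "nat \<Rightarrow> nat \<Rightarrow> complex"
  assume "\<And>n. s n \<in> carrier (function_module H)"
    and C: "\<forall>d>0. \<exists>N. \<forall>m\<ge>N. \<forall>n\<ge>N. ip_norm inner (s m \<ominus>\<^bsub>function_module H\<^esub> s n) < d"
  then have sH: "\<And>n. s n \<in> H" by simp
  \<comment> \<open>Completeness: a Cauchy sequence of limits is followed by a sequence of vectors at distance less than
    \<open>1 / (n + 1)\<close>, which is itself Cauchy and represents the limit.\<close>
  have "\<exists>x. ip_norm inner (\<lambda>k. s n k - B x (e k)) < 1 / (real n + 1)" for n
  proof -
    have r: "reps (repr (s n)) (s n)" using sH by (rule reps_repr)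
    have "0 < 1 / (real n + 2)" by simp
    then obtain N where N: "\<And>i j. i \<ge> N \<Longrightarrow> j \<ge> N \<Longrightarrow> q (repr (s n) i - repr (s n) j) < 1 / (real n + 2)"
      using r unfolding reps_def cau_def by metis
    have "ip_norm inner (\<lambda>k. s n k - B (repr (s n) N) (e k)) \<le> 1 / (real n + 2)"
      using N by (intro norm_le[OF reps_diff[OF r reps_const], of N] less_imp_le) simp
    also have "\<dots> < 1 / (real n + 1)" by (simp add: field_simps)
    finally show ?thesis by blast
  qed
  then have "\<forall>n. \<exists>x. ip_norm inner (\<lambda>k. s n k - B x (e k)) < 1 / (real n + 1)" by blast
  from choice[OF this] obtain x where x: "\<And>n. ip_norm inner (\<lambda>k. s n k - B (x n) (e k)) < 1 / (real n + 1)" by blast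
  have tri: "ip_norm inner (\<lambda>k. F k - G k) \<le> ip_norm inner (\<lambda>k. F k - L k) + ip_norm inner (\<lambda>k. L k - G k)"
    if "F \<in> H" "G \<in> H" "L \<in> H" for F G L
  proof -
    note r = that[THEN reps_repr]
    show ?thesis
      by (rule LIMSEQ_le[OF norm_lim[OF reps_diff[OF r(1) r(2)]] tendsto_add[OF norm_lim[OF reps_diff[OF r(1) r(3)]] norm_lim[OF reps_diff[OF r(3) r(2)]]]])
        (auto intro: q_diff_triangle)
  qed
  have sym: "ip_norm inner (\<lambda>k. F k - G k) = ip_norm inner (\<lambda>k. G k - F k)" if "F \<in> H" "G \<in> H" for F G
  proof -
    note r = that[THEN reps_repr]
    show ?thesis using norm_lim[OF reps_diff[OF r(1) r(2)]] norm_lim[OF reps_diff[OF r(2) r(1)]]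
      unfolding q_commute[of "repr F _"] using LIMSEQ_unique by blast
  qed
  have xH: "(\<lambda>k. B y (e k)) \<in> H" for y using reps_const by (auto simp: H_def)
  have qx: "q (y - z) = ip_norm inner (\<lambda>k. B y (e k) - B z (e k))" for y z
    using norm_lim[OF reps_diff[OF reps_const[of y] reps_const[of z]]] LIMSEQ_const_iff by metis
  have small: "\<exists>N. \<forall>n\<ge>N. 1 / (real n + 1) < d" if "0 < d" for d :: real
  proof -
    obtain N :: nat where "1 / d < real N" using reals_Archimedean2 by blast
    then have "1 / (real n + 1) < d" if "n \<ge> N" for n
    proof -
      have "1 / d < real n + 1" using \<open>1 / d < real N\<close> that by linarith
      then show ?thesis using \<open>0 < d\<close> by (simp add: field_simps)
    qed
    then show ?thesis by blast
  qed
  have "cau x" unfolding cau_def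
  proof (intro allI impI)
    fix d :: real assume d: "0 < d"
    obtain N where N: "\<And>m n. m \<ge> N \<Longrightarrow> n \<ge> N \<Longrightarrow> ip_norm inner (\<lambda>k. s m k - s n k) < d / 3"
      using C[unfolded H_minus[OF sH sH]] d by (meson divide_pos_pos zero_less_numeral)
    obtain N' where N': "\<And>n. n \<ge> N' \<Longrightarrow> 1 / (real n + 1) < d / 3" using small[of "d / 3"] d by auto
    have "q (x m - x n) < d" if mn: "m \<ge> max N N'" "n \<ge> max N N'" for m n
    proof -
      have "q (x m - x n) \<le> ip_norm inner (\<lambda>k. B (x m) (e k) - s m k) + ip_norm inner (\<lambda>k. s m k - B (x n) (e k))"
        unfolding qx by (intro tri xH sH)
      also have "\<dots> \<le> ip_norm inner (\<lambda>k. B (x m) (e k) - s m k) + (ip_norm inner (\<lambda>k. s m k - s n k) + ip_norm inner (\<lambda>k. s n k - B (x n) (e k)))"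
        by (intro add_mono order_refl tri xH sH)
      also have "\<dots> < d / 3 + (d / 3 + d / 3)"
        using x[of m] x[of n] N[of m n] N'[of m] N'[of n] mn sym[OF xH sH, of "x m" m] by (intro add_strict_mono) auto
      finally show ?thesis by simp
    qed
    then show "\<exists>N. \<forall>m\<ge>N. \<forall>n\<ge>N. q (x m - x n) < d" by blast
  qed
  then obtain F where F: "reps x F" using cau_reps by blast
  then have FH: "F \<in> H" by (auto simp: H_def)
  have "(\<lambda>n. ip_norm inner (\<lambda>k. s n k - F k)) \<longlonglongrightarrow> 0"
  proof (rule LIMSEQ_I)
    fix d :: real assume d: "0 < d"
    obtain N where N: "\<And>i j. i \<ge> N \<Longrightarrow> j \<ge> N \<Longrightarrow> q (x i - x j) < d / 3"
      using \<open>cau x\<close> d unfolding cau_def by (metis divide_pos_pos zero_less_numeral)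
    obtain N' where N': "\<And>n. n \<ge> N' \<Longrightarrow> 1 / (real n + 1) < d / 3" using small[of "d / 3"] d by auto
    have "ip_norm inner (\<lambda>k. s n k - F k) < d" if n: "n \<ge> max N N'" for n
    proof -
      have "ip_norm inner (\<lambda>k. B (x n) (e k) - F k) \<le> d / 3"
        using N n by (intro norm_le[OF reps_diff[OF reps_const F], of N] less_imp_le) simp
      moreover have "ip_norm inner (\<lambda>k. s n k - B (x n) (e k)) < d / 3" using x[of n] N'[of n] n by simp
      ultimately show ?thesis using tri[OF sH FH xH, of n "x n"] d by linarith
    qed
    moreover have "0 \<le> ip_norm inner (\<lambda>k. s n k - F k)" for n
      by (rule norm_ge[OF reps_diff[OF reps_repr[OF sH] F]])
    ultimately show "\<exists>no. \<forall>n\<ge>no. norm (ip_norm inner (\<lambda>k. s n k - F k) - 0) < d"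
      by (intro exI[of _ "max N N'"]) auto
  qed
  then show "\<exists>l\<in>carrier (function_module H). (\<lambda>n. ip_norm inner (s n \<ominus>\<^bsub>function_module H\<^esub> l)) \<longlonglongrightarrow> 0"
    unfolding function_module_simps by (intro bexI[OF _ FH]) (simp only: H_minus[OF sH FH])
qed

end


section \<open>Kazhdan pairs and positive definite functions\<close>

text \<open>
  A strongly continuous unitary action on the pre-Hilbert space; it extends to the completion.
\<close>

locale pre_representation = pre_hilbert_tested sm B e
  for sm :: "complex \<Rightarrow> 'v::ab_group_add \<Rightarrow> 'v" and B :: "'v \<Rightarrow> 'v \<Rightarrow> complex" and e :: "nat \<Rightarrow> 'v" +
  fixes L :: "'g::{topological_group_add, second_countable_topology} \<Rightarrow> 'v \<Rightarrow> 'v"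
  assumes L_add: "L g (x + y) = L g x + L g y" and L_sm: "L g (sm c x) = sm c (L g x)"
    and L_iso: "B (L g x) (L g y) = B x y"
    and L_mult: "L (g + h) x = L g (L h x)" and L_zero: "L 0 x = x"
    and L_cont: "((\<lambda>h. q (L h x - L g x)) \<longlongrightarrow> 0) (at g)"
begin

lemma L_diff: "L g (x - y) = L g x - L g y"
  using L_add[of g "x - y" y] by (simp add: algebra_simps)

lemma q_L: "q (L g x) = q x" by (simp add: q_def L_iso)

lemma cau_L: "cau X \<Longrightarrow> cau (\<lambda>i. L g (X i))"
  unfolding cau_def by (simp add: q_L flip: L_diff)

definition rep :: "'g \<Rightarrow> (nat \<Rightarrow> complex) \<Rightarrow> nat \<Rightarrow> complex" where
  "rep g F = (SOME F'. reps (\<lambda>i. L g (repr F i)) F')"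

lemma reps_unique: "reps X F \<Longrightarrow> reps X G \<Longrightarrow> F = G"
  unfolding reps_def using LIMSEQ_unique by blast

lemma reps_close: assumes "reps X F" "cau Y" "(\<lambda>i. q (X i - Y i)) \<longlonglongrightarrow> 0" shows "reps Y F"
proof -
  obtain G where G: "reps Y G" using cau_reps[OF assms(2)] by blast
  have "F n = G n" for n
  proof -
    have "(\<lambda>i. q (X i - Y i) * q (e n)) \<longlonglongrightarrow> 0" using tendsto_mult_right[OF assms(3), of "q (e n)"] by simp
    then have "(\<lambda>i. B (X i - Y i) (e n)) \<longlonglongrightarrow> 0"
      by (rule Lim_null_comparison[OF always_eventually[OF allI[OF cauchy_schwarz]]])
    moreover have "(\<lambda>i. B (X i - Y i) (e n)) \<longlonglongrightarrow> F n - G n"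
      using reps_diff[OF assms(1) G] unfolding reps_def by blast
    ultimately have "F n - G n = 0" using LIMSEQ_unique by blast
    then show ?thesis by simp
  qed
  then show ?thesis using G by (simp add: ext[of F G])
qed

lemma reps_rep: assumes "reps X F" shows "reps (\<lambda>i. L g (X i)) (rep g F)"
proof -
  have r: "reps (repr F) F" using assms by (intro reps_repr) (auto simp: H_def)
  then have "cau (repr F)" by (simp add: reps_def)
  then have "\<exists>F'. reps (\<lambda>i. L g (repr F i)) F'" by (intro cau_reps cau_L)
  then have 1: "reps (\<lambda>i. L g (repr F i)) (rep g F)"
    unfolding rep_def by (rule someI_ex[of "\<lambda>F'. reps (\<lambda>i. L g (repr F i)) F'"])
  show ?thesis
  proof (rule reps_close[OF 1])
    show "cau (\<lambda>i. L g (X i))" using assms by (intro cau_L) (simp add: reps_def)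
    show "(\<lambda>i. q (L g (repr F i) - L g (X i))) \<longlonglongrightarrow> 0"
      using reps_same[OF r assms] by (simp add: q_L flip: L_diff)
  qed
qed

lemma rep_H: "F \<in> H \<Longrightarrow> rep g F \<in> H"
  using reps_rep[OF reps_repr, of F g] by (auto simp: H_def)

lemma rep_rep: assumes "F \<in> H" shows "rep (g + h) F = rep g (rep h F)"
  using reps_rep[OF reps_repr[OF assms], of "g + h"] reps_rep[OF reps_rep[OF reps_repr[OF assms], of h], of g]
  unfolding L_mult by (rule reps_unique)

lemma rep_0: assumes "F \<in> H" shows "rep 0 F = F"
  using reps_rep[OF reps_repr[OF assms], of 0] reps_repr[OF assms] unfolding L_zero by (rule reps_unique)

lemma unitary: "unitary_representation (function_module H) inner rep"
proof (rule unitary_representation.intro[OF H_hilbert], rule unitary_representation_axioms.intro)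
  fix g
  have "rep (- g) (rep g F) = F" "rep g (rep (- g) F) = F" if "F \<in> H" for F
    using rep_rep[OF that, of "- g" g] rep_rep[OF that, of g "- g"] rep_0[OF that] by simp_all
  then show "bij_betw (rep g) (carrier (function_module H)) (carrier (function_module H))"
    by (intro bij_betwI[where g = "rep (- g)"]) (auto simp: rep_H)
next
  fix x y g assume "x \<in> carrier (function_module H)" "y \<in> carrier (function_module H)"
  then have x: "reps (repr x) x" and y: "reps (repr y) y" by (auto intro: reps_repr)
  show "rep g (x \<oplus>\<^bsub>function_module H\<^esub> y) = rep g x \<oplus>\<^bsub>function_module H\<^esub> rep g y"
    using reps_rep[OF reps_add[OF x y], of g] reps_add[OF reps_rep[OF x, of g] reps_rep[OF y, of g]]
    unfolding L_add function_module_simps by (rule reps_unique)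
  show "inner (rep g x) (rep g y) = inner x y"
    using inner_lim[OF reps_rep[OF x, of g] reps_rep[OF y, of g]] inner_lim[OF x y]
    unfolding L_iso by (rule LIMSEQ_unique)
next
  fix x g c assume "x \<in> carrier (function_module H)"
  then have x: "reps (repr x) x" by (auto intro: reps_repr)
  show "rep g (c \<odot>\<^bsub>function_module H\<^esub> x) = c \<odot>\<^bsub>function_module H\<^esub> rep g x"
    using reps_rep[OF reps_sm[OF x], of g c] reps_sm[OF reps_rep[OF x, of g], of c]
    unfolding L_sm function_module_simps by (rule reps_unique)
next
  fix x g h assume "x \<in> carrier (function_module H)"
  then show "rep (g + h) x = rep g (rep h x)" using rep_rep by simp
next
  fix x g assume "x \<in> carrier (function_module H)"
  then have xH: "x \<in> H" and x: "reps (repr x) x" by (auto intro: reps_repr)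
  have "((\<lambda>h. ip_norm inner (\<lambda>n. rep h x n - rep g x n)) \<longlongrightarrow> 0) (at g)"
  proof (rule tendstoI)
    fix d :: real assume d: "0 < d"
    then have "0 < d / 4" by simp
    then obtain N where N: "\<And>i j. i \<ge> N \<Longrightarrow> j \<ge> N \<Longrightarrow> q (repr x i - repr x j) < d / 4"
      using x unfolding reps_def cau_def by metis
    have ev: "\<forall>\<^sub>F h in at g. q (L h (repr x N) - L g (repr x N)) < d / 4"
      using order_tendstoD(2)[OF L_cont \<open>0 < d / 4\<close>] .
    show "\<forall>\<^sub>F h in at g. dist (ip_norm inner (\<lambda>n. rep h x n - rep g x n)) 0 < d"
      using ev
    proof (rule eventually_mono)
      fix h assume h: "q (L h (repr x N) - L g (repr x N)) < d / 4"
      have r: "reps (\<lambda>i. L h (repr x i) - L g (repr x i)) (\<lambda>n. rep h x n - rep g x n)"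
        by (intro reps_diff reps_rep x)
      have "ip_norm inner (\<lambda>n. rep h x n - rep g x n) \<le> 3 * d / 4"
      proof (rule norm_le[OF r])
        fix i assume i: "N \<le> i"
        have "q (L h (repr x i) - L g (repr x i)) \<le> q (L h (repr x i) - L h (repr x N)) + q (L h (repr x N) - L g (repr x i))"
          by (rule q_diff_triangle)
        also have "q (L h (repr x N) - L g (repr x i)) \<le> q (L h (repr x N) - L g (repr x N)) + q (L g (repr x N) - L g (repr x i))"
          by (rule q_diff_triangle)
        also have "q (L h (repr x i) - L h (repr x N)) = q (repr x i - repr x N)" by (simp add: q_L flip: L_diff)
        also have "q (L g (repr x N) - L g (repr x i)) = q (repr x N - repr x i)" by (simp add: q_L flip: L_diff)
        finally show "q (L h (repr x i) - L g (repr x i)) \<le> 3 * d / 4"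
          using h N[of i N] N[of N i] i by simp
      qed
      then show "dist (ip_norm inner (\<lambda>n. rep h x n - rep g x n)) 0 < d"
        using norm_ge[OF r] d by simp
    qed
  qed
  then show "((\<lambda>h. ip_norm inner (rep h x \<ominus>\<^bsub>function_module H\<^esub> rep g x)) \<longlongrightarrow> 0) (at g)"
    by (simp add: H_minus[OF rep_H[OF xH] rep_H[OF xH]])
qed

text \<open>
  A \<open>(K, \<epsilon>)\<close>-invariant vector of the pre-Hilbert space forces a nonzero invariant vector in the completion;
  any Cauchy sequence that represents it is asymptotically invariant and not null.
\<close>

lemma kazhdan_invariant_sequence:
  assumes K: "kazhdan_pair (K :: 'g set) \<epsilon>" and x: "0 < q x" "\<And>k. k \<in> K \<Longrightarrow> q (L k x - x) < \<epsilon> * q x"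
  shows "\<exists>X. cau X \<and> (\<forall>g. (\<lambda>i. q (L g (X i) - X i)) \<longlonglongrightarrow> 0) \<and> \<not> (\<lambda>i. q (X i)) \<longlonglongrightarrow> 0"
proof -
  define v where "v = (\<lambda>n. B x (e n))"
  have v: "reps (\<lambda>_. x) v" unfolding v_def by (rule reps_const)
  then have vH: "v \<in> H" by (auto simp: H_def)
  have nv: "ip_norm inner v = q x" using norm_lim[OF v] LIMSEQ_const_iff by metis
  have "v \<noteq> (\<lambda>_. 0)"
  proof
    assume "v = (\<lambda>_. 0)"
    then have "(\<lambda>i. q ((\<lambda>_. x) i)) \<longlonglongrightarrow> 0"
      using v reps_zero_null[of "\<lambda>_. x"] unfolding reps_def by simp
    then show False using x(1) LIMSEQ_const_iff[of "q x" 0] by simp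
  qed
  moreover have "ip_norm inner (rep k v \<ominus>\<^bsub>function_module H\<^esub> v) < \<epsilon> * ip_norm inner v" if "k \<in> K" for k
  proof -
    have "(\<lambda>i. q (L k x - x)) \<longlonglongrightarrow> ip_norm inner (\<lambda>n. rep k v n - v n)"
      using norm_lim[OF reps_diff[OF reps_rep[OF v, of k] v]] .
    then have "ip_norm inner (\<lambda>n. rep k v n - v n) = q (L k x - x)" using LIMSEQ_const_iff by metis
    then show ?thesis using x(2)[OF that] nv by (simp add: H_minus[OF rep_H[OF vH] vH])
  qed
  ultimately have ex: "\<exists>v\<in>carrier (function_module H). v \<noteq> \<zero>\<^bsub>function_module H\<^esub> \<and>
      (\<forall>k\<in>K. ip_norm inner (rep k v \<ominus>\<^bsub>function_module H\<^esub> v) < \<epsilon> * ip_norm inner v)"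
    using vH by (intro bexI[of _ v]) auto
  have "\<exists>w\<in>carrier (function_module H). w \<noteq> \<zero>\<^bsub>function_module H\<^esub> \<and> (\<forall>g. rep g w = w)"
    using K[unfolded kazhdan_pair_def, rule_format, OF unitary ex] .
  then obtain w where w: "w \<in> H" "w \<noteq> (\<lambda>_. 0)" "\<And>g. rep g w = w" by auto
  define X where "X = repr w"
  have X: "reps X w" unfolding X_def by (rule reps_repr[OF w(1)])
  have "(\<lambda>i. q (L g (X i) - X i)) \<longlonglongrightarrow> 0" for g
    using reps_same[OF reps_rep[OF X, of g, unfolded w(3)] X] .
  moreover have "\<not> (\<lambda>i. q (X i)) \<longlonglongrightarrow> 0"
  proof
    assume l: "(\<lambda>i. q (X i)) \<longlonglongrightarrow> 0"
    have "w n = 0" for n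
    proof -
      have "(\<lambda>i. q (X i) * q (e n)) \<longlonglongrightarrow> 0" using tendsto_mult_right[OF l, of "q (e n)"] by simp
      then have "(\<lambda>i. B (X i) (e n)) \<longlonglongrightarrow> 0"
        by (rule Lim_null_comparison[OF always_eventually[OF allI[OF cauchy_schwarz]]])
      moreover have "(\<lambda>i. B (X i) (e n)) \<longlonglongrightarrow> w n" using X by (simp add: reps_def)
      ultimately show ?thesis using LIMSEQ_unique by blast
    qed
    then show False using w(2) by auto
  qed
  ultimately show ?thesis using X unfolding reps_def by blast
qed

end

text \<open>
  The squared seminorm of the combination of point masses with coefficients \<open>f\<close> in the GNS space
  of \<open>\<phi>\<close>.
\<close>

definition kernel_form :: "('g::group_add \<Rightarrow> real) \<Rightarrow> ('g \<Rightarrow> complex) \<Rightarrow> real" where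
  "kernel_form \<phi> f = Re (\<Sum>g\<in>{g. f g \<noteq> 0}. \<Sum>h\<in>{h. f h \<noteq> 0}. f g * cnj (f h) * of_real (\<phi> (- g + h)))"

definition dense_sequence :: "nat \<Rightarrow> 'g::second_countable_topology" where
  "dense_sequence = (SOME \<gamma>. \<forall>X. open X \<longrightarrow> X \<noteq> {} \<longrightarrow> (\<exists>n. \<gamma> n \<in> X))"

lemma dense_sequence:
  assumes "open X" "X \<noteq> {}"
  shows "\<exists>n. dense_sequence n \<in> (X :: 'g::second_countable_topology set)"
proof -
  obtain D :: "'g set" where D: "countable D" "\<And>X. open X \<Longrightarrow> X \<noteq> {} \<Longrightarrow> \<exists>d\<in>D. d \<in> X"
    by (rule countable_dense_setE) blast
  have "\<exists>n. from_nat_into D n \<in> X" if X: "open X" "X \<noteq> {}" for X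
  proof -
    obtain d where d: "d \<in> D" "d \<in> X" using D(2)[OF X] by blast
    from from_nat_into_surj[OF D(1) d(1)] d(2) show ?thesis by blast
  qed
  then have "\<exists>\<gamma> :: nat \<Rightarrow> 'g. \<forall>X. open X \<longrightarrow> X \<noteq> {} \<longrightarrow> (\<exists>n. \<gamma> n \<in> X)" by blast
  then have "\<forall>X. open X \<longrightarrow> X \<noteq> {} \<longrightarrow> (\<exists>n. (dense_sequence :: nat \<Rightarrow> 'g) n \<in> X)"
    unfolding dense_sequence_def by (rule someI_ex)
  then show ?thesis using assms by blast
qed

text \<open>
  The GNS construction takes place on the finitely supported functions of the group, with left translation
  as the action.
\<close>

locale positive_definite_function =
  fixes \<phi> :: "'g::{topological_group_add, second_countable_topology} \<Rightarrow> real"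
  assumes posdef: "\<And>I c. finite I \<Longrightarrow> 0 \<le> Re (\<Sum>g\<in>I. \<Sum>h\<in>I. c g * cnj (c h) * of_real (\<phi> (- g + h)))"
    and sym: "\<phi> (- g) = \<phi> g" and cont: "continuous_on UNIV \<phi>"
begin

definition scale :: "complex \<Rightarrow> ('g \<Rightarrow>\<^sub>0 complex) \<Rightarrow> 'g \<Rightarrow>\<^sub>0 complex" where
  "scale c x = Poly_Mapping.map ((*) c) x"

definition gram_form :: "('g \<Rightarrow>\<^sub>0 complex) \<Rightarrow> ('g \<Rightarrow>\<^sub>0 complex) \<Rightarrow> complex" where
  "gram_form x y = (\<Sum>g\<in>Poly_Mapping.keys x. \<Sum>h\<in>Poly_Mapping.keys y. Poly_Mapping.lookup x g * cnj (Poly_Mapping.lookup y h) * of_real (\<phi> (- g + h)))"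

definition shift :: "'g \<Rightarrow> ('g \<Rightarrow>\<^sub>0 complex) \<Rightarrow> 'g \<Rightarrow>\<^sub>0 complex" where
  "shift g x = Abs_poly_mapping (\<lambda>h. Poly_Mapping.lookup x (- g + h))"

lemma lookup_scale: "Poly_Mapping.lookup (scale c x) g = c * Poly_Mapping.lookup x g"
  unfolding scale_def by (simp add: Poly_Mapping.map.rep_eq when_def)

lemma lookup_shift: "Poly_Mapping.lookup (shift g x) h = Poly_Mapping.lookup x (- g + h)"
proof -
  have "{h. Poly_Mapping.lookup x (- g + h) \<noteq> 0} \<subseteq> (+) g ` Poly_Mapping.keys x"
  proof
    fix h assume "h \<in> {h. Poly_Mapping.lookup x (- g + h) \<noteq> 0}"
    then have "- g + h \<in> Poly_Mapping.keys x" by (simp add: in_keys_iff)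
    moreover have "h = g + (- g + h)" by (simp add: add.assoc[symmetric])
    ultimately show "h \<in> (+) g ` Poly_Mapping.keys x" by blast
  qed
  then have "finite {h. Poly_Mapping.lookup x (- g + h) \<noteq> 0}" by (rule finite_subset) simp
  then show ?thesis unfolding shift_def by (simp add: lookup_Abs_poly_mapping)
qed

lemma gram_form_superset:
  assumes "finite I" "Poly_Mapping.keys x \<subseteq> I" "finite J" "Poly_Mapping.keys y \<subseteq> J"
  shows "gram_form x y = (\<Sum>g\<in>I. \<Sum>h\<in>J. Poly_Mapping.lookup x g * cnj (Poly_Mapping.lookup y h) * of_real (\<phi> (- g + h)))"
proof -
  have "(\<Sum>h\<in>Poly_Mapping.keys y. Poly_Mapping.lookup x g * cnj (Poly_Mapping.lookup y h) * of_real (\<phi> (- g + h)))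
      = (\<Sum>h\<in>J. Poly_Mapping.lookup x g * cnj (Poly_Mapping.lookup y h) * of_real (\<phi> (- g + h)))" for g
    using assms by (intro sum.mono_neutral_left) (auto simp: in_keys_iff)
  moreover have "(\<Sum>g\<in>Poly_Mapping.keys x. \<Sum>h\<in>J. Poly_Mapping.lookup x g * cnj (Poly_Mapping.lookup y h) * of_real (\<phi> (- g + h)))
      = (\<Sum>g\<in>I. \<Sum>h\<in>J. Poly_Mapping.lookup x g * cnj (Poly_Mapping.lookup y h) * of_real (\<phi> (- g + h)))"
    using assms by (intro sum.mono_neutral_left) (auto simp: in_keys_iff)
  ultimately show ?thesis unfolding gram_form_def by simp
qed

lemma keys_shift: "Poly_Mapping.keys (shift g x) = (+) g ` Poly_Mapping.keys x"
proof (intro Set.set_eqI iffI)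
  fix h assume "h \<in> Poly_Mapping.keys (shift g x)"
  then have "- g + h \<in> Poly_Mapping.keys x" by (simp add: in_keys_iff lookup_shift)
  moreover have "h = g + (- g + h)" by (simp add: add.assoc[symmetric])
  ultimately show "h \<in> (+) g ` Poly_Mapping.keys x" by blast
next
  fix h assume "h \<in> (+) g ` Poly_Mapping.keys x"
  then show "h \<in> Poly_Mapping.keys (shift g x)" by (auto simp: in_keys_iff lookup_shift add.assoc[symmetric])
qed

lemma gram_form_shift_shift: "gram_form (shift g x) (shift h y) =
    (\<Sum>a\<in>Poly_Mapping.keys x. \<Sum>b\<in>Poly_Mapping.keys y. Poly_Mapping.lookup x a * cnj (Poly_Mapping.lookup y b) * of_real (\<phi> (- (g + a) + (h + b))))"
  unfolding gram_form_def keys_shift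
  by (simp add: sum.reindex inj_on_def lookup_shift add.assoc[symmetric])

sublocale gns: pre_hilbert scale gram_form
proof
  fix x y z :: "'g \<Rightarrow>\<^sub>0 complex" and c
  let ?I = "Poly_Mapping.keys x \<union> Poly_Mapping.keys y \<union> Poly_Mapping.keys (x + y)"
  have "gram_form (x + y) z = (\<Sum>g\<in>?I. \<Sum>h\<in>Poly_Mapping.keys z. Poly_Mapping.lookup (x + y) g * cnj (Poly_Mapping.lookup z h) * of_real (\<phi> (- g + h)))"
    by (rule gram_form_superset) auto
  moreover have "gram_form x z = (\<Sum>g\<in>?I. \<Sum>h\<in>Poly_Mapping.keys z. Poly_Mapping.lookup x g * cnj (Poly_Mapping.lookup z h) * of_real (\<phi> (- g + h)))"
    by (rule gram_form_superset) auto
  moreover have "gram_form y z = (\<Sum>g\<in>?I. \<Sum>h\<in>Poly_Mapping.keys z. Poly_Mapping.lookup y g * cnj (Poly_Mapping.lookup z h) * of_real (\<phi> (- g + h)))"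
    by (rule gram_form_superset) auto
  ultimately show "gram_form (x + y) z = gram_form x z + gram_form y z"
    by (simp add: lookup_add distrib_right sum.distrib)
  have "Poly_Mapping.keys (scale c x) \<subseteq> Poly_Mapping.keys x" by (auto simp: in_keys_iff lookup_scale)
  then have "gram_form (scale c x) y = (\<Sum>g\<in>Poly_Mapping.keys x. \<Sum>h\<in>Poly_Mapping.keys y. Poly_Mapping.lookup (scale c x) g * cnj (Poly_Mapping.lookup y h) * of_real (\<phi> (- g + h)))"
    by (intro gram_form_superset) auto
  then show "gram_form (scale c x) y = c * gram_form x y"
    unfolding gram_form_def by (simp add: lookup_scale sum_distrib_left mult.assoc)
  have s: "\<phi> (- g + h) = \<phi> (- h + g)" for g h using sym[of "- g + h"] by (simp add: minus_add)
  show "gram_form x y = cnj (gram_form y x)"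
    unfolding gram_form_def cnj_sum by (subst sum.swap) (simp add: s mult_ac)
  show "0 \<le> Re (gram_form x x)" unfolding gram_form_def by (rule posdef) simp
qed

definition delta :: "'g \<Rightarrow> 'g \<Rightarrow>\<^sub>0 complex" where "delta g = Poly_Mapping.single g 1"

lemma gram_form_delta: "gram_form x (delta h) = (\<Sum>g\<in>Poly_Mapping.keys x. Poly_Mapping.lookup x g * of_real (\<phi> (- g + h)))"
  unfolding gram_form_def delta_def by simp

lemma gram_form_expand: "gram_form x y = (\<Sum>h\<in>Poly_Mapping.keys y. cnj (Poly_Mapping.lookup y h) * gram_form x (delta h))"
  unfolding gram_form_delta sum_distrib_left unfolding gram_form_def by (subst sum.swap) (simp add: mult_ac)

lemma q_delta_diff: "(gns.q (delta g - delta h))\<^sup>2 = 2 * (\<phi> 0 - \<phi> (- g + h))"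
proof -
  have d: "gram_form (delta a) (delta b) = of_real (\<phi> (- a + b))" for a b
    unfolding gram_form_delta by (simp add: delta_def)
  have s: "\<phi> (- h + g) = \<phi> (- g + h)" using sym[of "- g + h"] by (simp add: minus_add)
  have "of_real ((gns.q (delta g - delta h))\<^sup>2) = complex_of_real (2 * (\<phi> 0 - \<phi> (- g + h)))"
    unfolding gns.B_self[symmetric] gns.B_diff gns.B_diff2 d s by simp
  then show ?thesis unfolding of_real_eq_iff .
qed

text \<open>
  Since \<open>\<phi>\<close> is continuous, \<open>delta\<close> is continuous into the GNS space. Point masses span that space, so
  those at a dense sequence of group elements test for weak convergence.
\<close>

sublocale gns: pre_hilbert_tested scale gram_form "\<lambda>n. delta (dense_sequence n)"
proof
  fix Z v assume Z: "gns.cau Z" and t: "\<And>n. (\<lambda>i. gram_form (Z i) (delta (dense_sequence n))) \<longlonglongrightarrow> 0"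
  obtain M where M: "0 < M" "\<And>i. gns.q (Z i) \<le> M" using gns.cau_bounded[OF Z] by metis
  have "(\<lambda>i. gram_form (Z i) (delta h)) \<longlonglongrightarrow> 0" for h
  proof (rule LIMSEQ_I)
    fix r :: real assume r: "0 < r"
    define X where "X = (\<lambda>g. 2 * (\<phi> 0 - \<phi> (- h + g))) -` {..<(r / (2 * M))\<^sup>2}"
    have "open X" unfolding X_def
      by (intro open_vimage continuous_intros continuous_on_compose2[OF cont]) auto
    moreover have "h \<in> X" unfolding X_def using r M(1) by simp
    ultimately obtain n where n: "dense_sequence n \<in> X" using dense_sequence by blast
    have "(gns.q (delta h - delta (dense_sequence n)))\<^sup>2 < (r / (2 * M))\<^sup>2"
      using n unfolding q_delta_diff X_def by simp
    then have qn: "gns.q (delta h - delta (dense_sequence n)) < r / (2 * M)"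
      by (rule power_less_imp_less_base) (use r M in auto)
    obtain N where N: "\<And>i. i \<ge> N \<Longrightarrow> cmod (gram_form (Z i) (delta (dense_sequence n))) < r / 2"
      using LIMSEQ_D[OF t[of n], of "r / 2"] r by auto
    have "cmod (gram_form (Z i) (delta h)) < r" if "i \<ge> N" for i
    proof -
      have "gram_form (Z i) (delta h) = gram_form (Z i) (delta h - delta (dense_sequence n)) + gram_form (Z i) (delta (dense_sequence n))"
        by (simp add: gns.B_diff2)
      then have "cmod (gram_form (Z i) (delta h)) \<le> cmod (gram_form (Z i) (delta h - delta (dense_sequence n))) + cmod (gram_form (Z i) (delta (dense_sequence n)))"
        by (simp only:) (rule norm_triangle_ineq)
      also have "\<dots> \<le> gns.q (Z i) * gns.q (delta h - delta (dense_sequence n)) + cmod (gram_form (Z i) (delta (dense_sequence n)))"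
        by (intro add_right_mono gns.cauchy_schwarz)
      also have "\<dots> \<le> M * gns.q (delta h - delta (dense_sequence n)) + cmod (gram_form (Z i) (delta (dense_sequence n)))"
        using M by (intro add_mono mult_right_mono) auto
      also have "\<dots> < M * (r / (2 * M)) + r / 2"
        using qn N[OF that] M(1) by (intro add_strict_mono mult_strict_left_mono) auto
      finally show ?thesis using M(1) by (simp add: field_simps)
    qed
    then show "\<exists>N. \<forall>i\<ge>N. norm (gram_form (Z i) (delta h) - 0) < r" by auto
  qed
  then have "(\<lambda>i. \<Sum>h\<in>Poly_Mapping.keys v. cnj (Poly_Mapping.lookup v h) * gram_form (Z i) (delta h)) \<longlonglongrightarrow> (\<Sum>h\<in>Poly_Mapping.keys v. cnj (Poly_Mapping.lookup v h) * 0)"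
    by (intro tendsto_intros)
  then show "(\<lambda>i. gram_form (Z i) v) \<longlonglongrightarrow> 0" unfolding gram_form_expand[of _ v] by simp
qed

sublocale gns: pre_representation scale gram_form "\<lambda>n. delta (dense_sequence n)" shift
proof
  fix g h :: 'g and x y :: "'g \<Rightarrow>\<^sub>0 complex" and c
  show "shift g (x + y) = shift g x + shift g y"
    by (rule poly_mapping_eqI) (simp add: lookup_shift lookup_add)
  show "shift g (scale c x) = scale c (shift g x)"
    by (rule poly_mapping_eqI) (simp add: lookup_shift lookup_scale)
  show iso: "gram_form (shift g x) (shift g y) = gram_form x y" for x y g
    unfolding gram_form_shift_shift unfolding gram_form_def by (simp add: minus_add add.assoc[symmetric])
  show "shift (g + h) x = shift g (shift h x)"
    by (rule poly_mapping_eqI) (simp add: lookup_shift minus_add add.assoc del: add_uminus_conv_diff)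
  show "shift 0 x = x"
    by (rule poly_mapping_eqI) (simp add: lookup_shift)
  have "(gns.q (shift h x - shift g x))\<^sup>2 = 2 * ((gns.q x)\<^sup>2 - Re (gram_form (shift h x) (shift g x)))" for h
  proof -
    have "(gns.q (shift h x - shift g x))\<^sup>2 = Re (gram_form (shift h x - shift g x) (shift h x - shift g x))"
      by (simp add: gns.B_self)
    also have "\<dots> = Re (gram_form x x) + Re (gram_form x x) - Re (gram_form (shift h x) (shift g x)) - Re (gram_form (shift g x) (shift h x))"
      by (simp add: gns.B_diff gns.B_diff2 iso)
    also have "Re (gram_form (shift g x) (shift h x)) = Re (gram_form (shift h x) (shift g x))"
      by (subst gns.B_comm) simp
    finally show ?thesis by (simp add: gns.B_self)
  qed
  moreover have "((\<lambda>h. 2 * ((gns.q x)\<^sup>2 - Re (gram_form (shift h x) (shift g x)))) \<longlongrightarrow> 2 * ((gns.q x)\<^sup>2 - Re (gram_form (shift g x) (shift g x)))) (at g)"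
  proof -
    have c: "((\<lambda>h. \<phi> (- (h + a) + (g + b))) \<longlongrightarrow> \<phi> (- (g + a) + (g + b))) (at g)" for a b
    proof -
      have "continuous_on UNIV (\<lambda>h. \<phi> (- (h + a) + (g + b)))"
        by (intro continuous_intros continuous_on_compose2[OF cont]) auto
      then show ?thesis by (simp add: continuous_on_def)
    qed
    show ?thesis unfolding gram_form_shift_shift by (intro tendsto_intros c)
  qed
  moreover have "Re (gram_form (shift g x) (shift g x)) = (gns.q x)\<^sup>2"
    unfolding iso[of g x x] by (simp add: gns.B_self)
  ultimately have "((\<lambda>h. (gns.q (shift h x - shift g x))\<^sup>2) \<longlongrightarrow> 0) (at g)"
    by simp
  then have "((\<lambda>h. sqrt ((gns.q (shift h x - shift g x))\<^sup>2)) \<longlongrightarrow> sqrt 0) (at g)" by (intro tendsto_intros)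
  then show "((\<lambda>h. gns.q (shift h x - shift g x)) \<longlongrightarrow> 0) (at g)" by simp
qed

lemma q_kernel_form: "(gns.q x)\<^sup>2 = kernel_form \<phi> (Poly_Mapping.lookup x)"
proof -
  have "Poly_Mapping.keys x = {g. Poly_Mapping.lookup x g \<noteq> 0}" by (auto simp: in_keys_iff)
  then have "kernel_form \<phi> (Poly_Mapping.lookup x) = Re (gram_form x x)" unfolding kernel_form_def gram_form_def by simp
  then show ?thesis by (simp add: gns.B_self)
qed

text \<open>
  By \<open>q_delta_diff\<close> the last hypothesis says that the point mass at 0 is a \<open>(K, \<epsilon>)\<close>-invariant vector.
  The conclusion avoids the GNS space, so that coefficients can be transported to any realisation of the
  kernel.
\<close>

lemma kazhdan_invariant_coefficients:
  assumes K: "kazhdan_pair K \<epsilon>" and \<epsilon>: "0 < \<epsilon>" and pos: "0 < \<phi> 0"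
    and small: "\<And>k. k \<in> K \<Longrightarrow> 2 * (\<phi> 0 - \<phi> k) < \<epsilon>\<^sup>2 * \<phi> 0"
  shows "\<exists>f :: nat \<Rightarrow> 'g \<Rightarrow> complex. (\<forall>i. finite {g. f i g \<noteq> 0}) \<and>
    (\<forall>r>0. \<exists>N. \<forall>m\<ge>N. \<forall>n\<ge>N. kernel_form \<phi> (\<lambda>g. f m g - f n g) < r) \<and>
    (\<forall>g. (\<lambda>i. kernel_form \<phi> (\<lambda>h. f i (- g + h) - f i h)) \<longlonglongrightarrow> 0) \<and>
    \<not> (\<lambda>i. kernel_form \<phi> (f i)) \<longlonglongrightarrow> 0"
proof -
  have q0: "(gns.q (delta 0))\<^sup>2 = \<phi> 0"
  proof -
    have "gram_form (delta 0) (delta 0) = of_real (\<phi> 0)" unfolding gram_form_delta by (simp add: delta_def)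
    then show ?thesis unfolding gns.B_self of_real_eq_iff .
  qed
  then have "gns.q (delta 0) \<noteq> 0" using pos by auto
  then have qpos: "0 < gns.q (delta 0)" using gns.q_nonneg[of "delta 0"] by linarith
  have "gns.q (shift k (delta 0) - delta 0) < \<epsilon> * gns.q (delta 0)" if "k \<in> K" for k
  proof (rule power_less_imp_less_base)
    have "shift k (delta 0) = delta k"
    proof (rule poly_mapping_eqI)
      fix h
      have "- k + h = 0 \<longleftrightarrow> h = k" using neg_eq_iff_add_eq_0[of "- k" h] by auto
      then show "Poly_Mapping.lookup (shift k (delta 0)) h = Poly_Mapping.lookup (delta k) h"
        unfolding lookup_shift delta_def lookup_single when_def by auto
    qed
    then have "(gns.q (shift k (delta 0) - delta 0))\<^sup>2 = 2 * (\<phi> 0 - \<phi> k)"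
      using q_delta_diff[of k 0] sym[of k] by simp
    also have "\<dots> < (\<epsilon> * gns.q (delta 0))\<^sup>2" using small[OF that] by (simp add: power_mult_distrib q0)
    finally show "(gns.q (shift k (delta 0) - delta 0))\<^sup>2 < (\<epsilon> * gns.q (delta 0))\<^sup>2" .
  qed (use \<epsilon> in simp)
  from gns.kazhdan_invariant_sequence[OF K qpos this] obtain X where X: "gns.cau X"
    "\<And>g. (\<lambda>i. gns.q (shift g (X i) - X i)) \<longlonglongrightarrow> 0" "\<not> (\<lambda>i. gns.q (X i)) \<longlonglongrightarrow> 0" by blast
  define f where "f i = Poly_Mapping.lookup (X i)" for i
  have 1: "finite {g. f i g \<noteq> 0}" for i unfolding f_def by simp
  have 2: "\<exists>N. \<forall>m\<ge>N. \<forall>n\<ge>N. kernel_form \<phi> (\<lambda>g. f m g - f n g) < r" if "0 < r" for r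
  proof -
    have "0 < sqrt r" using that by simp
    then obtain N where N: "\<And>m n. m \<ge> N \<Longrightarrow> n \<ge> N \<Longrightarrow> gns.q (X m - X n) < sqrt r"
      using X(1) unfolding gns.cau_def by metis
    have "kernel_form \<phi> (\<lambda>g. f m g - f n g) < r" if "m \<ge> N" "n \<ge> N" for m n
    proof -
      have "(gns.q (X m - X n))\<^sup>2 < (sqrt r)\<^sup>2" using N[OF that] by (intro power_strict_mono) auto
      moreover have "Poly_Mapping.lookup (X m - X n) = (\<lambda>g. f m g - f n g)" by (simp add: f_def lookup_minus fun_eq_iff)
      ultimately show ?thesis using \<open>0 < r\<close> by (simp add: q_kernel_form)
    qed
    then show ?thesis by blast
  qed
  have 3: "(\<lambda>i. kernel_form \<phi> (\<lambda>h. f i (- g + h) - f i h)) \<longlonglongrightarrow> 0" for g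
  proof -
    have "Poly_Mapping.lookup (shift g (X i) - X i) = (\<lambda>h. f i (- g + h) - f i h)" for i
      by (simp add: f_def lookup_minus lookup_shift fun_eq_iff)
    then have "kernel_form \<phi> (\<lambda>h. f i (- g + h) - f i h) = (gns.q (shift g (X i) - X i))\<^sup>2" for i
      by (simp add: q_kernel_form)
    then show ?thesis using tendsto_power[OF X(2)[of g], of 2] by simp
  qed
  have 4: "\<not> (\<lambda>i. kernel_form \<phi> (f i)) \<longlonglongrightarrow> 0"
  proof
    assume "(\<lambda>i. kernel_form \<phi> (f i)) \<longlonglongrightarrow> 0"
    then have "(\<lambda>i. (gns.q (X i))\<^sup>2) \<longlonglongrightarrow> 0" by (simp add: q_kernel_form f_def)
    then have "(\<lambda>i. sqrt ((gns.q (X i))\<^sup>2)) \<longlonglongrightarrow> sqrt 0" by (intro tendsto_intros)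
    then show False using X(3) by simp
  qed
  show ?thesis using 1 2 3 4 by blast
qed

end


section \<open>Measurable labels take countably many values\<close>

text \<open>
  Vitali's argument for cosets of the rational multiples of \<open>c\<close>.
\<close>

lemma ex_nonmeasurable_subset:
  assumes c: "0 < (c::real)"
  shows "\<exists>E\<subseteq>{0..c}. E \<notin> sets lebesgue"
proof (rule ccontr)
  assume "\<not> ?thesis"
  then have all: "E \<in> sets lebesgue" if "E \<subseteq> {0..c}" for E using that by blast
  define eqv where "eqv x y \<longleftrightarrow> (\<exists>q\<in>\<rat>. x - y = c * q)" for x y :: real
  define rep where "rep x = (SOME y. y \<in> {0..c} \<and> eqv x y)" for x
  have rep: "rep x \<in> {0..c} \<and> eqv x (rep x)" if "x \<in> {0..c}" for x
    unfolding rep_def by (rule someI[of _ x]) (use that in \<open>auto simp: eqv_def intro!: bexI[of _ 0]\<close>)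
  have eqv_rep: "rep x = rep y" if xy: "eqv x y" for x y
  proof -
    obtain q where q: "q \<in> \<rat>" "x - y = c * q" using xy unfolding eqv_def by blast
    have "eqv x z \<longleftrightarrow> eqv y z" for z
    proof
      assume "eqv x z"
      then obtain p where "p \<in> \<rat>" "x - z = c * p" unfolding eqv_def by blast
      then have "p - q \<in> \<rat>" "y - z = c * (p - q)" using q by (auto simp: algebra_simps)
      then show "eqv y z" unfolding eqv_def by blast
    next
      assume "eqv y z"
      then obtain p where "p \<in> \<rat>" "y - z = c * p" unfolding eqv_def by blast
      then have "p + q \<in> \<rat>" "x - z = c * (p + q)" using q by (auto simp: algebra_simps)
      then show "eqv x z" unfolding eqv_def by blast
    qed
    then show ?thesis unfolding rep_def by simp
  qed
  define V where "V = rep ` {0..c}"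
  have V: "V \<subseteq> {0..c}" using rep by (auto simp: V_def)
  then have VL: "V \<in> sets lebesgue" by (rule all)
  have V_unique: "v = w" if vw: "v \<in> V" "w \<in> V" "eqv v w" for v w
  proof -
    obtain x y where xy: "x \<in> {0..c}" "v = rep x" "y \<in> {0..c}" "w = rep y" using vw(1,2) unfolding V_def by blast
    have "rep v = rep x" using eqv_rep rep[OF xy(1)] xy(2) by metis
    moreover have "rep w = rep y" using eqv_rep rep[OF xy(3)] xy(4) by metis
    ultimately show ?thesis using eqv_rep[OF vw(3)] xy by simp
  qed
  define T where "T q = (\<lambda>v. c * q + v) ` V" for q
  have TL: "T q \<in> sets lebesgue" and Tm: "emeasure lebesgue (T q) = emeasure lebesgue V" for q
    using lebesgue_sets_translation[OF VL, of "c * q"] emeasure_lebesgue_affine[of 1 "c * q" V]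
    unfolding T_def by (simp_all add: add.commute)
  have disj: "q = r" if "T q \<inter> T r \<noteq> {}" "q \<in> \<rat>" "r \<in> \<rat>" for q r
  proof -
    obtain v w where vw: "v \<in> V" "w \<in> V" "c * q + v = c * r + w" using \<open>T q \<inter> T r \<noteq> {}\<close> unfolding T_def by auto
    then have "v - w = c * (r - q)" by (simp add: algebra_simps)
    moreover have "r - q \<in> \<rat>" using that by simp
    ultimately have "eqv v w" unfolding eqv_def by blast
    then have "v = w" using V_unique vw by blast
    then show ?thesis using vw(3) c by simp
  qed
  define Q where "Q = {q::real. q \<in> \<rat> \<and> -1 \<le> q \<and> q \<le> 1}"
  have Qc: "countable Q" unfolding Q_def using countable_rat by (rule countable_subset[rotated]) auto
  have cover: "{0..c} \<subseteq> (\<Union>q\<in>Q. T q)"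
  proof
    fix x assume x: "x \<in> {0..c}"
    obtain q where q: "q \<in> \<rat>" "x - rep x = c * q" using rep[OF x] unfolding eqv_def by blast
    have "\<bar>c * q\<bar> \<le> c" using x rep[OF x] q(2) by auto
    then have "\<bar>q\<bar> \<le> 1" using c by (simp add: abs_mult)
    then have "q \<in> Q" using q(1) by (auto simp: Q_def)
    moreover have "x \<in> T q" unfolding T_def V_def using q(2) x by (auto simp: image_iff intro!: bexI[of _ x])
    ultimately show "x \<in> (\<Union>q\<in>Q. T q)" by blast
  qed
  have small: "T q \<subseteq> {-c..2*c}" if "q \<in> Q" for q
  proof -
    have "\<bar>c * q\<bar> \<le> c * 1" using that c unfolding Q_def by (simp add: abs_mult abs_le_iff)
    then show ?thesis using V unfolding T_def by fastforce
  qed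
  show False
  proof (cases "emeasure lebesgue V = 0")
    case True
    then have "T q \<in> null_sets lebesgue" for q using TL Tm by auto
    then have "(\<Union>q\<in>Q. T q) \<in> null_sets lebesgue" using Qc by (intro null_sets_UN') auto
    then have "emeasure lebesgue {0..c} = 0"
      using emeasure_mono[OF cover, of lebesgue] by (auto simp: null_sets_def)
    then show False using c by simp
  next
    case False
    have fin: "emeasure lebesgue V \<le> ennreal c"
      using emeasure_mono[OF V, of lebesgue] c by simp
    define m where "m = measure lebesgue V"
    have em: "emeasure lebesgue V = ennreal m" unfolding m_def using fin
      by (intro emeasure_eq_ennreal_measure) (auto simp: top_unique)
    then have m0: "m > 0" using False by (metis ennreal_eq_0_iff not_le)
    define A where "A n = T (1 / (real n + 1))" for n
    have inQ: "1 / (real n + 1) \<in> Q" for n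
    proof -
      have "0 \<le> 1 / (real n + 1)" "1 / (real n + 1) \<le> 1" by (simp_all add: field_simps)
      moreover have "-1 \<le> 1 / (real n + 1)" using calculation(1) by linarith
      ultimately show ?thesis by (simp add: Q_def)
    qed
    have "disjoint_family A"
    proof (unfold disjoint_family_on_def, intro ballI impI)
      fix i j :: nat assume "i \<noteq> j"
      then have "1 / (real i + 1) \<noteq> 1 / (real j + 1)" by (simp add: field_simps)
      then show "A i \<inter> A j = {}" using disj[of "1 / (real i + 1)" "1 / (real j + 1)"] unfolding A_def by auto
    qed
    then have sum: "(\<Sum>i<n. emeasure lebesgue (A i)) = emeasure lebesgue (\<Union>i<n. A i)" for n
      using TL by (intro sum_emeasure) (auto simp: A_def disjoint_family_on_def)
    have "ennreal (real n * m) \<le> ennreal (3 * c)" for n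
    proof -
      have "ennreal (real n * m) = (\<Sum>i<n. emeasure lebesgue (A i))"
        by (simp add: A_def Tm em ennreal_mult ennreal_of_nat_eq_real_of_nat m0 less_imp_le)
      also have "\<dots> \<le> emeasure lebesgue {-c..2*c}"
        unfolding sum using small inQ by (intro emeasure_mono) (auto simp: A_def)
      also have "\<dots> = ennreal (3 * c)" using c by simp
      finally show ?thesis .
    qed
    then have "real n * m \<le> 3 * c" for n using c by (simp add: ennreal_le_iff)
    then show False using reals_Archimedean3[OF m0, rule_format, of "3 * c"] by (meson not_le)
  qed
qed

text \<open>
  Finite Borel measures on Polish spaces are perfect. Inner regularity is applied to the image of the measure
  on the graph of \<open>k\<close> over \<open>A\<close>: a compact subset of the graph has a compact projection.
\<close>

lemma perfect_measure:
  fixes N :: "'p::{second_countable_topology, complete_space} measure" and k :: "'p \<Rightarrow> real"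
  assumes N: "sets N = sets borel" "finite_measure N" and k: "k \<in> borel_measurable N"
    and A: "A \<in> sets N" and e: "0 < e"
  shows "\<exists>K. compact K \<and> K \<subseteq> k ` A \<and> measure N A \<le> measure N (A \<inter> k -` K) + e"
proof -
  interpret finite_measure N by fact
  have spN: "space N = UNIV" using N(1) by (metis sets_eq_imp_space_eq space_borel)
  have k': "k \<in> borel_measurable borel" using k N(1) by (simp cong: measurable_cong_sets)
  define g where "g p = (p, k p)" for p
  have g: "g \<in> N \<rightarrow>\<^sub>M borel" unfolding g_def
    using k measurable_ident_sets[OF N(1)] by (intro borel_measurable_Pair) (auto simp: id_def)
  define N' where "N' = distr N borel g"
  interpret N': finite_measure N' unfolding N'_def by (rule finite_measure_distr[OF g])
  define \<Gamma> where "\<Gamma> = {z. fst z \<in> A \<and> k (fst z) = snd z}"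
  have "\<Gamma> = {z \<in> space borel. fst z \<in> A} \<inter> {z \<in> space borel. k (fst z) = snd z}" by (auto simp: \<Gamma>_def)
  also have "\<dots> \<in> sets borel"
  proof (intro sets.Int)
    have f: "fst \<in> (borel :: ('p \<times> real) measure) \<rightarrow>\<^sub>M borel" "snd \<in> (borel :: ('p \<times> real) measure) \<rightarrow>\<^sub>M borel"
      by (intro borel_measurable_continuous_onI continuous_intros)+
    have "(\<lambda>z. k (fst z)) \<in> (borel :: ('p \<times> real) measure) \<rightarrow>\<^sub>M borel"
      using f(1) k' by (rule measurable_compose)
    then show "{z \<in> space borel. k (fst z) = snd z} \<in> sets borel" using f(2) by measurable
    show "{z \<in> space (borel :: ('p \<times> real) measure). fst z \<in> A} \<in> sets borel"
      using measurable_sets[OF f(1), of A] A N(1) by (simp add: vimage_def)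
  qed
  finally have \<Gamma>: "\<Gamma> \<in> sets borel" .
  have gG: "g -` \<Gamma> = A" by (auto simp: g_def \<Gamma>_def)
  have "emeasure N' \<Gamma> = (SUP K \<in> {K. K \<subseteq> \<Gamma> \<and> compact K}. emeasure N' K)"
    by (rule inner_regular) (auto simp: N'_def \<Gamma>[unfolded N'_def] N'.emeasure_finite[unfolded N'_def])
  moreover have "emeasure N' \<Gamma> = ennreal (measure N A)"
    using g \<Gamma> gG spN by (simp add: N'_def emeasure_distr emeasure_eq_measure)
  moreover have "\<exists>K. K \<subseteq> \<Gamma> \<and> compact K \<and> ennreal (measure N A) < emeasure N' K + ennreal e"
  proof (cases "measure N A < e")
    case True then show ?thesis by (intro exI[of _ "{}"]) (auto simp: ennreal_less_iff)
  next
    case False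
    then have "ennreal (measure N A - e) < ennreal (measure N A)" using e by (simp add: ennreal_less_iff)
    then obtain K where K: "K \<subseteq> \<Gamma>" "compact K" "ennreal (measure N A - e) < emeasure N' K"
      using calculation by (auto simp: less_SUP_iff)
    then have "measure N A - e < measure N' K" using False by (simp add: N'.emeasure_eq_measure ennreal_less_iff)
    then show ?thesis using K e
      by (intro exI[of _ K]) (auto simp: N'.emeasure_eq_measure ennreal_less_iff simp flip: ennreal_plus)
  qed
  ultimately obtain K where K: "K \<subseteq> \<Gamma>" "compact K" "ennreal (measure N A) < emeasure N' K + ennreal e" by blast
  have Km: "K \<in> sets borel" using K(2) by (simp add: borel_compact)
  have "measure N A < measure N' K + e"
    using K(3) e by (simp add: N'.emeasure_eq_measure ennreal_less_iff flip: ennreal_plus)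
  moreover have "measure N' K = measure N (g -` K)" using g Km spN by (simp add: N'_def measure_distr)
  moreover have "measure N (g -` K) \<le> measure N (A \<inter> k -` (snd ` K))"
  proof (rule finite_measure_mono)
    show "g -` K \<subseteq> A \<inter> k -` (snd ` K)" using K(1) by (force simp: g_def \<Gamma>_def)
    have "compact (snd ` K)" using K(2) by (intro compact_continuous_image continuous_intros)
    then have "k -` (snd ` K) \<inter> space N \<in> sets N" by (intro measurable_sets[OF k]) (simp add: borel_compact)
    then show "A \<inter> k -` (snd ` K) \<in> sets N" using A spN by auto
  qed
  moreover have "compact (snd ` K)" using K(2) by (intro compact_continuous_image continuous_intros)
  moreover have "snd ` K \<subseteq> k ` A" using K(1) by (force simp: \<Gamma>_def)
  ultimately show ?thesis by (intro exI[of _ "snd ` K"]) auto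
qed

text \<open>
  A law without atoms has a continuous distribution function, and this function transports the law to the
  uniform one.
\<close>

lemma uniform_cdf_transform:
  assumes D: "finite_borel_measure D" and atomless: "\<And>x. measure D {x} = 0"
  shows "distr D borel (cdf D) = density lborel (indicator {0..measure D UNIV})"
proof -
  interpret D: finite_borel_measure D by fact
  define F where "F = cdf D"
  define c where "c = measure D UNIV"
  have spD: "space D = UNIV" using D.M_is_borel by (metis sets_eq_imp_space_eq space_borel)
  have cont: "isCont F x" for x unfolding F_def D.isCont_cdf by (rule atomless)
  have mono: "F x \<le> F y" if "x \<le> y" for x y unfolding F_def by (rule D.cdf_nondecreasing[OF that])
  have F0: "0 \<le> F x" "F x \<le> c" for x
    unfolding F_def c_def using D.cdf_nonneg D.cdf_bounded spD by auto
  have bot: "(F \<longlongrightarrow> 0) at_bot" and top: "(F \<longlongrightarrow> c) at_top"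
    unfolding F_def c_def using D.cdf_lim_at_bot D.cdf_lim_at_top spD by auto
  have Fm: "F \<in> borel_measurable D"
    using borel_measurable_continuous_onI[of F] cont D.M_is_borel
    by (simp add: continuous_at_imp_continuous_on cong: measurable_cong_sets)
  define D' where "D' = distr D borel F"
  define U where "U = density lborel (indicator {0..c} :: real \<Rightarrow> ennreal)"
  have c0: "0 \<le> c" by (simp add: c_def)
  have "emeasure U UNIV = ennreal c"
    unfolding U_def using c0 by (subst emeasure_density) (auto simp: nn_integral_indicator)
  then have "finite_measure U" by (intro finite_measureI) (simp add: U_def)
  then have "finite_borel_measure U"
    by (simp add: finite_borel_measure_def finite_borel_measure_axioms_def U_def)
  moreover have "finite_borel_measure D'"
    unfolding finite_borel_measure_def finite_borel_measure_axioms_def D'_def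
    using D.finite_measure_distr[OF Fm] by auto
  moreover have "cdf D' s = cdf U s" for s
  proof -
    have cU: "cdf U s = measure lborel ({0..c} \<inter> {..s})"
      unfolding cdf_def U_def by (simp add: measure_restricted)
    have cD: "cdf D' s = measure D {r. F r \<le> s}"
      unfolding cdf_def D'_def using Fm by (simp add: measure_distr vimage_def spD)
    consider "s < 0" | "c \<le> s" | "0 \<le> s" "s < c" by linarith
    then show ?thesis
    proof cases
      case 1
      then have "{r. F r \<le> s} = {}" "{0..c} \<inter> {..s} = {}" using F0(1) by (auto simp: not_le intro: less_le_trans)
      then show ?thesis using cU cD by simp
    next
      case 2
      then have "{r. F r \<le> s} = UNIV" "{0..c} \<inter> {..s} = {0..c}" using F0(2) by (auto intro: order_trans)
      then show ?thesis using cU cD c0 by (simp add: c_def)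
    next
      case 3
      have e: "{0..c} \<inter> {..s} = {0..s}" using 3 by auto
      have "measure D {r. F r \<le> s} = s"
      proof (cases "{r. F r \<le> s} = {}")
        case True
        then have "s < F x" for x by (meson Collect_empty_eq not_le)
        then have "s \<le> 0" using bot by (intro tendsto_lowerbound[OF bot]) (auto simp: less_imp_le)
        then show ?thesis using True 3 by simp
      next
        case False
        obtain b where b: "s < F b"
          using order_tendstoD(1)[OF top 3(2)] by (meson eventually_happens trivial_limit_at_top_linorder)
        then have bdd: "r \<le> b" if "F r \<le> s" for r using that mono[of b r] by linarith
        \<comment> \<open>The sublevel set is a ray \<open>{..r}\<close>, and \<open>F r = s\<close> by continuity.\<close>
        define r where "r = Sup {r. F r \<le> s}"
        have cl: "closed {r. F r \<le> s}"
          using cont by (intro closed_Collect_le continuous_at_imp_continuous_on) auto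
        have rin: "r \<in> {r. F r \<le> s}"
          unfolding r_def using False bdd cl by (intro closed_contains_Sup) (auto simp: bdd_above_def)
        have ub: "x \<le> r" if "F x \<le> s" for x
          unfolding r_def using that bdd by (intro cSup_upper) (auto simp: bdd_above_def)
        have "{r. F r \<le> s} = {..r}" proof -
          have "F x \<le> s" if "x \<le> r" for x using mono[OF that] rin by simp
          then show ?thesis using ub by blast
        qed
        moreover have "F r = s"
        proof (rule ccontr)
          assume "F r \<noteq> s"
          then have "F r < s" using rin by auto
          then have "\<forall>\<^sub>F x in at r. F x < s"
            using cont[of r] unfolding isCont_def by (intro order_tendstoD(2))
          then obtain d where d: "0 < d" "\<And>x. x \<noteq> r \<Longrightarrow> dist x r < d \<Longrightarrow> F x < s"
            unfolding eventually_at by auto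
          then have "F (r + d / 2) < s" by (simp add: dist_real_def)
          then show False using ub[of "r + d / 2"] d(1) by simp
        qed
        ultimately show ?thesis by (simp add: F_def cdf_def)
      qed
      then show ?thesis using cU cD e 3 by simp
    qed
  qed
  ultimately have "D' = U" by (intro cdf_unique') auto
  then show ?thesis unfolding D'_def U_def F_def c_def .
qed

lemma finite_measure_atoms_countable:
  assumes "finite_measure M" and lab: "\<And>E. {w \<in> space M. l w \<in> E} \<in> sets M"
  shows "countable {i. measure M {w \<in> space M. l w = i} \<noteq> 0}"
proof -
  interpret finite_measure M by fact
  have "finite_measure (distr M (count_space UNIV) l)"
    using lab by (intro finite_measure_distr) (auto simp: measurable_count_space_eq2_countable measurable_def vimage_def Collect_conj_eq Int_commute)
  then have "countable {x. measure (distr M (count_space UNIV) l) {x} \<noteq> 0}"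
    by (intro finite_measure.countable_support) auto
  moreover have "measure (distr M (count_space UNIV) l) {x} = measure M {w \<in> space M. l w = x}" for x
    using lab by (subst measure_distr) (auto simp: measurable_def vimage_def Collect_conj_eq Int_commute)
  ultimately show ?thesis by simp
qed

text \<open>
  All preimages under \<open>l\<close>, not only those of Borel sets, are measurable. If \<open>l\<close> were not concentrated on its
  atoms, the law of the remaining part could be transported to the uniform law on \<open>{0..c}\<close> by a map \<open>k\<close> with the
  same property. Perfectness, applied to the preimages of \<open>E\<close> and of \<open>{0..c} - E\<close>, would then squeeze every
  \<open>E \<subseteq> {0..c}\<close> between Borel sets of the same measure, which makes every \<open>E\<close> Lebesgue measurable.
\<close>

lemma real_label_countable:
  fixes N :: "'p::{second_countable_topology, complete_space} measure" and l :: "'p \<Rightarrow> real"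
  assumes N: "sets N = sets borel" "finite_measure N"
    and lab: "\<And>E. l -` E \<in> sets N"
  shows "\<exists>E. countable E \<and> (AE p in N. l p \<in> E)"
proof -
  interpret N: finite_measure N by fact
  have spN: "space N = UNIV" using N(1) by (metis sets_eq_imp_space_eq space_borel)
  define E0 where "E0 = {i. measure N {w \<in> space N. l w = i} \<noteq> 0}"
  have cE0: "countable E0" unfolding E0_def
    using lab spN by (intro finite_measure_atoms_countable[OF N(2)]) (simp add: vimage_def)
  define Z where "Z = l -` (- E0)"
  have Z: "Z \<in> sets N" unfolding Z_def by (rule lab)
  define D where "D = distr (density N (indicator Z)) borel l"
  have lN: "l \<in> borel_measurable N" using lab spN by (intro measurableI) auto
  have mD: "measure D B = measure N (Z \<inter> l -` B)" if "B \<in> sets borel" for B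
    using that lab Z lN spN unfolding D_def by (simp add: measure_distr measure_restricted)
  have finZ: "finite_measure (density N (indicator Z))"
    using Z by (intro finite_measureI) (auto simp: emeasure_density N.emeasure_finite)
  have D: "finite_borel_measure D"
    unfolding finite_borel_measure_def finite_borel_measure_axioms_def D_def
    using finite_measure.finite_measure_distr[OF finZ, of l borel] lN by auto
  have "measure D {x} = 0" for x
  proof (cases "x \<in> E0")
    case True
    then have "Z \<inter> l -` {x} = {}" by (auto simp: Z_def)
    then show ?thesis by (simp add: mD)
  next
    case False
    then have "measure N (l -` {x}) = 0" using spN by (simp add: E0_def vimage_def)
    moreover have "measure N (Z \<inter> l -` {x}) \<le> measure N (l -` {x})" using lab by (intro N.finite_measure_mono) auto
    ultimately have "measure N (Z \<inter> l -` {x}) = 0" using measure_nonneg[of N "Z \<inter> l -` {x}"] by linarith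
    then show ?thesis by (simp add: mD)
  qed
  note uni = uniform_cdf_transform[OF D this]
  define c where "c = measure D UNIV"
  have cZ: "c = measure N Z" unfolding c_def by (simp add: mD)
  have Fm: "cdf D \<in> borel_measurable borel"
    using finite_borel_measure.cdf_nondecreasing[OF D] by (intro borel_measurable_mono) (auto simp: mono_def)
  define k where "k p = cdf D (l p)" for p
  have kN: "k \<in> borel_measurable N" unfolding k_def using lN Fm by (rule measurable_compose)
  have klab: "k -` E \<in> sets N" for E using lab[of "cdf D -` E"] by (simp add: k_def vimage_def)
  have kc: "k p \<in> {0..c}" for p
    unfolding k_def c_def using finite_borel_measure.cdf_nonneg[OF D] finite_borel_measure.cdf_bounded[OF D]
    by (simp add: D_def)
  have kuni: "measure N (Z \<inter> k -` B) \<le> measure lborel (B \<inter> {0..c})" if B: "B \<in> sets borel" for B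
  proof -
    have "measure (distr D borel (cdf D)) B = measure N (Z \<inter> k -` B)"
      using B Fm by (subst measure_distr) (auto simp: D_def mD[unfolded D_def] k_def vimage_def measurable_sets_borel)
    moreover have "measure (density lborel (indicator {0..c} :: real \<Rightarrow> ennreal)) B = measure lborel (B \<inter> {0..c})"
      using B by (simp add: measure_restricted Int_commute)
    ultimately show ?thesis using uni unfolding c_def by simp
  qed
  have "c = 0"
  proof (rule ccontr)
    assume "c \<noteq> 0"
    then have "0 < c" using cZ by (simp add: zero_less_measure_iff)
    then obtain E where E: "E \<subseteq> {0..c}" "E \<notin> sets lebesgue" using ex_nonmeasurable_subset by blast
    have ap: "\<exists>K. compact K \<and> K \<subseteq> B \<and> measure N (Z \<inter> k -` B) \<le> measure lborel K + e"
      if B: "B \<subseteq> {0..c}" and e: "0 < e" for B e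
    proof -
      obtain K where K: "compact K" "K \<subseteq> k ` (Z \<inter> k -` B)"
        "measure N (Z \<inter> k -` B) \<le> measure N (Z \<inter> k -` B \<inter> k -` K) + e"
        using perfect_measure[OF N kN _ e, of "Z \<inter> k -` B"] Z klab by auto
      have KB: "K \<subseteq> B" using K(2) by auto
      have "measure N (Z \<inter> k -` B \<inter> k -` K) \<le> measure N (Z \<inter> k -` K)"
        using Z klab by (intro N.finite_measure_mono) auto
      also have "\<dots> \<le> measure lborel (K \<inter> {0..c})" using kuni K(1) by (simp add: borel_compact)
      also have "K \<inter> {0..c} = K" using KB B by auto
      finally show ?thesis using K KB by (intro exI[of _ K]) auto
    qed
    obtain K where K: "\<And>n. compact (K n)" "\<And>n. K n \<subseteq> E"
      "\<And>n. measure N (Z \<inter> k -` E) \<le> measure lborel (K n) + 1 / (real n + 1)"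
      using ap[OF E(1), of "1 / (real _ + 1)"] by (metis add.commute of_nat_0_less_iff of_nat_Suc zero_less_Suc zero_less_divide_1_iff)
    obtain L where L: "\<And>n. compact (L n)" "\<And>n. L n \<subseteq> {0..c} - E"
      "\<And>n. measure N (Z \<inter> k -` ({0..c} - E)) \<le> measure lborel (L n) + 1 / (real n + 1)"
      using ap[of "{0..c} - E" "1 / (real _ + 1)"] by (metis Diff_subset add.commute of_nat_0_less_iff of_nat_Suc zero_less_Suc zero_less_divide_1_iff)
    have KLb: "K n \<in> sets borel" "L n \<in> sets borel" for n using K(1) L(1) by (auto simp: borel_compact)
    define A where "A = (\<Union>n. K n)"
    define W where "W = {0..c} - (\<Union>n. L n)"
    have AW: "A \<subseteq> E" "E \<subseteq> W" "A \<in> sets borel" "W \<in> sets borel"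
      using K(2) L(2) E(1) KLb unfolding A_def W_def by auto
    have "Z = (Z \<inter> k -` E) \<union> (Z \<inter> k -` ({0..c} - E))" using kc by blast
    then have "c = measure N ((Z \<inter> k -` E) \<union> (Z \<inter> k -` ({0..c} - E)))" using cZ by simp
    also have "\<dots> = measure N (Z \<inter> k -` E) + measure N (Z \<inter> k -` ({0..c} - E))"
      using Z klab by (intro N.finite_measure_Union) auto
    finally have cEE: "c = measure N (Z \<inter> k -` E) + measure N (Z \<inter> k -` ({0..c} - E))" .
    have small: "emeasure lborel (W - A) \<le> ennreal (2 / (real n + 1))" for n
    proof -
      have sub: "W - A \<subseteq> {0..c} - (L n \<union> K n)" unfolding W_def A_def by auto
      have disj: "L n \<inter> K n = {}" using K(2)[of n] L(2)[of n] by auto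
      have inc: "L n \<union> K n \<subseteq> {0..c}" using K(2)[of n] L(2)[of n] E(1) by auto
      have fin: "emeasure lborel (K n) \<noteq> \<infinity>" "emeasure lborel (L n) \<noteq> \<infinity>"
        using K(1) L(1) emeasure_compact_finite by (metis infinity_ennreal_def less_top)+
      have "measure lborel ({0..c} - (L n \<union> K n)) = c - measure lborel (L n \<union> K n)"
        using inc KLb \<open>0 < c\<close> by (subst measure_Diff) auto
      also have "measure lborel (L n \<union> K n) = measure lborel (L n) + measure lborel (K n)"
        using disj KLb fin by (intro measure_Union) auto
      finally have "measure lborel ({0..c} - (L n \<union> K n)) \<le> 2 / (real n + 1)"
        using K(3)[of n] L(3)[of n] cEE by simp
      moreover have "emeasure lborel ({0..c} - (L n \<union> K n)) \<noteq> \<infinity>"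
        using emeasure_mono[of "{0..c} - (L n \<union> K n)" "{0..c}" lborel] \<open>0 < c\<close> by (auto simp: top_unique)
      ultimately have "emeasure lborel ({0..c} - (L n \<union> K n)) \<le> ennreal (2 / (real n + 1))"
        by (simp add: emeasure_eq_ennreal_measure ennreal_leI)
      then show ?thesis using emeasure_mono[OF sub, of lborel] KLb by auto
    qed
    have "emeasure lborel (W - A) = 0"
    proof (rule ccontr)
      assume n0: "emeasure lborel (W - A) \<noteq> 0"
      have "(\<lambda>n. ennreal (2 / (real n + 1))) \<longlonglongrightarrow> ennreal 0"
        by (intro tendsto_ennrealI) real_asymp
      then have "emeasure lborel (W - A) \<le> ennreal 0"
        using small by (intro tendsto_lowerbound[of _ "ennreal 0" sequentially]) auto
      then show False using n0 by simp
    qed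
    then have "W - A \<in> null_sets lborel" using AW by auto
    then have "W - A \<in> null_sets lebesgue" by (rule null_sets_completionI)
    then have "E - A \<in> null_sets lebesgue"
      using AW(2) by (intro null_sets_completion_subset[of "E - A" "W - A" lborel] Diff_mono) simp_all
    then have "A \<union> (E - A) \<in> sets lebesgue" using AW(3) by (intro sets.Un) auto
    moreover have "A \<union> (E - A) = E" using AW by auto
    ultimately show False using E(2) by simp
  qed
  then have "Z \<in> null_sets N" using cZ Z by (auto simp: N.emeasure_eq_measure)
  then have "AE p in N. p \<notin> Z" by (rule AE_not_in)
  then show ?thesis using cE0 by (intro exI[of _ E0]) (auto simp: Z_def)
qed


section \<open>Essentially separable values\<close>

text \<open>
  The part of being standard Borel that is needed: an isomorphism with a Borel subset of \<open>\<real>\<^sup>\<omega>\<close>, which is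
  Polish. It only speaks of sigma-algebras, which lets it pass to products.
\<close>

definition borel_embeddable :: "'a measure \<Rightarrow> bool" where
  "borel_embeddable M \<longleftrightarrow> (\<exists>J :: 'a \<Rightarrow> nat \<Rightarrow> real.
     inj_on J (space M) \<and> J \<in> borel_measurable M \<and> (\<forall>A\<in>sets M. J ` A \<in> sets borel))"

lemma image_sets_sigma:
  assumes gen: "sets M = sigma_sets (space M) \<G>" and inj: "inj_on J (space M)"
    and sp: "J ` space M \<in> sets borel" and img: "\<And>A. A \<in> \<G> \<Longrightarrow> A \<subseteq> space M \<and> J ` A \<in> sets borel"
    and A: "A \<in> sets M"
  shows "J ` A \<in> sets borel"
proof -
  have "A \<in> sigma_sets (space M) \<G>" using A gen by simp
  then have "A \<subseteq> space M \<and> J ` A \<in> sets borel"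
  proof induction
    case (Compl A)
    then have "J ` (space M - A) = J ` space M - J ` A" using inj by (simp add: inj_on_image_set_diff)
    then show ?case using Compl sp by auto
  next
    case (Union A) then show ?case by (auto simp: image_UN)
  qed (use img in auto)
  then show ?thesis ..
qed

text \<open>
  The distances to a dense sequence embed a Polish space homeomorphically into \<open>\<real>\<^sup>\<omega>\<close>. The image is completely
  metrizable, hence a \<open>G\<^sub>\<delta>\<close> set.
\<close>

lemma standard_borel_embeddable:
  assumes "standard_borel M"
  shows "borel_embeddable M"
proof -
  obtain T where T: "completely_metrizable_space T" "second_countable T" "topspace T = space M"
    "sets M = sigma_sets (space M) {U. openin T U}"
    using assms unfolding standard_borel_def by blast
  obtain S d where "Metric_space S d" and TS: "T = Metric_space.mtopology S d"
    using T(1) unfolding completely_metrizable_space_def by blast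
  interpret Metric_space S d by fact
  have S: "S = space M" using T(3) TS by simp
  obtain C where C: "countable C" "C \<subseteq> S" "T closure_of C = S"
    using second_countable_imp_separable_space[OF T(2)] T(3) S unfolding separable_space_def by auto
  have near: "\<exists>q\<in>C. d q w < e" if we: "w \<in> S" "0 < e" for w e
  proof -
    have "w \<in> {x \<in> S. \<forall>r>0. \<exists>y\<in>C. y \<in> mball x r}"
      using we(1) C(3) unfolding TS metric_closure_of by simp
    then obtain q where "q \<in> C" "q \<in> mball w e" using we(2) by blast
    then show ?thesis by (auto simp: commute)
  qed
  show ?thesis
  proof (cases "S = {}")
    case True
    then have "sets M = {{}}" using S space_empty_iff by metis
    then show ?thesis using True S unfolding borel_embeddable_def
      by (intro exI[of _ "\<lambda>_ _. 0"]) auto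
  next
    case False
    then have "C \<noteq> {}" using near by (metis all_not_in_conv zero_less_one)
    then obtain q :: "nat \<Rightarrow> 'a" where q: "range q = C" using C(1) by (metis range_from_nat_into)
    have qS: "q n \<in> S" for n using q C(2) by auto
    have near': "\<exists>n. d (q n) w < e" if "w \<in> S" "0 < e" for w e
      using near[OF that] q by (metis imageE)
    define J where "J w n = d (q n) w" for w n
    have "continuous_map mtopology euclideanreal (\<lambda>w. d (q k) w)" for k
      using continuous_on_mdist[of "q k" "metric (S, d)"] qS[of k] by (simp add: mtopology_of_def)
    then have cont: "continuous_map T euclidean J"
      unfolding euclidean_product_topology[symmetric] continuous_map_componentwise_UNIV J_def TS by blast
    have op: "\<exists>V. open V \<and> J ` U = V \<inter> J ` S" if U: "openin T U" for U
    proof -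
      define V where "V = (\<Union>(n, r) \<in> {(n, r). 0 < r \<and> mball (q n) r \<subseteq> U}. {f :: nat \<Rightarrow> real. f n < r})"
      have "open {f :: nat \<Rightarrow> real. f n < r}" for n r
        by (intro open_Collect_less continuous_intros) (rule continuous_on_product_coordinates)
      then have "open V" unfolding V_def by auto
      moreover have "J ` U = V \<inter> J ` S"
      proof (intro equalityI subsetI)
        fix f assume "f \<in> J ` U"
        then obtain w where w: "w \<in> U" "f = J w" by auto
        then have wS: "w \<in> S" using openin_subset[OF U] TS by auto
        obtain r where r: "0 < r" "mball w r \<subseteq> U" using U w(1) unfolding TS openin_mtopology by blast
        obtain n where n: "d (q n) w < r / 2" using near'[OF wS, of "r/2"] r(1) by auto
        have "mball (q n) (r / 2) \<subseteq> mball w r"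
        proof
          fix v assume "v \<in> mball (q n) (r / 2)"
          then show "v \<in> mball w r" using n triangle[of w "q n" v] wS qS[of n] by (auto simp: commute)
        qed
        then have "(n, r / 2) \<in> {(n, r). 0 < r \<and> mball (q n) r \<subseteq> U}" using r by auto
        moreover have "f n < r / 2" using n w(2) by (simp add: J_def)
        ultimately have "f \<in> V" unfolding V_def by blast
        then show "f \<in> V \<inter> J ` S" using wS w by auto
      next
        fix f assume "f \<in> V \<inter> J ` S"
        then obtain w n r where "w \<in> S" "f = J w" "mball (q n) r \<subseteq> U" "J w n < r" unfolding V_def by auto
        then have "w \<in> mball (q n) r" using qS by (auto simp: J_def)
        then show "f \<in> J ` U" using \<open>mball (q n) r \<subseteq> U\<close> \<open>f = J w\<close> by auto
      qed
      ultimately show ?thesis by blast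
    qed
    have inj: "inj_on J S"
    proof
      fix v w assume vw: "v \<in> S" "w \<in> S" "J v = J w"
      show "v = w"
      proof (rule ccontr)
        assume "v \<noteq> w"
        then have "0 < d v w" using vw by simp
        then obtain n where n: "d (q n) v < d v w / 2" using near'[OF vw(1), of "d v w / 2"] by auto
        moreover have "d (q n) w = d (q n) v" using vw(3) unfolding J_def by metis
        ultimately show False using triangle[of v "q n" w] vw qS[of n] by (simp add: commute)
      qed
    qed
    have "homeomorphic_map T (subtopology euclidean (J ` S)) J"
    proof (rule bijective_open_imp_homeomorphic_map)
      show "continuous_map T (subtopology euclidean (J ` S)) J"
        using cont by (auto simp: continuous_map_in_subtopology TS)
      show "open_map T (subtopology euclidean (J ` S)) J"
        unfolding open_map_def
      proof (intro allI impI)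
        fix U assume "openin T U"
        from op[OF this] show "openin (subtopology euclidean (J ` S)) (J ` U)"
          by (metis inf_commute openin_open)
      qed
    qed (use inj in \<open>auto simp: TS\<close>)
    then have "completely_metrizable_space (subtopology euclidean (J ` S))"
      using T(1) homeomorphic_completely_metrizable_space homeomorphic_map_imp_homeomorphic_space by blast
    then have "gdelta_in euclidean (J ` S)"
      by (intro completely_metrizable_space_imp_gdelta_in metrizable_space_euclidean) simp_all
    then obtain \<V> where V: "countable \<V>" "\<V> \<subseteq> Collect (openin euclidean)" "\<Inter>\<V> = J ` S"
      unfolding gdelta_in_alt intersection_of_def by blast
    have "\<Inter>\<V> \<in> sets borel"
    proof (cases "\<V> = {}")
      case False
      have "open V" if "V \<in> \<V>" for V using that V(2) by auto
      then have "(\<Inter>V\<in>\<V>. V) \<in> sets borel"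
        using V(1) False by (intro sets.countable_INT') auto
      then show ?thesis by simp
    qed simp
    then have JS: "J ` S \<in> sets borel" using V(3) by simp
    have "J ` A \<in> sets borel" if "A \<in> sets M" for A
    proof (rule image_sets_sigma[OF T(4)])
      fix U assume "U \<in> {U. openin T U}"
      then have "openin T U" by simp
      from op[OF this] openin_subset[OF this] show "U \<subseteq> space M \<and> J ` U \<in> sets borel"
        using JS T(3) by auto
    qed (use inj JS S that in auto)
    moreover have "J \<in> borel_measurable M"
    proof (rule borel_measurableI)
      fix W :: "(nat \<Rightarrow> real) set" assume "open W"
      then have "openin T {x \<in> topspace T. J x \<in> W}"
        using cont by (intro openin_continuous_map_preimage[OF cont]) simp
      moreover have "{x \<in> topspace T. J x \<in> W} = J -` W \<inter> space M" using T(3) by auto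
      ultimately show "J -` W \<inter> space M \<in> sets M" unfolding T(4) by auto
    qed
    ultimately show ?thesis using inj S unfolding borel_embeddable_def by blast
  qed
qed

lemma borel_embeddable_pair:
  assumes "borel_embeddable M" "borel_embeddable N"
  shows "borel_embeddable (M \<Otimes>\<^sub>M N)"
proof -
  obtain I where I: "inj_on I (space M)" "I \<in> borel_measurable M" "\<And>A. A \<in> sets M \<Longrightarrow> I ` A \<in> sets (borel :: (nat \<Rightarrow> real) measure)"
    using assms(1) unfolding borel_embeddable_def by auto
  obtain J where J: "inj_on J (space N)" "J \<in> borel_measurable N" "\<And>A. A \<in> sets N \<Longrightarrow> J ` A \<in> sets (borel :: (nat \<Rightarrow> real) measure)"
    using assms(2) unfolding borel_embeddable_def by auto
  define L where "L z n = (if even n then I (fst z) (n div 2) else J (snd z) (n div 2))" for z n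
  have L2: "L z (2 * n) = I (fst z) n" "L z (2 * n + 1) = J (snd z) n" for z n by (auto simp: L_def)
  define p0 p1 :: "(nat \<Rightarrow> real) \<Rightarrow> nat \<Rightarrow> real" where "p0 f n = f (2 * n)" and "p1 f n = f (2 * n + 1)" for f n
  have p: "p0 (L z) = I (fst z)" "p1 (L z) = J (snd z)" for z
    by (auto simp: p0_def p1_def L2 simp del: One_nat_def)
  have pm: "p0 \<in> borel_measurable borel" "p1 \<in> borel_measurable borel"
    unfolding p0_def p1_def by (intro measurable_coordinatewise_then_product borel_measurable_continuous_onI continuous_on_product_coordinates)+
  have inj: "inj_on L (space (M \<Otimes>\<^sub>M N))"
  proof
    fix z w assume zw: "z \<in> space (M \<Otimes>\<^sub>M N)" "w \<in> space (M \<Otimes>\<^sub>M N)" and "L z = L w"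
    then have "I (fst z) = I (fst w)" "J (snd z) = J (snd w)" using p by metis+
    moreover have "fst z \<in> space M" "fst w \<in> space M" "snd z \<in> space N" "snd w \<in> space N"
      using zw by (simp_all add: space_pair_measure mem_Times_iff)
    ultimately show "z = w" using I(1) J(1) by (intro prod_eqI) (simp_all add: inj_on_def)
  qed
  have rect: "L ` (A \<times> B) \<in> sets borel" if "A \<in> sets M" "B \<in> sets N" for A B
  proof -
    have "L ` (A \<times> B) = p0 -` (I ` A) \<inter> p1 -` (J ` B)"
    proof (intro equalityI subsetI)
      fix f assume "f \<in> p0 -` (I ` A) \<inter> p1 -` (J ` B)"
      then obtain a b where ab: "a \<in> A" "b \<in> B" "p0 f = I a" "p1 f = J b" by auto
      have "f n = L (a, b) n" for n
      proof (cases "even n")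
        case True
        then show ?thesis using fun_cong[OF ab(3), of "n div 2"] by (simp add: p0_def L_def)
      next
        case False
        then show ?thesis using fun_cong[OF ab(4), of "n div 2"] by (simp add: p1_def L_def)
      qed
      then have "f = L (a, b)" by auto
      then show "f \<in> L ` (A \<times> B)" using ab by auto
    qed (auto simp: p)
    also have "\<dots> \<in> sets borel"
      using measurable_sets[OF pm(1) I(3)[OF that(1)]] measurable_sets[OF pm(2) J(3)[OF that(2)]] by auto
    finally show ?thesis .
  qed
  have "L ` A \<in> sets borel" if "A \<in> sets (M \<Otimes>\<^sub>M N)" for A
  proof (rule image_sets_sigma[OF _ inj _ _ that])
    show "sets (M \<Otimes>\<^sub>M N) = sigma_sets (space (M \<Otimes>\<^sub>M N)) {a \<times> b | a b. a \<in> sets M \<and> b \<in> sets N}"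
      by (simp add: sets_pair_measure space_pair_measure)
    show "L ` space (M \<Otimes>\<^sub>M N) \<in> sets borel" unfolding space_pair_measure by (rule rect) auto
    fix C assume "C \<in> {a \<times> b | a b. a \<in> sets M \<and> b \<in> sets N}"
    then show "C \<subseteq> space (M \<Otimes>\<^sub>M N) \<and> L ` C \<in> sets borel"
      using rect by (auto simp: space_pair_measure dest: sets.sets_into_space)
  qed
  moreover have "L \<in> borel_measurable (M \<Otimes>\<^sub>M N)"
  proof (rule measurable_coordinatewise_then_product)
    fix n
    have c: "(\<lambda>f :: nat \<Rightarrow> real. f k) \<in> borel_measurable borel" for k
      by (intro borel_measurable_continuous_onI continuous_on_product_coordinates)
    show "(\<lambda>z. L z n) \<in> borel_measurable (M \<Otimes>\<^sub>M N)"
      unfolding L_def using I(2) J(2) c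
      by (cases "even n") (auto intro!: measurable_compose[OF _ c] measurable_compose[OF measurable_fst] measurable_compose[OF measurable_snd])
  qed
  ultimately show ?thesis using inj unfolding borel_embeddable_def by blast
qed

text \<open>
  The labels may come from any type: only those that occur matter, and choosing a point \<open>w0\<close> for each of
  them injects the labels into the space, hence into \<open>\<real>\<^sup>\<omega>\<close> and \<open>\<real>\<close>.
\<close>

lemma label_countable:
  assumes emb: "borel_embeddable M" and fin: "finite_measure M"
    and lab: "\<And>E. {w \<in> space M. l w \<in> E} \<in> sets M"
  shows "\<exists>E. countable E \<and> (AE w in M. l w \<in> E)"
proof -
  interpret finite_measure M by fact
  obtain J where J: "inj_on J (space M)" "J \<in> borel_measurable M" "\<And>A. A \<in> sets M \<Longrightarrow> J ` A \<in> sets (borel :: (nat \<Rightarrow> real) measure)"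
    using emb unfolding borel_embeddable_def by auto
  obtain \<iota> :: "(nat \<Rightarrow> real) \<Rightarrow> real" where \<iota>: "inj \<iota>"
  proof -
    \<comment> \<open>A point is determined by the rational cuts below its coordinates, hence by a set of natural numbers.\<close>
    define a :: "(nat \<Rightarrow> real) \<Rightarrow> nat set" where
      "a f = {n. of_rat (from_nat (snd (prod_decode n))) < f (fst (prod_decode n))}" for f
    have "inj a"
    proof
      fix f g assume "a f = a g"
      show "f = g"
      proof (rule ccontr)
        assume "f \<noteq> g"
        then obtain n where n: "f n \<noteq> g n" by auto
        obtain r where r: "min (f n) (g n) < of_rat r" "of_rat r < max (f n) (g n)"
        proof -
          have "min (f n) (g n) < max (f n) (g n)" using n by (simp add: min_def max_def)
          from of_rat_dense[OF this] show ?thesis using that by blast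
        qed
        have "prod_encode (n, to_nat r) \<in> a f \<longleftrightarrow> prod_encode (n, to_nat r) \<in> a g" using \<open>a f = a g\<close> by simp
        then show False using r by (auto simp: a_def min_def max_def split: if_splits)
      qed
    qed
    moreover obtain b :: "nat set \<Rightarrow> real" where "inj b"
      using nat_sets_eqpoll_reals unfolding eqpoll_def by (meson bij_betw_imp_inj_on)
    ultimately have "inj (b \<circ> a)" by (rule inj_compose[rotated])
    then show ?thesis using that by blast
  qed
  define w0 where "w0 i = (SOME w. w \<in> space M \<and> l w = i)" for i
  have w0: "w0 (l w) \<in> space M \<and> l (w0 (l w)) = l w" if "w \<in> space M" for w
    unfolding w0_def by (rule someI[of _ w]) (use that in auto)
  define lr where "lr w = \<iota> (J (w0 (l w)))" for w
  have lr: "l v = l w" if "lr v = lr w" "v \<in> space M" "w \<in> space M" for v w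
  proof -
    have "J (w0 (l v)) = J (w0 (l w))" using that(1) \<iota> unfolding lr_def by (metis injD)
    then have "w0 (l v) = w0 (l w)" using J(1) w0 that by (metis inj_onD)
    then show ?thesis using w0 that by metis
  qed
  \<comment> \<open>The labelling is carried over to the Polish space \<open>\<real>\<^sup>\<omega>\<close>, with a dummy value off the image.\<close>
  define N where "N = distr M borel J"
  define k where "k p = (if p \<in> J ` space M then lr (the_inv_into (space M) J p) else 0)" for p
  have kJ: "k (J w) = lr w" if "w \<in> space M" for w
    unfolding k_def using that J(1) by (simp add: the_inv_into_f_f)
  have "k -` E \<in> sets N" for E
  proof -
    have "p \<in> k -` E \<longleftrightarrow> p \<in> J ` {w \<in> space M. lr w \<in> E} \<union> (if 0 \<in> E then - J ` space M else {})" for p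
    proof (cases "p \<in> J ` space M")
      case True
      then obtain w where w: "w \<in> space M" "p = J w" by blast
      have "p \<in> J ` {w \<in> space M. lr w \<in> E} \<longleftrightarrow> lr w \<in> E"
        unfolding w(2) using w(1) inj_onD[OF J(1)] by blast
      then show ?thesis using True kJ[OF w(1)] w(2) by auto
    next
      case False
      then have "p \<notin> J ` {w \<in> space M. lr w \<in> E}" by blast
      then show ?thesis using False by (simp add: k_def)
    qed
    then have "k -` E = J ` {w \<in> space M. lr w \<in> E} \<union> (if 0 \<in> E then - J ` space M else {})"
      by blast
    moreover have "{w \<in> space M. lr w \<in> E} \<in> sets M" unfolding lr_def using lab[of "{i. \<iota> (J (w0 i)) \<in> E}"] by simp
    ultimately show ?thesis using J(3)[of "{w \<in> space M. lr w \<in> E}"] J(3)[of "space M"] by (auto simp: N_def)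
  qed
  moreover have "finite_measure N" unfolding N_def using J(2) by (rule finite_measure_distr)
  ultimately obtain E where E: "countable E" "AE p in N. k p \<in> E"
    using real_label_countable[of N k] by (auto simp: N_def)
  have "AE w in M. k (J w) \<in> E" using E(2) J(2) unfolding N_def by (rule AE_distrD[rotated])
  then have AElr: "AE w in M. lr w \<in> E" by (rule AE_mp) (auto intro!: AE_I2 simp: kJ)
  define E' where "E' = l ` {w \<in> space M. lr w \<in> E}"
  have "countable E'"
  proof (rule countable_image_inj_on[of "\<lambda>i. lr (w0 i)"])
    have s: "lr (w0 (l w)) = lr w" if "w \<in> space M" for w using w0[OF that] by (simp add: lr_def)
    show "countable ((\<lambda>i. lr (w0 i)) ` E')"
      by (rule countable_subset[OF _ E(1)]) (auto simp: E'_def s)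
    show "inj_on (\<lambda>i. lr (w0 i)) E'" 
    proof (rule inj_onI)
      fix i j assume ij: "i \<in> E'" "j \<in> E'" "lr (w0 i) = lr (w0 j)"
      obtain v w where "i = l v" "v \<in> space M" "j = l w" "w \<in> space M"
        using ij(1,2) unfolding E'_def by blast
      then show "i = j" using lr[of v w] ij(3) s by simp
    qed
  qed
  moreover have "AE w in M. l w \<in> E'" using AElr by (rule AE_mp) (auto intro!: AE_I2 simp: E'_def)
  ultimately show ?thesis by blast
qed


text \<open>
  For \<open>e > 0\<close>, well-order the space and label \<open>y\<close> by the least point \<open>m y\<close> within distance \<open>e\<close>. On the set
  \<open>F k\<close> of those \<open>y\<close> whose ball of radius \<open>1 / (k + 1)\<close> stays inside the ball around \<open>m y\<close>, points that are
  close to each other have the same label. Hence \<open>{y \<in> F k. m y \<in> E}\<close> is closed for every \<open>E\<close> whatsoever, and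
  \<open>label_countable\<close> applies: almost surely only countably many labels occur on \<open>F k\<close>. The sets \<open>F k\<close> cover
  the space, and labels are within \<open>e\<close> of the values.
\<close>

lemma essentially_separably_valued:
  fixes \<xi> :: "'a \<Rightarrow> 'x::metric_space"
  assumes emb: "borel_embeddable M" and fin: "finite_measure M" and \<xi>: "\<xi> \<in> borel_measurable M"
  shows "\<exists>D. countable D \<and> (AE w in M. \<xi> w \<in> closure D)"
proof -
  obtain r :: "('x \<times> 'x) set" where r: "well_order_on UNIV r" using well_order_on by blast
  have wf: "wf (r - Id)" and lin: "linear_order_on UNIV r"
    using r unfolding well_order_on_def by auto
  have tot: "(x, y) \<in> r - Id \<or> x = y \<or> (y, x) \<in> r - Id" for x y
    using lin unfolding linear_order_on_def total_on_def by blast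
  have "\<exists>D. countable D \<and> (AE w in M. \<exists>x\<in>D. dist x (\<xi> w) < e)" if e: "0 < e" for e
  proof -
    define P where "P x y \<longleftrightarrow> dist x y < e \<and> (\<forall>z. (z, x) \<in> r - Id \<longrightarrow> \<not> dist z y < e)" for x y
    have "\<exists>x. P x y" for y
    proof -
      have "y \<in> {z. dist z y < e}" using e by simp
      from wfE_min[OF wf this] show ?thesis unfolding P_def by (metis mem_Collect_eq)
    qed
    moreover have P_unique: "x = x'" if "P x y" "P x' y" for x x' y
      using that tot[of x x'] unfolding P_def by blast
    ultimately obtain m where m: "\<And>y. P (m y) y" by metis
    have mU: "dist (m y) y < e" for y using m[of y] unfolding P_def by blast
    have m_le: "\<not> (z, m y) \<in> r - Id" if "dist z y < e" for z y
      using m[of y] that unfolding P_def by blast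
    define F where "F k = {y. ball y (1 / (real k + 1)) \<subseteq> ball (m y) e}" for k
    have close_eq: "m y = m y'" if "y \<in> F k" "y' \<in> F k" "dist y y' < 1 / (real k + 1)" for y y' k
    proof -
      have "dist (m y) y' < e" using that(1,3) unfolding F_def by (auto simp: subset_eq)
      moreover have "dist (m y') y < e" using that(2,3) unfolding F_def by (auto simp: subset_eq dist_commute)
      ultimately show ?thesis using m_le tot by blast
    qed
    have closed: "closed {y \<in> F k. m y \<in> E}" for k E
    proof -
      define d where "d = 1 / (real k + 1)"
      have d: "0 < d" by (simp add: d_def)
      show ?thesis unfolding closed_limpt
      proof (intro allI impI)
        fix z assume "z islimpt {y \<in> F k. m y \<in> E}"
        then have ap: "\<exists>y\<in>F k. m y \<in> E \<and> dist y z < s" if "0 < s" for s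
          using that unfolding islimpt_approachable by blast
        obtain y where y: "y \<in> F k" "m y \<in> E" "dist y z < d / 2" using ap[of "d / 2"] d by auto
        have same: "m y' = m y" if "y' \<in> F k" "dist y' z < d / 2" for y'
          using close_eq[OF that(1) y(1)] that(2) y(3) dist_triangle2[of y' y z] unfolding d_def by simp
        have sub: "ball z d \<subseteq> ball (m y) e"
        proof
          fix p assume p: "p \<in> ball z d"
          obtain y' where y': "y' \<in> F k" "dist y' z < min (d / 2) (d - dist z p)"
            using ap[of "min (d / 2) (d - dist z p)"] d p by auto
          have "dist y' p < d" using y'(2) dist_triangle[of y' p z] by simp
          then have "p \<in> ball (m y') e" using y'(1) unfolding F_def d_def by auto
          then show "p \<in> ball (m y) e" using same y' by simp
        qed
        have "m z = m y"
        proof (rule ccontr)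
          assume "m z \<noteq> m y"
          moreover have "dist (m y) z < e" using sub d by (auto simp: subset_eq)
          ultimately have lt: "(m z, m y) \<in> r - Id" using m_le[of "m y" z] tot[of "m z" "m y"] by auto
          obtain y' where y': "y' \<in> F k" "dist y' z < min (d / 2) (e - dist (m z) z)"
            using ap[of "min (d / 2) (e - dist (m z) z)"] d mU[of z] by auto
          have "dist (m z) y' < e" using y'(2) dist_triangle2[of "m z" y' z] by simp
          then have "\<not> (m z, m y') \<in> r - Id" by (rule m_le)
          then show False using lt same[of y'] y' by simp
        qed
        then show "z \<in> {y \<in> F k. m y \<in> E}" using sub y(2) unfolding F_def d_def by simp
      qed
    qed
    define l where "l k w = (if \<xi> w \<in> F k then Some (m (\<xi> w)) else None)" for k w
    have lab: "{w \<in> space M. l k w \<in> E} \<in> sets M" for k E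
    proof -
      define A where "A = {y \<in> F k. m y \<in> {x. Some x \<in> E}}"
      define B where "B = {y \<in> F k. m y \<in> UNIV}"
      have AB: "A \<in> sets borel" "B \<in> sets borel" unfolding A_def B_def by (intro borel_closed closed)+
      have "{w \<in> space M. l k w \<in> E} = (\<xi> -` (A \<union> (if None \<in> E then - B else {}))) \<inter> space M"
        by (auto simp: l_def A_def B_def)
      moreover have "A \<union> (if None \<in> E then - B else {}) \<in> sets borel" using AB by simp
      ultimately show ?thesis using measurable_sets[OF \<xi>] by (simp only:)
    qed
    have "\<forall>k. \<exists>E. countable E \<and> (AE w in M. l k w \<in> E)"
      using label_countable[OF emb fin lab] by blast
    then obtain E where E: "\<And>k. countable (E k)" "\<And>k. AE w in M. l k w \<in> E k" by metis
    define D where "D = (\<Union>k. {x. Some x \<in> E k})"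
    have "countable {x. Some x \<in> E k}" for k
    proof (rule countable_image_inj_on[of Some])
      show "countable (Some ` {x. Some x \<in> E k})" by (rule countable_subset[OF _ E(1)[of k]]) auto
    qed simp
    then have cD: "countable D" unfolding D_def by auto
    have "AE w in M. \<forall>k. l k w \<in> E k" using E(2) by (simp add: AE_all_countable)
    then have "AE w in M. \<exists>x\<in>D. dist x (\<xi> w) < e"
    proof (rule AE_mp, intro AE_I2 impI)
      fix w assume w: "\<forall>k. l k w \<in> E k"
      have "0 < e - dist (m (\<xi> w)) (\<xi> w)" using mU[of "\<xi> w"] by simp
      then obtain k where k: "1 / (real k + 1) < e - dist (m (\<xi> w)) (\<xi> w)"
        by (metis nat_approx_posE of_nat_Suc add.commute)
      have "\<xi> w \<in> F k" unfolding F_def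
      proof (intro CollectI subsetI)
        fix p assume "p \<in> ball (\<xi> w) (1 / (real k + 1))"
        then show "p \<in> ball (m (\<xi> w)) e" using k dist_triangle[of "m (\<xi> w)" p "\<xi> w"] by simp
      qed
      then have "Some (m (\<xi> w)) \<in> E k" using w[rule_format, of k] by (simp add: l_def)
      then have "m (\<xi> w) \<in> D" unfolding D_def by blast
      then show "\<exists>x\<in>D. dist x (\<xi> w) < e" using mU by blast
    qed
    then show ?thesis using cD by blast
  qed
  then have "\<forall>n. \<exists>D. countable D \<and> (AE w in M. \<exists>x\<in>D. dist x (\<xi> w) < 1 / (real n + 1))" by simp
  from choice[OF this] obtain D where
    D: "\<And>n. countable (D n)" "\<And>n. AE w in M. \<exists>x\<in>D n. dist x (\<xi> w) < 1 / (real n + 1)"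
    by blast
  have "AE w in M. \<forall>n. \<exists>x\<in>D n. dist x (\<xi> w) < 1 / (real n + 1)" using D(2) by (simp add: AE_all_countable)
  then have "AE w in M. \<xi> w \<in> closure (\<Union>n. D n)"
  proof (rule AE_mp, intro AE_I2 impI)
    fix w assume w: "\<forall>n. \<exists>x\<in>D n. dist x (\<xi> w) < 1 / (real n + 1)"
    show "\<xi> w \<in> closure (\<Union>n. D n)" unfolding closure_approachable
    proof (intro allI impI)
      fix s :: real assume "0 < s"
      then obtain n where "1 / (real n + 1) < s" by (metis nat_approx_posE of_nat_Suc add.commute)
      moreover obtain x where "x \<in> D n" "dist x (\<xi> w) < 1 / (real n + 1)" using w by blast
      ultimately show "\<exists>y\<in>\<Union>n. D n. dist y (\<xi> w) < s" by (intro bexI[of _ x]) auto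
    qed
  qed
  moreover have "countable (\<Union>n. D n)" using D(1) by auto
  ultimately show ?thesis by blast
qed


section \<open>Baire category in locally compact groups\<close>

definition meager :: "'g::topological_space set \<Rightarrow> bool" where
  "meager A \<longleftrightarrow> (\<exists>F :: nat \<Rightarrow> 'g set. (\<forall>n. closed (F n) \<and> interior (F n) = {}) \<and> A \<subseteq> (\<Union>n. F n))"

lemma meager_subset: "meager B \<Longrightarrow> A \<subseteq> B \<Longrightarrow> meager A"
  unfolding meager_def by (meson subset_trans)

lemma meager_empty: "meager {}"
  unfolding meager_def by (intro exI[of _ "\<lambda>_. {}"]) auto

lemma meager_nowhere_dense: "closed F \<Longrightarrow> interior F = {} \<Longrightarrow> meager F"
  unfolding meager_def by (intro exI[of _ "\<lambda>_. F"]) auto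

lemma meager_UN:
  fixes A :: "nat \<Rightarrow> 'g::topological_space set"
  assumes "\<And>n. meager (A n)"
  shows "meager (\<Union>n. A n)"
proof -
  have "\<forall>n. \<exists>F :: nat \<Rightarrow> 'g set. (\<forall>m. closed (F m) \<and> interior (F m) = {}) \<and> A n \<subseteq> (\<Union>m. F m)"
    using assms unfolding meager_def by blast
  from choice[OF this] obtain F :: "nat \<Rightarrow> nat \<Rightarrow> 'g set" where
    F: "\<And>n m. closed (F n m) \<and> interior (F n m) = {}" "\<And>n. A n \<subseteq> (\<Union>m. F n m)" by blast
  define F' where "F' k = F (fst (prod_decode k)) (snd (prod_decode k))" for k
  have "F n m = F' (prod_encode (n, m))" for n m by (simp add: F'_def)
  then have "F n m \<subseteq> (\<Union>k. F' k)" for n m by (metis UNIV_I UN_upper)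
  then have "(\<Union>m. F n m) \<subseteq> (\<Union>k. F' k)" for n by (simp add: UN_least)
  then have "(\<Union>n. A n) \<subseteq> (\<Union>k. F' k)" using F(2) by (meson UN_least subset_trans)
  then show ?thesis unfolding meager_def using F(1) by (intro exI[of _ F']) (auto simp: F'_def)
qed

lemma meager_Un: "meager A \<Longrightarrow> meager B \<Longrightarrow> meager (A \<union> B)"
  using meager_UN[of "\<lambda>n. if n = 0 then A else B"] by (rule meager_subset) (auto split: if_splits intro: exI[of _ "1::nat"])

text \<open>
  Sets that differ from an open set by a meager set form a sigma-algebra; complements are handled by the
  boundary of an open set being nowhere dense.
\<close>

lemma borel_has_baire_property:
  fixes A :: "'g::topological_space set"
  assumes "A \<in> sets borel"
  shows "\<exists>U. open U \<and> meager (A - U) \<and> meager (U - A)"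
proof -
  have "A \<in> sigma_sets UNIV {S :: 'g set. open S}" using assms by (simp add: borel_def)
  then show ?thesis
  proof induction
    case (Basic U) then show ?case by (intro exI[of _ U]) (auto simp: meager_empty)
  next
    case Empty show ?case by (intro exI[of _ "{}"]) (auto simp: meager_empty)
  next
    case (Compl A)
    then obtain U where U: "open U" "meager (A - U)" "meager (U - A)" by blast
    have "interior (closure U - U) = {}"
    proof (rule ccontr)
      assume "interior (closure U - U) \<noteq> {}"
      then obtain x where "x \<in> interior (closure U - U)" by blast
      then obtain T where T: "open T" "x \<in> T" "T \<subseteq> closure U - U" by (meson interiorE)
      then have "T \<inter> U \<noteq> {}" using open_Int_closure_eq_empty[OF T(1), of U] by blast
      then show False using T by blast
    qed
    then have m: "meager (closure U - U)" using U(1) by (intro meager_nowhere_dense closed_Diff) auto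
    show ?case
    proof (intro exI[of _ "- closure U"] conjI)
      show "meager (UNIV - A - - closure U)"
        by (rule meager_subset[OF meager_Un[OF U(3) m]]) auto
      show "meager (- closure U - (UNIV - A))"
        by (rule meager_subset[OF U(2)]) (use closure_subset in auto)
    qed auto
  next
    case (Union A)
    then have "\<forall>n. \<exists>U. open U \<and> meager (A n - U) \<and> meager (U - A n)" by blast
    from choice[OF this] obtain U where U: "\<And>n. open (U n)" "\<And>n. meager (A n - U n)" "\<And>n. meager (U n - A n)" by blast
    show ?case
    proof (intro exI[of _ "\<Union>n. U n"] conjI)
      show "meager ((\<Union>n. A n) - (\<Union>n. U n))" by (rule meager_subset[OF meager_UN[OF U(2)]]) auto
      show "meager ((\<Union>n. U n) - (\<Union>n. A n))" by (rule meager_subset[OF meager_UN[OF U(3)]]) auto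
    qed (use U(1) in auto)
  qed
qed

lemma open_left_translation:
  fixes S :: "'g::topological_group_add set"
  assumes "open S" shows "open ((+) g ` S)"
proof -
  have "(+) g ` S = (\<lambda>x. - g + x) -` S" by (force simp: image_iff add.assoc[symmetric])
  moreover have "open ((\<lambda>x. - g + x) -` S)" using assms by (intro open_vimage continuous_intros)
  ultimately show ?thesis by simp
qed

lemma closed_left_translation:
  fixes S :: "'g::topological_group_add set"
  assumes "closed S" shows "closed ((+) g ` S)"
proof -
  have "(+) g ` S = (\<lambda>x. - g + x) -` S" by (force simp: image_iff add.assoc[symmetric])
  moreover have "closed ((\<lambda>x. - g + x) -` S)" using assms by (intro closed_vimage continuous_intros)
  ultimately show ?thesis by simp
qed

lemma meager_left_translation:
  fixes A :: "'g::topological_group_add set"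
  assumes "meager A" shows "meager ((+) g ` A)"
proof -
  obtain F :: "nat \<Rightarrow> 'g set" where F: "\<And>n. closed (F n)" "\<And>n. interior (F n) = {}" "A \<subseteq> (\<Union>n. F n)"
    using assms unfolding meager_def by blast
  have "interior ((+) g ` F n) = {}" for n
  proof (rule ccontr)
    assume "interior ((+) g ` F n) \<noteq> {}"
    then obtain T where T: "open T" "T \<noteq> {}" "T \<subseteq> (+) g ` F n"
      using interior_subset open_interior by metis
    have "(+) (- g) ` T \<subseteq> F n" using T(3) by (force simp: add.assoc[symmetric])
    then have "(+) (- g) ` T \<subseteq> interior (F n)" using open_left_translation[OF T(1)] by (rule interior_maximal)
    then show False using T(2) F(2) by auto
  qed
  moreover have "closed ((+) g ` F n)" for n using F(1) by (rule closed_left_translation)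
  moreover have "(+) g ` A \<subseteq> (\<Union>n. (+) g ` F n)" using F(3) by blast
  ultimately show ?thesis unfolding meager_def by (intro exI[of _ "\<lambda>n. (+) g ` F n"]) blast
qed

context
  assumes lc: "locally_compact_space (euclidean :: 'g::{topological_group_add, t2_space, second_countable_topology} topology)"
begin

lemma regular_euclidean: "regular_space (euclidean :: 'g topology)"
proof (rule locally_compact_Hausdorff_imp_regular_space[OF lc])
  show "Hausdorff_space (euclidean :: 'g topology)"
    unfolding Hausdorff_space_def disjnt_def by (metis hausdorff open_openin)
qed

lemma compact_neighbourhood:
  assumes "open W" "x \<in> (W :: 'g set)"
  obtains U where "open U" "x \<in> U" "compact (closure U)" "closure U \<subseteq> W"
proof -
  have "neighbourhood_base_of (\<lambda>C. compactin euclidean C \<and> closedin euclidean C) (euclidean :: 'g topology)"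
    using lc regular_euclidean locally_compact_regular_space_neighbourhood_base by blast
  then obtain U K where UK: "openin euclidean U" "compactin euclidean K" "closedin euclidean K" "x \<in> U" "U \<subseteq> K" "K \<subseteq> W"
    using assms unfolding neighbourhood_base_of by (metis open_openin)
  have "closed K" "compact K" "open U" using UK by auto
  then have "closure U \<subseteq> K" using UK(5) by (simp add: closure_minimal)
  moreover have "compact (closure U)" using \<open>compact K\<close> calculation by (metis closed_Int_compact closed_closure inf.absorb1)
  ultimately show ?thesis using that[of U] \<open>open U\<close> UK by auto
qed

lemma open_not_meager:
  assumes "open U" "U \<noteq> {}" shows "\<not> meager (U :: 'g set)"
proof
  assume "meager U"
  then obtain F :: "nat \<Rightarrow> 'g set" where F: "\<And>n. closed (F n)" "\<And>n. interior (F n) = {}" "U \<subseteq> (\<Union>n. F n)"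
    unfolding meager_def by blast
  have "euclidean interior_of \<Union>(range F) = {}"
    using lc regular_euclidean F(1,2) by (intro Baire_category_alt) auto
  then have "interior (\<Union>n. F n) = {}" by simp
  then show False using interior_maximal[OF F(3) assms(1)] assms(2) by auto
qed

text \<open>
  Let \<open>A\<close> agree with the open set \<open>U\<close> up to a meager set. For \<open>v\<close> near 0 the open set \<open>U \<inter> (v + U)\<close> is not
  empty, so by the Baire category theorem it meets \<open>A \<inter> (v + A)\<close>.
\<close>

lemma pettis:
  assumes "A \<in> sets borel" "\<not> meager (A :: 'g set)"
  shows "\<exists>V. open V \<and> 0 \<in> V \<and> (\<forall>v\<in>V. \<exists>a\<in>A. \<exists>b\<in>A. v = a - b)"
proof -
  obtain U where U: "open U" "meager (A - U)" "meager (U - A)"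
    using borel_has_baire_property[OF assms(1)] by blast
  have "U \<noteq> {}" using U(2) assms(2) by auto
  then obtain u where u: "u \<in> U" by blast
  define V where "V = (\<lambda>v. v + u) -` U"
  have "open V" unfolding V_def using U(1) by (intro open_vimage continuous_intros)
  moreover have "0 \<in> V" using u by (simp add: V_def)
  moreover have "\<exists>a\<in>A. \<exists>b\<in>A. v = a - b" if v: "v \<in> V" for v
  proof -
    have "v + u \<in> U \<inter> (+) v ` U" using v u by (auto simp: V_def)
    moreover have "open (U \<inter> (+) v ` U)" using U(1) by (intro open_Int open_left_translation)
    ultimately have "\<not> meager (U \<inter> (+) v ` U)" using open_not_meager by blast
    moreover have "meager ((U - A) \<union> (+) v ` (U - A))"
      using U(3) by (intro meager_Un meager_left_translation)
    ultimately have "\<not> U \<inter> (+) v ` U \<subseteq> (U - A) \<union> (+) v ` (U - A)" using meager_subset by blast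
    then obtain x where x: "x \<in> U" "x \<in> (+) v ` U" "x \<notin> U - A" "x \<notin> (+) v ` (U - A)" by blast
    then obtain y where "y \<in> U" "x = v + y" by blast
    then have "x \<in> A" "y \<in> A" "v = x - y" using x by (auto simp: add.assoc)
    then show ?thesis by blast
  qed
  ultimately show ?thesis by blast
qed

text \<open>
  The pairs are treated one after the other; each step shrinks two of the sets, using that a translate of an
  open set is not contained in \<open>N\<close> and that the complement of \<open>N\<close> is open.
\<close>

lemma separate_pairs:
  fixes U :: "nat \<Rightarrow> 'g set" and P :: "(nat \<times> nat) set"
  assumes "finite P" "\<And>i j. (i, j) \<in> P \<Longrightarrow> i \<noteq> j" and N: "closed N" "interior N = {}"
    and U: "\<And>i. open (U i) \<and> U i \<noteq> {}"
  shows "\<exists>U'. (\<forall>i. open (U' i) \<and> U' i \<noteq> {} \<and> U' i \<subseteq> U i) \<and>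
    (\<forall>i j x y. (i, j) \<in> P \<longrightarrow> x \<in> U' i \<longrightarrow> y \<in> U' j \<longrightarrow> - x + y \<notin> N)"
  using assms(1,2)
proof (induction P)
  case empty then show ?case using U by (intro exI[of _ U]) auto
next
  case (insert p P)
  obtain i j where p: "p = (i, j)" and ij: "i \<noteq> j" using insert.prems by (cases p) auto
  obtain V where V: "\<And>i. open (V i) \<and> V i \<noteq> {} \<and> V i \<subseteq> U i"
    "\<And>i j x y. (i, j) \<in> P \<Longrightarrow> x \<in> V i \<Longrightarrow> y \<in> V j \<Longrightarrow> - x + y \<notin> N"
  proof -
    have "i \<noteq> j" if "(i, j) \<in> P" for i j using insert.prems[of i j] that by blast
    from insert.IH[OF this] obtain V where V: "(\<forall>i. open (V i) \<and> V i \<noteq> {} \<and> V i \<subseteq> U i) \<and>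
      (\<forall>i j x y. (i, j) \<in> P \<longrightarrow> x \<in> V i \<longrightarrow> y \<in> V j \<longrightarrow> - x + y \<notin> N)" by blast
    show ?thesis by (rule that[of V]) (use V in blast)+
  qed
  obtain x0 where x0: "x0 \<in> V i" using V(1) by blast
  have "open ((+) (- x0) ` V j)" using V(1) by (intro open_left_translation) simp
  then have "\<not> (+) (- x0) ` V j \<subseteq> N" using V(1)[of j] interior_maximal[of _ N] N(2) by (metis image_is_empty subset_empty)
  then obtain y0 where y0: "y0 \<in> V j" "- x0 + y0 \<notin> N" by blast
  define D where "D = (\<lambda>z :: 'g \<times> 'g. - fst z + snd z) -` (- N)"
  have "open D" unfolding D_def using N(1) by (intro open_vimage continuous_intros) auto
  moreover have "(x0, y0) \<in> D" using y0 by (simp add: D_def)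
  ultimately obtain X Y where "open X" "open Y" "(x0, y0) \<in> X \<times> Y" "X \<times> Y \<subseteq> D"
    by (rule open_prod_elim)
  then have XY: "open X" "open Y" "x0 \<in> X" "y0 \<in> Y" "X \<times> Y \<subseteq> D" by auto
  define U' where "U' = V(i := V i \<inter> X, j := V j \<inter> Y)"
  have sub: "U' k \<subseteq> V k" for k by (auto simp: U'_def)
  have "open (U' k) \<and> U' k \<noteq> {} \<and> U' k \<subseteq> U k" for k
    using V(1)[of k] V(1)[of i] V(1)[of j] XY x0 y0(1) ij sub[of k] by (auto simp: U'_def)
  moreover have "- x + y \<notin> N" if "(a, b) \<in> insert p P" "x \<in> U' a" "y \<in> U' b" for a b x y
  proof (cases "(a, b) = p")
    case True
    then have "(x, y) \<in> X \<times> Y" using that ij p by (auto simp: U'_def)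
    then show ?thesis using XY(5) by (auto simp: D_def)
  next
    case False
    then show ?thesis using V(2)[of a b x y] that sub[of a] sub[of b] by auto
  qed
  ultimately show ?case by blast
qed

text \<open>
  A dyadic tree of open sets is built in which \<open>U (Suc k) j\<close> has its closure in \<open>U k (j div 2)\<close> and differences
  between distinct sets of one level avoid the nowhere dense sets treated so far. The binary digits
  of \<open>x\<close> select a branch, and \<open>\<Phi> x\<close> is a common point of its sets, which exists by compactness. Each set
  of level \<open>k + 1\<close> is moreover contained in or disjoint from the \<open>k\<close>-th basic open set, so whether
  \<open>\<Phi> x\<close> lies in that basic set depends on finitely many digits; this makes \<open>\<Phi>\<close> measurable.
\<close>

lemma cantor_scheme:
  assumes "meager (A :: 'g set)"
  obtains \<Phi> :: "real \<Rightarrow> 'g" where "\<Phi> \<in> borel_measurable (restrict_space borel {0..<1})"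
    "\<And>x y. x \<in> {0..<1} \<Longrightarrow> y \<in> {0..<1} \<Longrightarrow> x \<noteq> y \<Longrightarrow> - \<Phi> x + \<Phi> y \<notin> A"
proof -
  obtain F0 :: "nat \<Rightarrow> 'g set" where F0: "\<And>n. closed (F0 n)" "\<And>n. interior (F0 n) = {}" "A \<subseteq> (\<Union>n. F0 n)"
    using assms unfolding meager_def by blast
  define F where "F n = (\<Union>m\<le>n. F0 m)" for n
  have F: "closed (F n)" "interior (F n) = {}" for n
  proof -
    show "closed (F n)" unfolding F_def using F0(1) by (intro closed_UN) auto
    have "meager (F n)" unfolding meager_def
      using F0(1,2) by (intro exI[of _ F0]) (auto simp: F_def)
    then have "meager (interior (F n))" by (rule meager_subset) (rule interior_subset)
    then show "interior (F n) = {}" using open_not_meager[OF open_interior] by blast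
  qed
  have F_mono: "F m \<subseteq> F n" if "m \<le> n" for m n unfolding F_def using that by (intro UN_mono) auto
  obtain B :: "nat \<Rightarrow> 'g set" where B: "\<And>S. open S \<Longrightarrow> \<exists>K. S = (\<Union>k\<in>K. B k)" "\<And>n. open (B n)"
  proof -
    obtain BB :: "'g set set" where BB: "countable BB" "topological_basis BB"
      using ex_countable_basis by blast
    define B where "B n = (if BB = {} then {} else from_nat_into BB n)" for n
    have "\<exists>K. S = (\<Union>k\<in>K. B k)" if "open S" for S
    proof -
      obtain \<U> where "\<U> \<subseteq> BB" "\<Union>\<U> = S" using BB(2) \<open>open S\<close> unfolding topological_basis_def by metis
      then have "S = (\<Union>k\<in>{k. B k \<in> \<U>}. B k)"
        using from_nat_into_surj[OF BB(1)] unfolding B_def by (auto split: if_splits)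
      then show ?thesis by blast
    qed
    moreover have "open (B n)" for n
      unfolding B_def using topological_basis_open[OF BB(2)] from_nat_into[of BB n] by auto
    ultimately show ?thesis using that by blast
  qed
  obtain W where W: "open W" "(0 :: 'g) \<in> W" "compact (closure W)" "closure W \<subseteq> UNIV"
    by (rule compact_neighbourhood[OF open_UNIV UNIV_I])
  define P where "P k U \<longleftrightarrow> (\<forall>j. open (U j) \<and> U j \<noteq> {}) \<and> (k = 0 \<longrightarrow> U 0 = W)" for k :: nat and U :: "nat \<Rightarrow> 'g set"
  define Q where "Q k U U' \<longleftrightarrow> (\<forall>j. closure (U' j) \<subseteq> U (j div 2) \<and> (U' j \<subseteq> B k \<or> U' j \<inter> B k = {})) \<and>
     (\<forall>i<2^(k+1). \<forall>j<2^(k+1). i \<noteq> j \<longrightarrow> (\<forall>x\<in>U' i. \<forall>y\<in>U' j. - x + y \<notin> F k))"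
    for k :: nat and U U' :: "nat \<Rightarrow> 'g set"
  have "\<exists>U. P 0 U" unfolding P_def using W by (intro exI[of _ "\<lambda>_. W"]) auto
  moreover have "\<exists>U'. P (Suc k) U' \<and> Q k U U'" if "P k U" for k U
  proof -
    have U: "open (U j)" "U j \<noteq> {}" for j using that unfolding P_def by auto
    have "\<exists>V. open V \<and> V \<noteq> {} \<and> closure V \<subseteq> U (j div 2) \<and> (V \<subseteq> B k \<or> V \<inter> B k = {})" for j
    proof -
      define O' where "O' = (if U (j div 2) \<inter> B k = {} then U (j div 2) else U (j div 2) \<inter> B k)"
      have O': "open O'" "O' \<noteq> {}" using U[of "j div 2"] B(2)[of k] by (auto simp: O'_def)
      then obtain x where "x \<in> O'" by blast
      then obtain V where V: "open V" "x \<in> V" "closure V \<subseteq> O'" using compact_neighbourhood[OF O'(1)] by metis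
      have "V \<subseteq> O'" using V(3) closure_subset by blast
      then have "V \<subseteq> B k \<or> V \<inter> B k = {}" by (auto simp: O'_def split: if_splits)
      moreover have "closure V \<subseteq> U (j div 2)" using V(3) by (auto simp: O'_def split: if_splits)
      ultimately show ?thesis using V by blast
    qed
    then obtain V where V: "\<And>j. open (V j) \<and> V j \<noteq> {}" "\<And>j. closure (V j) \<subseteq> U (j div 2)"
      "\<And>j. V j \<subseteq> B k \<or> V j \<inter> B k = {}" by metis
    define PP where "PP = {(i, j). i < 2^(k+1) \<and> j < 2^(k+1) \<and> i \<noteq> (j::nat)}"
    have "finite PP" by (rule finite_subset[of _ "{..<2^(k+1)} \<times> {..<2^(k+1)}"]) (auto simp: PP_def)
    moreover have "i \<noteq> j" if "(i, j) \<in> PP" for i j using that by (simp add: PP_def)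
    ultimately obtain U' where U': "\<And>i. open (U' i) \<and> U' i \<noteq> {} \<and> U' i \<subseteq> V i"
      "\<And>i j x y. (i, j) \<in> PP \<Longrightarrow> x \<in> U' i \<Longrightarrow> y \<in> U' j \<Longrightarrow> - x + y \<notin> F k"
      using separate_pairs[of PP "F k" V] F[of k] V(1) by blast
    have "closure (U' j) \<subseteq> U (j div 2)" for j using closure_mono[of "U' j" "V j"] U'(1)[of j] V(2)[of j] by blast
    moreover have "U' j \<subseteq> B k \<or> U' j \<inter> B k = {}" for j using U'(1)[of j] V(3)[of j] by blast
    moreover have "- x + y \<notin> F k" if "i < 2^(k+1)" "j < 2^(k+1)" "i \<noteq> j" "x \<in> U' i" "y \<in> U' j" for i j x y
      using U'(2)[of i j x y] that by (simp add: PP_def)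
    ultimately have "Q k U U'" unfolding Q_def by blast
    moreover have "P (Suc k) U'" unfolding P_def using U'(1) by simp
    ultimately show ?thesis by blast
  qed
  ultimately obtain U where U: "\<And>k. P k (U k)" "\<And>k. Q k (U k) (U (Suc k))"
    using dependent_nat_choice[of P Q] by blast
  define dig where "dig k x = nat \<lfloor>2^k * x\<rfloor>" for k and x :: real
  have dig_div: "dig (Suc k) x div 2 = dig k x" if "0 \<le> x" for k x
  proof -
    have "\<lfloor>2^Suc k * x\<rfloor> div 2 = \<lfloor>(2^Suc k * x) / 2\<rfloor>" using floor_divide_real_eq_div[of 2 "2^Suc k * x"] by simp
    then have "\<lfloor>2^Suc k * x\<rfloor> div 2 = \<lfloor>2^k * x\<rfloor>" by simp
    then show ?thesis unfolding dig_def by (metis nat_div_distrib nat_numeral zero_le_numeral nat_div_as_int that zero_le_floor zero_le_mult_iff zero_le_power)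
  qed
  have dig_less: "dig k x < 2^k" if "x \<in> {0..<1}" for k x
  proof -
    have "2^k * x < 2^k * 1" using that by (intro mult_strict_left_mono) auto
    then have "\<lfloor>2^k * x\<rfloor> < 2^k" by (simp add: floor_less_iff)
    then show ?thesis unfolding dig_def using that by (simp add: nat_less_iff)
  qed
  have closure_step: "closure (U (Suc k) (dig (Suc k) x)) \<subseteq> U k (dig k x)" if "0 \<le> x" for k x
    using U(2)[of k] dig_div[OF that, of k] unfolding Q_def by metis
  have "\<exists>p. \<forall>k. p \<in> U k (dig k x)" if x: "x \<in> {0..<1}" for x
  proof -
    define C where "C k = closure (U k (dig k x))" for k
    have step: "C (Suc k) \<subseteq> C k" for k using closure_step[of x k] x closure_subset unfolding C_def by force
    have dec: "decseq C" by (rule decseq_SucI) (rule step)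
    have C0: "C 0 = closure W" using U(1)[of 0] dig_less[OF x, of 0] unfolding C_def P_def by simp
    have ne: "C k \<noteq> {}" for k using U(1)[of k] unfolding C_def P_def by simp
    have "(\<Inter>k. C k) \<noteq> {}"
    proof (rule compact_space_imp_nest[of "subtopology euclidean (closure W)"])
      show "compact_space (subtopology euclidean (closure W))" using W(3) by (simp add: compact_space_subtopology)
      show "closedin (subtopology euclidean (closure W)) (C n)" for n
        using decseqD[OF dec, of 0 n] C0 unfolding C_def by (simp add: closedin_closed_subset closed_subset)
    qed (use ne dec in auto)
    then obtain p where "p \<in> C k" for k by blast
    then have "p \<in> U k (dig k x)" for k using closure_step[of x k] x unfolding C_def by (metis atLeastLessThan_iff subsetD)
    then show ?thesis by blast
  qed
  then obtain \<Phi> where \<Phi>: "\<And>x k. x \<in> {0..<1} \<Longrightarrow> \<Phi> x \<in> U k (dig k x)" by metis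
  have "- \<Phi> x + \<Phi> y \<notin> A" if xy: "x \<in> {0..<1}" "y \<in> {0..<1}" "x \<noteq> y" for x y
  proof
    assume "- \<Phi> x + \<Phi> y \<in> A"
    then obtain n where n: "- \<Phi> x + \<Phi> y \<in> F0 n" using F0(3) by blast
    obtain m where m: "1 / 2^m < \<bar>x - y\<bar>"
      using real_arch_pow_inv[of "\<bar>x - y\<bar>" "1/2"] xy(3) by (auto simp: power_one_over)
    define k where "k = max m n"
    have "dig (Suc k) x \<noteq> dig (Suc k) y"
    proof
      assume "dig (Suc k) x = dig (Suc k) y"
      then have "\<lfloor>2^Suc k * x\<rfloor> = \<lfloor>2^Suc k * y\<rfloor>" unfolding dig_def using xy
        by (simp add: eq_nat_nat_iff)
      then have "\<bar>2^Suc k * x - 2^Suc k * y\<bar> < 1" by linarith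
      then have "2^Suc k * \<bar>x - y\<bar> < 1" by (simp add: abs_mult flip: right_diff_distrib)
      then have "\<bar>x - y\<bar> < 1 / 2^Suc k" by (simp add: field_simps)
      also have "(1::real) / 2^Suc k \<le> 1 / 2^m" unfolding k_def by (intro divide_left_mono power_increasing) auto
      finally show False using m by simp
    qed
    then have "- \<Phi> x + \<Phi> y \<notin> F k"
      using U(2)[of k] dig_less[OF xy(1), of "Suc k"] dig_less[OF xy(2), of "Suc k"] \<Phi>[OF xy(1), of "Suc k"] \<Phi>[OF xy(2), of "Suc k"]
      unfolding Q_def by (metis Suc_eq_plus1)
    moreover have "F0 n \<subseteq> F k" unfolding F_def k_def by (rule UN_upper) simp
    ultimately show False using n by blast
  qed
  moreover have "\<Phi> \<in> borel_measurable (restrict_space borel {0..<1})"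
  proof (rule borel_measurableI)
    fix S :: "'g set" assume "open S"
    then obtain K where K: "S = (\<Union>k\<in>K. B k)" using B(1) by blast
    let ?M = "restrict_space borel {0..<1 :: real}"
    have sp: "space ?M = {0..<1}" by (simp add: space_restrict_space)
    have digm: "dig k \<in> ?M \<rightarrow>\<^sub>M count_space UNIV" for k
    proof -
      have "(\<lambda>x::real. \<lfloor>2^k * x\<rfloor>) \<in> borel \<rightarrow>\<^sub>M count_space UNIV" by measurable
      then have "dig k \<in> borel \<rightarrow>\<^sub>M count_space UNIV" unfolding dig_def by (rule measurable_compose) simp
      then show ?thesis by (rule measurable_restrict_space1)
    qed
    have "\<Phi> -` B k \<inter> space ?M \<in> sets ?M" for k
    proof -
      have "\<Phi> x \<in> B k \<longleftrightarrow> U (Suc k) (dig (Suc k) x) \<subseteq> B k" if "x \<in> {0..<1}" for x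
        using \<Phi>[OF that, of "Suc k"] U(2)[of k] unfolding Q_def by blast
      then have "\<Phi> -` B k \<inter> space ?M = dig (Suc k) -` {j. U (Suc k) j \<subseteq> B k} \<inter> space ?M" unfolding sp by blast
      also have "\<dots> \<in> sets ?M" using digm by (rule measurable_sets) simp
      finally show ?thesis .
    qed
    then have "(\<Union>k\<in>K. \<Phi> -` B k \<inter> space ?M) \<in> sets ?M" by (intro sets.countable_UN') auto
    moreover have "\<Phi> -` S \<inter> space ?M = (\<Union>k\<in>K. \<Phi> -` B k \<inter> space ?M)" unfolding K by blast
    ultimately show "\<Phi> -` S \<inter> space ?M \<in> sets ?M" by simp
  qed
  ultimately show ?thesis using that by blast
qed

end


section \<open>Approximation of measurable sets by dyadic cells\<close>

text \<open>
  Sets that can be approximated in measure by members of an algebra \<open>R\<close> form a sigma-algebra.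
\<close>

lemma approximable_sigma:
  assumes fin: "finite_measure M" and gen: "sets M = sigma_sets (space M) \<G>"
    and R_empty: "R {}" and R_compl: "\<And>S. S \<in> sets M \<Longrightarrow> R S \<Longrightarrow> R (space M - S)"
    and R_Un: "\<And>S T. S \<in> sets M \<Longrightarrow> T \<in> sets M \<Longrightarrow> R S \<Longrightarrow> R T \<Longrightarrow> R (S \<union> T)"
    and R_gen: "\<And>S \<eta>. S \<in> \<G> \<Longrightarrow> 0 < \<eta> \<Longrightarrow> \<exists>S'\<in>sets M. R S' \<and> measure M ((S - S') \<union> (S' - S)) < \<eta>"
    and S: "S \<in> sets M" and \<eta>: "0 < (\<eta>::real)"
  shows "\<exists>S'\<in>sets M. R S' \<and> measure M ((S - S') \<union> (S' - S)) < \<eta>"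
proof -
  interpret finite_measure M by fact
  have "S \<in> sigma_sets (space M) \<G>" using S gen by simp
  then have "\<forall>\<eta>>0. \<exists>S'\<in>sets M. R S' \<and> measure M ((S - S') \<union> (S' - S)) < \<eta>"
  proof induction
    case (Basic a) then show ?case using R_gen by blast
  next
    case Empty show ?case using R_empty by (intro allI impI bexI[of _ "{}"]) auto
  next
    case (Compl a)
    show ?case
    proof (intro allI impI)
      fix \<eta> :: real assume "0 < \<eta>"
      then obtain S' where S': "S' \<in> sets M" "R S'" "measure M ((a - S') \<union> (S' - a)) < \<eta>" using Compl.IH by blast
      have asp: "a \<subseteq> space M" using Compl.hyps gen sets.sets_into_space by blast
      have "(space M - a - (space M - S')) \<union> (space M - S' - (space M - a)) = (a - S') \<union> (S' - a)"
        using asp sets.sets_into_space[OF S'(1)] by blast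
      then show "\<exists>S'\<in>sets M. R S' \<and> measure M ((space M - a - S') \<union> (S' - (space M - a))) < \<eta>"
        using S' R_compl[OF S'(1,2)] by (intro bexI[of _ "space M - S'"]) auto
    qed
  next
    case (Union a)
    have aM: "a n \<in> sets M" for n using Union.hyps[of n] gen by simp
    have fin_un: "\<exists>S'\<in>sets M. R S' \<and> measure M (((\<Union>i<n. a i) - S') \<union> (S' - (\<Union>i<n. a i))) < \<eta>" if "0 < \<eta>" for n \<eta>
      using that
    proof (induction n arbitrary: \<eta>)
      case 0 then show ?case using R_empty by (intro bexI[of _ "{}"]) auto
    next
      case (Suc n)
      then have h: "0 < \<eta> / 2" by simp
      obtain S1 where S1: "S1 \<in> sets M" "R S1" "measure M (((\<Union>i<n. a i) - S1) \<union> (S1 - (\<Union>i<n. a i))) < \<eta> / 2"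
        using Suc.IH[OF h] by blast
      obtain S2 where S2: "S2 \<in> sets M" "R S2" "measure M ((a n - S2) \<union> (S2 - a n)) < \<eta> / 2"
        using Union.IH[of n] h by blast
      have "measure M (((\<Union>i<Suc n. a i) - (S1 \<union> S2)) \<union> ((S1 \<union> S2) - (\<Union>i<Suc n. a i)))
        \<le> measure M ((((\<Union>i<n. a i) - S1) \<union> (S1 - (\<Union>i<n. a i))) \<union> ((a n - S2) \<union> (S2 - a n)))"
        using S1(1) S2(1) aM by (intro finite_measure_mono) (auto simp: lessThan_Suc)
      also have "\<dots> \<le> measure M (((\<Union>i<n. a i) - S1) \<union> (S1 - (\<Union>i<n. a i))) + measure M ((a n - S2) \<union> (S2 - a n))"
        using S1(1) S2(1) aM by (intro measure_Un_le) auto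
      also have "\<dots> < \<eta>" using S1(3) S2(3) by simp
      finally show ?case using R_Un[OF S1(1) S2(1) S1(2) S2(2)] S1(1) S2(1) by (intro bexI[of _ "S1 \<union> S2"]) auto
    qed
    show ?case
    proof (intro allI impI)
      fix \<eta> :: real assume \<eta>: "0 < \<eta>"
      define A where "A n = (\<Union>i<n. a i)" for n
      have A: "A n \<in> sets M" for n unfolding A_def using aM by auto
      have UA: "(\<Union>n. A n) = (\<Union>i. a i)" unfolding A_def by blast
      have "(\<lambda>n. measure M (A n)) \<longlonglongrightarrow> measure M (\<Union>n. A n)"
      proof (rule finite_Lim_measure_incseq)
        show "incseq A" unfolding A_def by (intro monoI UN_mono) auto
      qed (use A in auto)
      then obtain n where n: "\<bar>measure M (A n) - measure M (\<Union>n. A n)\<bar> < \<eta> / 2"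
        using LIMSEQ_D[of _ _ "\<eta> / 2"] \<eta> by (metis half_gt_zero order_refl real_norm_def)
      have "measure M ((\<Union>n. A n) - A n) = measure M (\<Union>n. A n) - measure M (A n)"
        using A by (intro finite_measure_Diff) auto
      then have n': "measure M ((\<Union>n. A n) - A n) < \<eta> / 2" using n by linarith
      obtain S' where S': "S' \<in> sets M" "R S'" "measure M ((A n - S') \<union> (S' - A n)) < \<eta> / 2"
        using fin_un[of "\<eta> / 2" n] \<eta> unfolding A_def by auto
      have "measure M (((\<Union>n. A n) - S') \<union> (S' - (\<Union>n. A n)))
        \<le> measure M (((\<Union>n. A n) - A n) \<union> ((A n - S') \<union> (S' - A n)))"
        using S'(1) A by (intro finite_measure_mono) auto
      also have "\<dots> \<le> measure M ((\<Union>n. A n) - A n) + measure M ((A n - S') \<union> (S' - A n))"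
        using S'(1) A by (intro measure_Un_le) auto
      also have "\<dots> < \<eta>" using n' S'(3) by simp
      finally show "\<exists>S'\<in>sets M. R S' \<and> measure M ((\<Union> (range a) - S') \<union> (S' - \<Union> (range a))) < \<eta>"
        using S' unfolding UA by blast
    qed
  qed
  then show ?thesis using \<eta> by blast
qed

definition same_cell :: "nat \<Rightarrow> real \<Rightarrow> real \<Rightarrow> bool" where
  "same_cell k x y \<longleftrightarrow> \<lfloor>2^k * x\<rfloor> = \<lfloor>2^k * y\<rfloor>"

lemma same_cell_mono: assumes "same_cell k x y" "m \<le> k" shows "same_cell m x y"
proof -
  have "\<lfloor>2^m * z\<rfloor> = \<lfloor>2^k * z\<rfloor> div 2^(k-m)" for z :: real
  proof -
    have e: "(2::real)^k = 2^(k-m) * 2^m" using assms(2) by (simp flip: power_add)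
    have "2^m * z = 2^k * z / real_of_int (2^(k-m))" unfolding e by simp
    then show ?thesis using floor_divide_real_eq_div[of "2^(k-m)" "2^k * z"] by simp
  qed
  then show ?thesis using assms(1) unfolding same_cell_def by simp
qed

definition unif :: "real measure" where "unif = density lborel (indicator {0..<1})"

lemma sets_unif [simp, measurable_cong]: "sets unif = sets borel" and space_unif [simp]: "space unif = UNIV"
  by (simp_all add: unif_def)

lemma emeasure_unif: "A \<in> sets borel \<Longrightarrow> emeasure unif A = emeasure lborel ({0..<1} \<inter> A)"
  unfolding unif_def by (intro emeasure_restricted) auto

lemma prob_space_unif: "prob_space unif"
  by (rule prob_spaceI) (simp add: emeasure_unif)

lemma unif_embeddable: "borel_embeddable unif"
proof -
  define J :: "real \<Rightarrow> nat \<Rightarrow> real" where "J x n = x" for x n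
  have "J ` A \<in> sets borel" if "A \<in> sets borel" for A
  proof -
    have c: "(\<lambda>f :: nat \<Rightarrow> real. f k) \<in> borel_measurable borel" for k
      by (intro borel_measurable_continuous_onI continuous_on_product_coordinates)
    have "J ` A = (\<Inter>n. {f \<in> space borel. f n = f 0}) \<inter> (\<lambda>f. f 0) -` A"
      by (force simp: J_def image_iff)
    moreover have "{f \<in> space borel. f n = f 0} \<in> sets (borel :: (nat \<Rightarrow> real) measure)" for n using c by measurable
    moreover have "(\<lambda>f :: nat \<Rightarrow> real. f 0) -` A \<in> sets borel" using measurable_sets[OF c[of 0] that] by simp
    ultimately show ?thesis by (simp add: sets.countable_INT'')
  qed
  moreover have "J \<in> borel_measurable unif"
    unfolding J_def by (intro measurable_coordinatewise_then_product) simp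
  moreover have "inj_on J UNIV" unfolding J_def by (intro inj_onI) (metis)
  ultimately show ?thesis unfolding borel_embeddable_def by (intro exI[of _ J]) simp
qed

lemma unif_approx:
  assumes "A \<in> sets borel" "0 < \<eta>"
  shows "\<exists>A'\<in>sets unif. (\<exists>k. \<forall>x y. same_cell k x y \<longrightarrow> (x \<in> A' \<longleftrightarrow> y \<in> A')) \<and> measure unif ((A - A') \<union> (A' - A)) < \<eta>"
proof (rule approximable_sigma[where R = "\<lambda>A. \<exists>k. \<forall>x y. same_cell k x y \<longrightarrow> (x \<in> A \<longleftrightarrow> y \<in> A)" and \<G> = "range lessThan"])
  interpret prob_space unif by (rule prob_space_unif)
  show "finite_measure unif" by unfold_locales
  show "sets unif = sigma_sets (space unif) (range lessThan)"
    by (simp add: borel_Iio)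
  show "\<exists>k. \<forall>x y. same_cell k x y \<longrightarrow> (x \<in> S \<union> T \<longleftrightarrow> y \<in> S \<union> T)"
    if ST: "\<exists>k. \<forall>x y. same_cell k x y \<longrightarrow> (x \<in> S \<longleftrightarrow> y \<in> S)" "\<exists>k. \<forall>x y. same_cell k x y \<longrightarrow> (x \<in> T \<longleftrightarrow> y \<in> T)" for S T
  proof -
    obtain k l where "\<forall>x y. same_cell k x y \<longrightarrow> (x \<in> S \<longleftrightarrow> y \<in> S)" "\<forall>x y. same_cell l x y \<longrightarrow> (x \<in> T \<longleftrightarrow> y \<in> T)"
      using ST by blast
    moreover have "same_cell (max k l) x y \<Longrightarrow> same_cell k x y \<and> same_cell l x y" for x y
      using same_cell_mono by (meson max.cobounded1 max.cobounded2)
    ultimately show ?thesis by (intro exI[of _ "max k l"]) blast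
  qed
  show "\<exists>S'\<in>sets unif. (\<exists>k. \<forall>x y. same_cell k x y \<longrightarrow> (x \<in> S' \<longleftrightarrow> y \<in> S')) \<and> measure unif ((S - S') \<union> (S' - S)) < \<eta>"
    if Sr: "S \<in> range lessThan" and \<eta>: "0 < \<eta>" for S \<eta>
  proof -
    obtain a where a: "S = {..<a}" using Sr by blast
    obtain k where k: "1 / 2^k < \<eta>" using real_arch_pow_inv[OF \<eta>, of "1/2"] by (auto simp: power_one_over)
    define S' where "S' = {x :: real. \<lfloor>2^k * x\<rfloor> < \<lfloor>2^k * a\<rfloor>}"
    define I where "I = {real_of_int \<lfloor>2^k * a\<rfloor> / 2^k ..< (real_of_int \<lfloor>2^k * a\<rfloor> + 1) / 2^k}"
    have "S' = (\<lambda>x :: real. \<lfloor>2^k * x\<rfloor>) -` {..<\<lfloor>2^k * a\<rfloor>} \<inter> space borel" by (auto simp: S'_def)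
    also have "\<dots> \<in> sets borel" by (rule measurable_sets[of _ _ "count_space UNIV"]) auto
    finally have S': "S' \<in> sets borel" .
    have "(S - S') \<union> (S' - S) \<subseteq> I"
    proof
      fix x assume x: "x \<in> (S - S') \<union> (S' - S)"
      have "2^k * x < 2^k * a \<longleftrightarrow> x < a" by simp
      then have "\<lfloor>2^k * x\<rfloor> = \<lfloor>2^k * a\<rfloor>" using x floor_mono[of "2^k * x" "2^k * a"] floor_mono[of "2^k * a" "2^k * x"]
        unfolding a S'_def by auto
      then have "real_of_int \<lfloor>2^k * a\<rfloor> \<le> 2^k * x" "2^k * x < real_of_int \<lfloor>2^k * a\<rfloor> + 1" by linarith+
      then show "x \<in> I" unfolding I_def by (simp add: field_simps)
    qed
    then have "measure unif ((S - S') \<union> (S' - S)) \<le> measure unif I"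
      by (intro finite_measure_mono) (auto simp: I_def)
    also have "\<dots> \<le> 1 / 2^k"
    proof -
      have "emeasure unif I = emeasure lborel ({0..<1} \<inter> I)" by (rule emeasure_unif) (simp add: I_def)
      also have "\<dots> \<le> emeasure lborel I" by (intro emeasure_mono) (auto simp: I_def)
      also have "\<dots> = ennreal (1 / 2^k)" unfolding I_def by (simp add: divide_right_mono add_divide_distrib)
      finally show ?thesis by (simp add: emeasure_eq_measure)
    qed
    finally have "measure unif ((S - S') \<union> (S' - S)) < \<eta>" using k by simp
    moreover have "\<forall>x y. same_cell k x y \<longrightarrow> (x \<in> S' \<longleftrightarrow> y \<in> S')" by (simp add: S'_def same_cell_def)
    ultimately show ?thesis using S' by (intro bexI[of _ S']) auto
  qed
qed (use assms in \<open>auto simp: same_cell_def\<close>)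

lemma unif_pair_approx:
  assumes \<Omega>: "prob_space \<Omega>" and S: "S \<in> sets (unif \<Otimes>\<^sub>M \<Omega>)" and \<eta>: "0 < \<eta>"
  shows "\<exists>S'\<in>sets (unif \<Otimes>\<^sub>M \<Omega>). (\<exists>k. \<forall>x y w. same_cell k x y \<longrightarrow> ((x, w) \<in> S' \<longleftrightarrow> (y, w) \<in> S'))
    \<and> measure (unif \<Otimes>\<^sub>M \<Omega>) ((S - S') \<union> (S' - S)) < \<eta>"
proof (rule approximable_sigma[where R = "\<lambda>S. \<exists>k. \<forall>x y w. same_cell k x y \<longrightarrow> ((x, w) \<in> S \<longleftrightarrow> (y, w) \<in> S)"
      and \<G> = "{a \<times> b | a b. a \<in> sets unif \<and> b \<in> sets \<Omega>}"])
  interpret unif: prob_space unif by (rule prob_space_unif)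
  interpret \<Omega>: prob_space \<Omega> by fact
  interpret P: pair_prob_space unif \<Omega> ..
  show "finite_measure (unif \<Otimes>\<^sub>M \<Omega>)" by unfold_locales
  show "sets (unif \<Otimes>\<^sub>M \<Omega>) = sigma_sets (space (unif \<Otimes>\<^sub>M \<Omega>)) {a \<times> b | a b. a \<in> sets unif \<and> b \<in> sets \<Omega>}"
    unfolding sets_pair_measure space_pair_measure ..
  show "\<exists>k. \<forall>x y w. same_cell k x y \<longrightarrow> ((x, w) \<in> S \<union> T \<longleftrightarrow> (y, w) \<in> S \<union> T)"
    if ST: "\<exists>k. \<forall>x y w. same_cell k x y \<longrightarrow> ((x, w) \<in> S \<longleftrightarrow> (y, w) \<in> S)"
      "\<exists>k. \<forall>x y w. same_cell k x y \<longrightarrow> ((x, w) \<in> T \<longleftrightarrow> (y, w) \<in> T)" for S T :: "(real \<times> 'a) set"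
  proof -
    obtain k l where "\<forall>x y w. same_cell k x y \<longrightarrow> ((x, w) \<in> S \<longleftrightarrow> (y, w) \<in> S)"
      "\<forall>x y w. same_cell l x y \<longrightarrow> ((x, w) \<in> T \<longleftrightarrow> (y, w) \<in> T)" using ST by blast
    moreover have "same_cell (max k l) x y \<Longrightarrow> same_cell k x y \<and> same_cell l x y" for x y
      using same_cell_mono by (meson max.cobounded1 max.cobounded2)
    ultimately show ?thesis by (intro exI[of _ "max k l"]) blast
  qed
  show "\<exists>S'\<in>sets (unif \<Otimes>\<^sub>M \<Omega>). (\<exists>k. \<forall>x y w. same_cell k x y \<longrightarrow> ((x, w) \<in> S' \<longleftrightarrow> (y, w) \<in> S'))
    \<and> measure (unif \<Otimes>\<^sub>M \<Omega>) ((S - S') \<union> (S' - S)) < \<eta>"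
    if Sr: "S \<in> {a \<times> b | a b. a \<in> sets unif \<and> b \<in> sets \<Omega>}" and \<eta>: "0 < \<eta>" for S \<eta>
  proof -
    obtain a b where ab: "S = a \<times> b" "a \<in> sets borel" "b \<in> sets \<Omega>" using Sr by auto
    obtain a' k where a': "a' \<in> sets borel" "\<forall>x y. same_cell k x y \<longrightarrow> (x \<in> a' \<longleftrightarrow> y \<in> a')"
      "measure unif ((a - a') \<union> (a' - a)) < \<eta>" using unif_approx[OF ab(2) \<eta>] by auto
    have "(S - a' \<times> b) \<union> (a' \<times> b - S) \<subseteq> ((a - a') \<union> (a' - a)) \<times> space \<Omega>"
      using sets.sets_into_space[OF ab(3)] unfolding ab(1) by blast
    then have "measure (unif \<Otimes>\<^sub>M \<Omega>) ((S - a' \<times> b) \<union> (a' \<times> b - S)) \<le> measure (unif \<Otimes>\<^sub>M \<Omega>) (((a - a') \<union> (a' - a)) \<times> space \<Omega>)"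
      using ab a' by (intro P.finite_measure_mono) auto
    also have "\<dots> = measure unif ((a - a') \<union> (a' - a))"
      using ab a' by (simp add: measure_def \<Omega>.emeasure_pair_measure_Times \<Omega>.emeasure_space_1)
    also have "\<dots> < \<eta>" by (rule a'(3))
    finally show ?thesis using a'(1,2) ab(3) by (intro bexI[of _ "a' \<times> b"]) auto
  qed
  show "\<exists>k. \<forall>x y w. same_cell k x y \<longrightarrow> ((x, w) \<in> space (unif \<Otimes>\<^sub>M \<Omega>) - S \<longleftrightarrow> (y, w) \<in> space (unif \<Otimes>\<^sub>M \<Omega>) - S)"
    if Sk: "\<exists>k. \<forall>x y w. same_cell k x y \<longrightarrow> ((x, w) \<in> S \<longleftrightarrow> (y, w) \<in> S)" for S :: "(real \<times> 'a) set"
  proof -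
    obtain k where "\<forall>x y w. same_cell k x y \<longrightarrow> ((x, w) \<in> S \<longleftrightarrow> (y, w) \<in> S)" using Sk by blast
    then show ?thesis by (intro exI[of _ k]) (simp add: space_pair_measure)
  qed
qed (use S \<eta> in auto)


section \<open>The random orbit of a cocycle\<close>

text \<open>
  The base point \<open>x0\<close> is arbitrary.
\<close>

locale isometric_cocycle =
  fixes \<Omega> :: "'w measure"
    and act :: "'g::{topological_group_add, t2_space, second_countable_topology} \<Rightarrow> 'w \<Rightarrow> 'w"
    and \<alpha> :: "'g \<Rightarrow> 'w \<Rightarrow> 'x::metric_space \<Rightarrow> 'x"
    and x0 :: 'x
  assumes lc: "locally_compact_space (euclidean :: 'g topology)"
    and std: "standard_probability_space \<Omega>"
    and mp: "mp_action \<Omega> act"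
    and coc: "isom_cocycle \<Omega> act \<alpha>"
begin

sublocale prob_space \<Omega> using std by (simp add: standard_probability_space_def)

lemma embeddable: "borel_embeddable \<Omega>"
  using std by (intro standard_borel_embeddable) (simp add: standard_probability_space_def)

lemma act_measurable2: "(\<lambda>z. act (fst z) (snd z)) \<in> borel \<Otimes>\<^sub>M \<Omega> \<rightarrow>\<^sub>M \<Omega>"
  using mp by (simp add: mp_action_def case_prod_unfold)

lemma act_measurable [measurable]: "act g \<in> \<Omega> \<rightarrow>\<^sub>M \<Omega>"
  using measurable_compose[OF measurable_Pair1'[of g borel \<Omega>] act_measurable2] by simp

lemma act_space [simp]: "w \<in> space \<Omega> \<Longrightarrow> act g w \<in> space \<Omega>"
  using act_measurable by (rule measurable_space)

lemma act_zero: "w \<in> space \<Omega> \<Longrightarrow> act 0 w = w"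
  and act_add: "w \<in> space \<Omega> \<Longrightarrow> act (g + h) w = act g (act h w)"
  and distr_act: "distr \<Omega> \<Omega> (act g) = \<Omega>"
  using mp by (auto simp: mp_action_def)

lemma act_minus [simp]: "w \<in> space \<Omega> \<Longrightarrow> act g (act (- g) w) = w" "w \<in> space \<Omega> \<Longrightarrow> act (- g) (act g w) = w"
  using act_add[of w g "- g"] act_add[of w "- g" g] act_zero by auto

lemma integral_act: "f \<in> borel_measurable \<Omega> \<Longrightarrow> (\<integral>w. f (act g w) \<partial>\<Omega>) = (\<integral>w. f w \<partial>\<Omega> :: real)"
  using integral_distr[OF act_measurable[of g], of f] by (simp add: distr_act)

lemma AE_act: assumes "AE w in \<Omega>. P w" shows "AE w in \<Omega>. P (act g w)"
proof (rule AE_distrD[OF act_measurable[of g]])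
  show "AE w in distr \<Omega> \<Omega> (act g). P w" unfolding distr_act by fact
qed

lemma \<alpha>_measurable: "(\<lambda>z. \<alpha> (fst z) (snd z)) \<in> borel \<Otimes>\<^sub>M \<Omega> \<rightarrow>\<^sub>M isometries_borel"
  using coc by (simp add: isom_cocycle_def case_prod_unfold)

lemma \<alpha>_isometry: assumes "w \<in> space \<Omega>" shows "bij (\<alpha> g w)" "dist (\<alpha> g w x) (\<alpha> g w y) = dist x y"
proof -
  have "\<alpha> g w \<in> space isometries_borel"
    using measurable_space[OF \<alpha>_measurable, of "(g, w)"] assms by (simp add: space_pair_measure)
  then have "\<alpha> g w \<in> isometries" by (simp add: isometries_borel_def space_restrict_space)
  then show "bij (\<alpha> g w)" "dist (\<alpha> g w x) (\<alpha> g w y) = dist x y" by (auto simp: isometries_def)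
qed

lemma \<alpha>_add: "w \<in> space \<Omega> \<Longrightarrow> \<alpha> (g + h) w x = \<alpha> g (act h w) (\<alpha> h w x)"
  using coc by (simp add: isom_cocycle_def)

lemma \<alpha>_zero: assumes "w \<in> space \<Omega>" shows "\<alpha> 0 w x = x"
proof -
  have "\<alpha> 0 w (\<alpha> 0 w x) = \<alpha> 0 w x" using \<alpha>_add[OF assms, of 0 0 x] act_zero[OF assms] by simp
  then show ?thesis using \<alpha>_isometry(1)[OF assms, of 0] by (metis bij_pointE)
qed

text \<open>
  The random orbit of the base point. The inverse is placed so that the cocycle maps the orbit over \<open>w\<close> to the
  orbit over \<open>act g w\<close>, as \<open>\<alpha>_orb\<close> states.
\<close>

definition orb :: "'g \<Rightarrow> 'w \<Rightarrow> 'x" where "orb g w = \<alpha> g (act (- g) w) x0"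

lemma orb_measurable2: "(\<lambda>z. orb (fst z) (snd z)) \<in> borel \<Otimes>\<^sub>M \<Omega> \<rightarrow>\<^sub>M borel"
proof -
  have m: "(\<lambda>g. - g) \<in> borel \<rightarrow>\<^sub>M (borel :: 'g measure)"
    by (intro borel_measurable_continuous_onI continuous_intros)
  have "(\<lambda>z. (- fst z, snd z)) \<in> borel \<Otimes>\<^sub>M \<Omega> \<rightarrow>\<^sub>M (borel :: 'g measure) \<Otimes>\<^sub>M \<Omega>"
    by (intro measurable_Pair measurable_compose[OF measurable_fst m] measurable_snd)
  from measurable_compose[OF this act_measurable2]
  have "(\<lambda>z. (fst z, act (- fst z) (snd z))) \<in> borel \<Otimes>\<^sub>M \<Omega> \<rightarrow>\<^sub>M (borel :: 'g measure) \<Otimes>\<^sub>M \<Omega>"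
    by (intro measurable_Pair measurable_fst) simp
  from measurable_compose[OF this \<alpha>_measurable]
  have "(\<lambda>z. \<alpha> (fst z) (act (- fst z) (snd z))) \<in> borel \<Otimes>\<^sub>M \<Omega> \<rightarrow>\<^sub>M isometries_borel" by simp
  moreover have "(\<lambda>\<phi> :: 'x \<Rightarrow> 'x. \<phi> x0) \<in> isometries_borel \<rightarrow>\<^sub>M borel"
    unfolding isometries_borel_def
    by (intro measurable_restrict_space1 borel_measurable_continuous_onI continuous_on_product_coordinates)
  ultimately show ?thesis unfolding orb_def by (rule measurable_compose)
qed

lemma orb_measurable [measurable]: "orb g \<in> \<Omega> \<rightarrow>\<^sub>M borel"
  using measurable_compose[OF measurable_Pair1'[of g borel \<Omega>] orb_measurable2] by simp

lemma \<alpha>_orb: assumes "w \<in> space \<Omega>" shows "\<alpha> g w (orb h w) = orb (g + h) (act g w)"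
proof -
  have "act (- (g + h)) (act g w) = act (- h) w"
    using assms by (simp add: minus_add act_add[of "act g w"] del: add_uminus_conv_diff)
  then have "orb (g + h) (act g w) = \<alpha> (g + h) (act (- h) w) x0" by (simp add: orb_def)
  also have "\<dots> = \<alpha> g w (\<alpha> h (act (- h) w) x0)" using \<alpha>_add[of "act (- h) w" g h x0] assms by simp
  finally show ?thesis by (simp add: orb_def)
qed

lemma orb_zero: "w \<in> space \<Omega> \<Longrightarrow> orb 0 w = x0"
  by (simp add: orb_def act_zero \<alpha>_zero)

definition disp :: "'g \<Rightarrow> 'w \<Rightarrow> real" where "disp g w = dist x0 (orb g w)"

lemma disp_measurable2: "(\<lambda>z. disp (fst z) (snd z)) \<in> borel \<Otimes>\<^sub>M \<Omega> \<rightarrow>\<^sub>M borel"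
  unfolding disp_def
  by (rule measurable_compose[OF orb_measurable2]) (intro borel_measurable_continuous_onI continuous_intros)

lemma disp_measurable [measurable]: "disp g \<in> \<Omega> \<rightarrow>\<^sub>M borel"
  using measurable_compose[OF measurable_Pair1'[of g borel \<Omega>] disp_measurable2] by simp

lemma disp_nonneg [simp]: "0 \<le> disp g w" by (simp add: disp_def)

lemma dist_orb: assumes "w \<in> space \<Omega>" shows "dist (orb g w) (orb h w) = disp (- g + h) (act (- g) w)"
proof -
  define v where "v = act (- g) w"
  have v: "v \<in> space \<Omega>" "act g v = w" using assms by (auto simp: v_def)
  have "orb h w = \<alpha> g v (orb (- g + h) v)" using \<alpha>_orb[OF v(1), of g "- g + h"] v(2) by (simp add: add.assoc[symmetric])
  moreover have "orb g w = \<alpha> g v (orb 0 v)" using \<alpha>_orb[OF v(1), of g 0] v(2) by simp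
  ultimately show ?thesis using \<alpha>_isometry(2)[OF v(1)] orb_zero[OF v(1)] by (simp add: disp_def v_def)
qed

lemma dist_orb_measurable [measurable]: "(\<lambda>w. dist (orb g w) (orb h w)) \<in> borel_measurable \<Omega>"
proof -
  have "(\<lambda>w. disp (- g + h) (act (- g) w)) \<in> borel_measurable \<Omega>" by measurable
  then show ?thesis by (rule measurable_cong[THEN iffD1, rotated]) (simp add: dist_orb)
qed

text \<open>
  The mean displacement is cut off at 1 for integrability. By \<open>integral_dist_orb\<close> the mean
  truncated distance of the orbit points at \<open>g\<close> and \<open>h\<close> is \<open>\<tau> (- g + h)\<close>, a left invariant pseudometric.
\<close>

definition \<tau> :: "'g \<Rightarrow> real" where "\<tau> g = (\<integral>w. min 1 (disp g w) \<partial>\<Omega>)"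

lemma integrable_min [simp]: "f \<in> borel_measurable \<Omega> \<Longrightarrow> (\<And>w. 0 \<le> f w) \<Longrightarrow> integrable \<Omega> (\<lambda>w. min 1 (f w :: real))"
  by (rule integrable_const_bound[where B = 1]) auto

lemma integral_dist_orb: "(\<integral>w. min 1 (dist (orb g w) (orb h w)) \<partial>\<Omega>) = \<tau> (- g + h)"
proof -
  have "(\<integral>w. min 1 (dist (orb g w) (orb h w)) \<partial>\<Omega>) = (\<integral>w. min 1 (disp (- g + h) (act (- g) w)) \<partial>\<Omega>)"
    by (rule Bochner_Integration.integral_cong) (simp_all add: dist_orb)
  also have "\<dots> = \<tau> (- g + h)" unfolding \<tau>_def
    by (rule integral_act[of "\<lambda>w. min 1 (disp (- g + h) w)"]) measurable
  finally show ?thesis .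
qed

lemma \<tau>_minus: "\<tau> (- g) = \<tau> g"
  using integral_dist_orb[of g 0] integral_dist_orb[of 0 g] by (simp add: dist_commute)

lemma \<tau>_add: "\<tau> (g + h) \<le> \<tau> g + \<tau> h"
proof -
  have "\<tau> (g + h) = (\<integral>w. min 1 (dist (orb (- g) w) (orb h w)) \<partial>\<Omega>)" using integral_dist_orb[of "- g" h] by simp
  also have "\<dots> \<le> (\<integral>w. min 1 (dist (orb (- g) w) (orb 0 w)) + min 1 (dist (orb 0 w) (orb h w)) \<partial>\<Omega>)"
  proof (rule integral_mono)
    show "min 1 (dist (orb (- g) w) (orb h w)) \<le> min 1 (dist (orb (- g) w) (orb 0 w)) + min 1 (dist (orb 0 w) (orb h w))" for w
      using dist_triangle[of "orb (- g) w" "orb h w" "orb 0 w"] zero_le_dist[of "orb (- g) w" "orb 0 w"]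
        zero_le_dist[of "orb 0 w" "orb h w"] by linarith
  qed simp_all
  also have "\<dots> = \<tau> g + \<tau> h" using integral_dist_orb[of "- g" 0] integral_dist_orb[of 0 h] by simp
  finally show ?thesis .
qed

lemma \<tau>_measurable: "\<tau> \<in> borel_measurable borel"
proof -
  have "(\<lambda>z. min 1 (disp (fst z) (snd z))) \<in> borel \<Otimes>\<^sub>M \<Omega> \<rightarrow>\<^sub>M borel"
    using disp_measurable2 by measurable
  then show ?thesis unfolding \<tau>_def
    by (intro borel_measurable_lebesgue_integral) (simp add: case_prod_beta)
qed

lemma orb_essentially_separable: "\<exists>D. countable D \<and> (AE w in \<Omega>. orb g w \<in> closure D)"
  by (rule essentially_separably_valued[OF embeddable _ orb_measurable]) unfold_locales

text \<open>
  If the ball were meager, there would be a measurable family \<open>\<Phi> x\<close>, \<open>x \<in> {0..<1}\<close>, at mutual distance at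
  least \<open>\<epsilon>\<close> for \<open>\<tau>\<close>. The map \<open>(x, w) \<mapsto> orb (\<Phi> x) w\<close> is essentially separably valued, so up to a set \<open>E\<close> of
  small measure it takes, to precision \<open>\<epsilon> / 8\<close>, finitely many values \<open>c j\<close>, on sets \<open>S j\<close> that depend on \<open>x\<close>
  only through its dyadic cell of level \<open>m\<close>. Infinitely many \<open>x\<close> have a small section of \<open>E\<close>, so two of
  them share a cell; for these two the orbit points are close with high probability.
\<close>

lemma \<tau>_ball_not_meager:
  assumes \<epsilon>: "0 < \<epsilon>"
  shows "\<not> meager {g. \<tau> g < \<epsilon>}"
proof
  assume "meager {g. \<tau> g < \<epsilon>}"
  then obtain \<Phi>0 :: "real \<Rightarrow> 'g" where \<Phi>0: "\<Phi>0 \<in> borel_measurable (restrict_space borel {0..<1})"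
    "\<And>x y. x \<in> {0..<1} \<Longrightarrow> y \<in> {0..<1} \<Longrightarrow> x \<noteq> y \<Longrightarrow> - \<Phi>0 x + \<Phi>0 y \<notin> {g. \<tau> g < \<epsilon>}"
    by (rule cantor_scheme[OF lc]) blast
  define \<Phi> where "\<Phi> x = (if x \<in> {0..<1} then \<Phi>0 x else 0)" for x :: real
  have \<Phi>m: "\<Phi> \<in> unif \<rightarrow>\<^sub>M borel"
    unfolding \<Phi>_def using \<Phi>0(1)
    by (subst measurable_cong_sets[OF sets_unif refl], intro measurable_restrict_space_iff[THEN iffD1]) auto
  have sep: "\<epsilon> \<le> \<tau> (- \<Phi> x + \<Phi> y)" if "x \<in> {0..<1}" "y \<in> {0..<1}" "x \<noteq> y" for x y
    using \<Phi>0(2)[OF that] that by (simp add: \<Phi>_def)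
  interpret unif: prob_space unif by (rule prob_space_unif)
  interpret P: pair_prob_space unif \<Omega> ..
  let ?P = "unif \<Otimes>\<^sub>M \<Omega>"
  define \<xi> where "\<xi> z = orb (\<Phi> (fst z)) (snd z)" for z
  have "(\<lambda>z. (\<Phi> (fst z), snd z)) \<in> ?P \<rightarrow>\<^sub>M borel \<Otimes>\<^sub>M \<Omega>"
    by (intro measurable_Pair measurable_compose[OF measurable_fst \<Phi>m] measurable_snd)
  from measurable_compose[OF this orb_measurable2] have \<xi>m: "\<xi> \<in> borel_measurable ?P" unfolding \<xi>_def by simp
  obtain D0 where D0: "countable D0" "AE z in ?P. \<xi> z \<in> closure D0"
    using essentially_separably_valued[OF borel_embeddable_pair[OF unif_embeddable embeddable] _ \<xi>m]
      P.finite_measure_axioms by blast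
  define c where "c = from_nat_into (insert x0 D0)"
  have rc: "range c = insert x0 D0" unfolding c_def by (rule range_from_nat_into) (use D0(1) in auto)
  define near where "near j z \<longleftrightarrow> dist (\<xi> z) (c j) < \<epsilon> / 8" for j z
  define S where "S j = {z \<in> space ?P. near j z \<and> (\<forall>i<j. \<not> near i z)}" for j
  have nearm: "{z \<in> space ?P. near j z} \<in> sets ?P" for j
  proof -
    have "(\<lambda>z. dist (\<xi> z) (c j)) \<in> borel_measurable ?P"
      by (rule measurable_compose[OF \<xi>m]) (intro borel_measurable_continuous_onI continuous_intros)
    then show ?thesis unfolding near_def by measurable
  qed
  have Sm: "S j \<in> sets ?P" for j
  proof -
    have "S j = {z \<in> space ?P. near j z} - (\<Union>i<j. {z \<in> space ?P. near i z})" by (auto simp: S_def)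
    then show ?thesis using nearm by auto
  qed
  have Sdisj: "i = j" if "z \<in> S i" "z \<in> S j" for i j z
    using that unfolding S_def by (metis (no_types, lifting) mem_Collect_eq linorder_neqE_nat)
  \<comment> \<open>At the end, two points in a common cell are at distance less than \<open>\<epsilon> / 4 + 6 * \<eta>\<close> for \<open>\<tau>\<close>.\<close>
  define \<eta> where "\<eta> = \<epsilon> / 16"
  have \<eta>: "0 < \<eta>" using \<epsilon> by (simp add: \<eta>_def)
  have AEU: "AE z in ?P. z \<in> (\<Union>j. S j)"
    using D0(2)
  proof (rule AE_mp, intro AE_I2 impI)
    fix z assume z: "z \<in> space ?P" "\<xi> z \<in> closure D0"
    have "0 < \<epsilon> / 8" using \<epsilon> by simp
    then obtain d where "d \<in> D0" "dist d (\<xi> z) < \<epsilon> / 8" using z(2) unfolding closure_approachable by blast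
    moreover then obtain j where "d = c j" using rc by (metis insertCI rangeE)
    ultimately have "\<exists>j. near j z" by (auto simp: near_def dist_commute)
    then obtain l where "near l z" "\<forall>i<l. \<not> near i z" using exists_least_iff[of "\<lambda>j. near j z"] by blast
    then have "z \<in> S l" unfolding S_def using z(1) by blast
    then show "z \<in> (\<Union>j. S j)" by blast
  qed
  have "(\<lambda>n. measure ?P (\<Union>j<n. S j)) \<longlonglongrightarrow> measure ?P (\<Union>n. \<Union>j<n. S j)"
  proof (rule P.finite_Lim_measure_incseq)
    show "incseq (\<lambda>n. \<Union>j<n. S j)" by (intro monoI UN_mono) auto
  qed (use Sm in auto)
  moreover have "(\<Union>n. \<Union>j<n. S j) = (\<Union>j. S j)" by blast
  moreover have "measure ?P (\<Union>j. S j) = 1" using AEU Sm by (intro P.prob_eq_1[THEN iffD2]) auto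
  ultimately have "(\<lambda>n. measure ?P (\<Union>j<n. S j)) \<longlonglongrightarrow> 1" by simp
  then obtain J where J: "\<bar>measure ?P (\<Union>j<J. S j) - 1\<bar> < \<eta>"
    using LIMSEQ_D[OF _ \<eta>] by (metis order_refl real_norm_def)
  have "\<forall>j. \<exists>S'. S' \<in> sets ?P \<and> (\<exists>k. \<forall>x y w. same_cell k x y \<longrightarrow> ((x, w) \<in> S' \<longleftrightarrow> (y, w) \<in> S'))
      \<and> measure ?P ((S j - S') \<union> (S' - S j)) < \<eta> / (real J + 1)"
    using unif_pair_approx[OF prob_space_axioms Sm, of "\<eta> / (real J + 1)"] \<eta> by (simp add: Bex_def)
  from choice[OF this] obtain S' where S': "\<And>j. S' j \<in> sets ?P"
    "\<And>j. \<exists>k. \<forall>x y w. same_cell k x y \<longrightarrow> ((x, w) \<in> S' j \<longleftrightarrow> (y, w) \<in> S' j)"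
    "\<And>j. measure ?P ((S j - S' j) \<union> (S' j - S j)) < \<eta> / (real J + 1)" by blast
  have "\<forall>j. \<exists>k. \<forall>x y w. same_cell k x y \<longrightarrow> ((x, w) \<in> S' j \<longleftrightarrow> (y, w) \<in> S' j)" using S'(2) by blast
  from choice[OF this] obtain k where
    k: "\<And>j x y w. same_cell (k j) x y \<Longrightarrow> (x, w) \<in> S' j \<longleftrightarrow> (y, w) \<in> S' j" by blast
  define m where "m = (\<Sum>j<J. k j)"
  have km: "k j \<le> m" if "j < J" for j unfolding m_def using that by (intro member_le_sum) auto
  define E where "E = (space ?P - (\<Union>j<J. S j)) \<union> (\<Union>j<J. (S j - S' j) \<union> (S' j - S j))"
  have Em: "E \<in> sets ?P" unfolding E_def
    by (intro sets.Un sets.Diff sets.top sets.finite_UN finite_lessThan Sm S'(1))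
  have "measure ?P E \<le> measure ?P (space ?P - (\<Union>j<J. S j)) + measure ?P (\<Union>j<J. (S j - S' j) \<union> (S' j - S j))"
    unfolding E_def by (intro measure_Un_le sets.Un sets.Diff sets.top sets.finite_UN finite_lessThan Sm S'(1))
  also have "measure ?P (space ?P - (\<Union>j<J. S j)) = 1 - measure ?P (\<Union>j<J. S j)"
    by (intro P.prob_compl sets.finite_UN finite_lessThan Sm)
  also have "measure ?P (\<Union>j<J. (S j - S' j) \<union> (S' j - S j)) \<le> (\<Sum>j<J. measure ?P ((S j - S' j) \<union> (S' j - S j)))"
    by (intro measure_UNION_le finite_lessThan sets.Un sets.Diff Sm S'(1))
  also have "\<dots> \<le> (\<Sum>j<J. \<eta> / (real J + 1))" using S'(3) by (intro sum_mono less_imp_le)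
  also have "\<dots> \<le> \<eta>" using \<eta> by (simp add: field_simps)
  finally have PE: "measure ?P E < 2 * \<eta>" using J by linarith
  have same: "\<exists>j. (x, w) \<in> S j \<and> (y, w) \<in> S j"
    if xy: "same_cell m x y" "w \<in> space \<Omega>" "(x, w) \<notin> E" "(y, w) \<notin> E" for x y w
  proof -
    have "(x, w) \<in> space ?P" using xy(2) by (simp add: space_pair_measure)
    then obtain j where j: "j < J" "(x, w) \<in> S j" using xy(3) unfolding E_def by blast
    then have "(x, w) \<in> S' j" using xy(3) unfolding E_def by blast
    moreover have "same_cell (k j) x y" using same_cell_mono[OF xy(1) km[OF j(1)]] .
    ultimately have "(y, w) \<in> S' j" using k by blast
    then have "(y, w) \<in> S j" using xy(4) j(1) unfolding E_def by blast
    then show ?thesis using j(2) by blast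
  qed
  define sec where "sec x = Pair x -` E" for x
  have secm: "sec x \<in> sets \<Omega>" for x unfolding sec_def using Em by (rule sets_Pair1)
  \<comment> \<open>By Markov's inequality these \<open>x\<close> form a set of positive measure, in particular an infinite one.\<close>
  define good where "good = {x \<in> {0..<1}. measure \<Omega> (sec x) < 3 * \<eta>}"
  have inf: "infinite good"
  proof
    assume fin: "finite good"
    have "AE x in unif. x \<in> {0..<1} \<and> x \<notin> good"
    proof -
      have "good \<in> null_sets lborel" using fin by (simp add: finite_imp_null_set_lborel)
      then have "AE x in lborel. x \<notin> good" by (rule AE_not_in)
      then show ?thesis unfolding unif_def by (subst AE_density) (auto simp: indicator_def split: if_splits)
    qed
    then have "AE x in unif. ennreal (3 * \<eta>) \<le> emeasure \<Omega> (sec x)"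
      by (rule AE_mp) (auto intro!: AE_I2 simp: good_def emeasure_eq_measure not_less ennreal_leI)
    then have "(\<integral>\<^sup>+x. ennreal (3 * \<eta>) \<partial>unif) \<le> (\<integral>\<^sup>+x. emeasure \<Omega> (sec x) \<partial>unif)" by (rule nn_integral_mono_AE)
    also have "\<dots> = emeasure ?P E" unfolding sec_def by (rule emeasure_pair_measure_alt[symmetric, OF Em])
    finally have "ennreal (3 * \<eta>) \<le> ennreal (measure ?P E)"
      using unif.emeasure_space_1 by (simp add: P.emeasure_eq_measure)
    then show False using PE \<eta> by (simp add: ennreal_le_iff)
  qed
  have "(\<lambda>x. \<lfloor>2^m * x\<rfloor>) ` good \<subseteq> {0..<2^m}"
  proof
    fix i assume "i \<in> (\<lambda>x. \<lfloor>2^m * x\<rfloor>) ` good"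
    then obtain x :: real where x: "0 \<le> x" "x < 1" "i = \<lfloor>2^m * x\<rfloor>" by (auto simp: good_def)
    have "2^m * x < 2^m * 1" using x(2) by (intro mult_strict_left_mono) auto
    then show "i \<in> {0..<2^m}" using x by (simp add: floor_less_iff)
  qed
  then have "finite ((\<lambda>x. \<lfloor>2^m * x\<rfloor>) ` good)" by (rule finite_subset) simp
  then have "\<not> inj_on (\<lambda>x. \<lfloor>2^m * x\<rfloor>) good" using inf finite_imageD by blast
  then obtain x y where xy: "x \<in> good" "y \<in> good" "x \<noteq> y" "same_cell m x y"
    unfolding inj_on_def same_cell_def by blast
  have "\<tau> (- \<Phi> x + \<Phi> y) = (\<integral>w. min 1 (dist (orb (\<Phi> x) w) (orb (\<Phi> y) w)) \<partial>\<Omega>)" by (rule integral_dist_orb[symmetric])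
  also have "\<dots> \<le> (\<integral>w. \<epsilon> / 4 + indicator (sec x) w + indicator (sec y) w \<partial>\<Omega>)"
  proof (rule integral_mono)
    show "integrable \<Omega> (\<lambda>w. \<epsilon> / 4 + indicator (sec x) w + indicator (sec y) w)"
      using secm by (intro Bochner_Integration.integrable_add integrable_const integrable_real_indicator) (auto simp: emeasure_eq_measure)
    fix w assume w: "w \<in> space \<Omega>"
    show "min 1 (dist (orb (\<Phi> x) w) (orb (\<Phi> y) w)) \<le> \<epsilon> / 4 + indicator (sec x) w + indicator (sec y) w"
    proof (cases "(x, w) \<in> E \<or> (y, w) \<in> E")
      case True
      then have "1 \<le> (indicator (sec x) w + indicator (sec y) w :: real)" by (auto simp: sec_def indicator_def)
      moreover have "min 1 (dist (orb (\<Phi> x) w) (orb (\<Phi> y) w)) \<le> 1" by simp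
      ultimately show ?thesis using \<epsilon> by linarith
    next
      case False
      then obtain j where "(x, w) \<in> S j" "(y, w) \<in> S j" using same[OF xy(4) w] by blast
      then have "dist (orb (\<Phi> x) w) (c j) < \<epsilon> / 8" "dist (orb (\<Phi> y) w) (c j) < \<epsilon> / 8"
        by (auto simp: S_def near_def \<xi>_def)
      then have "dist (orb (\<Phi> x) w) (orb (\<Phi> y) w) \<le> \<epsilon> / 4"
        using dist_triangle2[of "orb (\<Phi> x) w" "orb (\<Phi> y) w" "c j"] by linarith
      moreover have "0 \<le> (indicator (sec x) w :: real)" "0 \<le> (indicator (sec y) w :: real)" by simp_all
      ultimately show ?thesis by linarith
    qed
  qed simp
  also have "\<dots> = \<epsilon> / 4 + measure \<Omega> (sec x) + measure \<Omega> (sec y)"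
    using secm by (subst Bochner_Integration.integral_add Bochner_Integration.integral_add, auto simp: emeasure_eq_measure prob_space sets.Int_space_eq2)+
  also have "\<dots> < \<epsilon> / 4 + 3 * \<eta> + 3 * \<eta>" using xy(1,2) by (simp add: good_def)
  also have "\<dots> \<le> \<epsilon>" using \<epsilon> by (simp add: \<eta>_def)
  finally show False using sep[of x y] xy by (simp add: good_def)
qed

text \<open>
  The theorem of Pettis and the subadditivity of \<open>\<tau>\<close> replace automatic continuity.
\<close>

lemma \<tau>_small: assumes "0 < \<epsilon>" shows "\<exists>V. open V \<and> 0 \<in> V \<and> (\<forall>v\<in>V. \<tau> v < \<epsilon>)"
proof -
  have e: "0 < \<epsilon> / 2" using assms by simp
  have "{g. \<tau> g < \<epsilon> / 2} = \<tau> -` {..<\<epsilon> / 2} \<inter> space borel" by auto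
  then have "{g. \<tau> g < \<epsilon> / 2} \<in> sets borel" using measurable_sets[OF \<tau>_measurable, of "{..<\<epsilon> / 2}"] by simp
  from pettis[OF lc this \<tau>_ball_not_meager[OF e]] obtain V where V: "open V" "0 \<in> V"
    "\<And>v. v \<in> V \<Longrightarrow> \<exists>a\<in>{g. \<tau> g < \<epsilon> / 2}. \<exists>b\<in>{g. \<tau> g < \<epsilon> / 2}. v = a - b" by blast
  have "\<tau> v < \<epsilon>" if v: "v \<in> V" for v
  proof -
    obtain a b where "\<tau> a < \<epsilon> / 2" "\<tau> b < \<epsilon> / 2" "v = a - b" using V(3)[OF v] by blast
    then show ?thesis using \<tau>_add[of a "- b"] \<tau>_minus[of b] by simp
  qed
  then show ?thesis using V by blast
qed

end


section \<open>Kernel sums over the orbit\<close>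

text \<open>
  Null sets are disregarded, so that the set where an almost everywhere convergent construction
  succeeds qualifies.
\<close>

definition (in isometric_cocycle) almost_invariant :: "'w set \<Rightarrow> bool" where
  "almost_invariant E \<longleftrightarrow> E \<in> sets \<Omega> \<and> (\<forall>g. AE w in \<Omega>. act g w \<in> E \<longleftrightarrow> w \<in> E)"

text \<open>
  The bound \<open>t \<le> 1\<close> makes the kernel 1-Lipschitz in the distance.
\<close>

locale median_cocycle = isometric_cocycle \<Omega> act \<alpha> x0
  for \<Omega> :: "'w measure"
    and act :: "'g::{topological_group_add, t2_space, second_countable_topology} \<Rightarrow> 'w \<Rightarrow> 'w"
    and \<alpha> :: "'g \<Rightarrow> 'w \<Rightarrow> 'x::metric_space \<Rightarrow> 'x"
    and x0 :: 'x +
  fixes t :: real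
  assumes med: "median_space TYPE('x)" and t: "0 < t" "t \<le> 1"
begin

definition supp :: "('g \<Rightarrow> complex) \<Rightarrow> 'g set" where "supp f = {g. f g \<noteq> 0}"

text \<open>
  In the reproducing kernel Hilbert space of \<open>exp (- t * d)\<close>, the function \<open>U f w\<close> is the combination of
  the kernel functions at the orbit points with coefficients \<open>f\<close>, and \<open>Q f w\<close> is its squared norm.
\<close>

definition U :: "('g \<Rightarrow> complex) \<Rightarrow> 'w \<Rightarrow> 'x \<Rightarrow> complex" where
  "U f w y = (\<Sum>h\<in>supp f. f h * of_real (exp (- t * dist (orb h w) y)))"

definition Q :: "('g \<Rightarrow> complex) \<Rightarrow> 'w \<Rightarrow> real" where
  "Q f w = (\<Sum>g\<in>supp f. \<Sum>h\<in>supp f. Re (f g * cnj (f h)) * exp (- t * dist (orb g w) (orb h w)))"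

lemma U_superset: "finite I \<Longrightarrow> supp f \<subseteq> I \<Longrightarrow> U f w y = (\<Sum>h\<in>I. f h * of_real (exp (- t * dist (orb h w) y)))"
  unfolding U_def by (rule sum.mono_neutral_left) (auto simp: supp_def)

lemma supp_diff: "supp (\<lambda>g. f g - e g) \<subseteq> supp f \<union> supp e"
  by (auto simp: supp_def)

lemma U_diff:
  assumes "finite (supp f)" "finite (supp e)"
  shows "U (\<lambda>g. f g - e g) w y = U f w y - U e w y"
proof -
  let ?I = "supp f \<union> supp e"
  have I: "finite ?I" using assms by simp
  show ?thesis
    using U_superset[OF I supp_diff, of w y] U_superset[OF I, of f w y] U_superset[OF I, of e w y]
    by (simp add: sum_subtractf left_diff_distrib)
qed

lemma U_bound: "cmod (U f w y) \<le> (\<Sum>h\<in>supp f. cmod (f h))"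
  unfolding U_def
proof (rule sum_norm_le)
  fix h
  have "exp (- t * dist (orb h w) y) \<le> 1" using t by simp
  then show "cmod (f h * of_real (exp (- t * dist (orb h w) y))) \<le> cmod (f h)"
    by (simp add: norm_mult mult_left_le)
qed

lemma Q_superset:
  assumes "finite I" "supp f \<subseteq> I"
  shows "Q f w = (\<Sum>g\<in>I. \<Sum>h\<in>I. Re (f g * cnj (f h)) * exp (- t * dist (orb g w) (orb h w)))"
proof -
  have "(\<Sum>h\<in>supp f. Re (f g * cnj (f h)) * exp (- t * dist (orb g w) (orb h w)))
      = (\<Sum>h\<in>I. Re (f g * cnj (f h)) * exp (- t * dist (orb g w) (orb h w)))" for g
    by (rule sum.mono_neutral_left) (use assms in \<open>auto simp: supp_def\<close>)
  moreover have "(\<Sum>g\<in>supp f. \<Sum>h\<in>I. Re (f g * cnj (f h)) * exp (- t * dist (orb g w) (orb h w)))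
      = (\<Sum>g\<in>I. \<Sum>h\<in>I. Re (f g * cnj (f h)) * exp (- t * dist (orb g w) (orb h w)))"
    by (rule sum.mono_neutral_left) (use assms in \<open>auto simp: supp_def\<close>)
  ultimately show ?thesis unfolding Q_def by simp
qed

lemma Q_nonneg: assumes "finite (supp f)" shows "0 \<le> Q f w"
proof -
  have "Q f w = Re (\<Sum>g\<in>supp f. \<Sum>h\<in>supp f. f g * cnj (f h) * of_real (exp (- t * dist (orb g w) (orb h w))))"
    unfolding Q_def by simp
  then show ?thesis using exp_neg_dist_posdef[OF med assms, of t f "\<lambda>h. orb h w"] t by simp
qed

text \<open>
  Evaluation at a point is a functional of norm at most 1 on the reproducing kernel space. In elementary terms,
  positive definiteness is applied to the orbit points together with \<open>y\<close>, which receives the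
  coefficient \<open>- U f w y\<close>.
\<close>

lemma U_le_Q: assumes fin: "finite (supp f)" shows "(cmod (U f w y))\<^sup>2 \<le> Q f w"
proof -
  define u where "u = U f w y"
  define c where "c i = (case i of None \<Rightarrow> - u | Some h \<Rightarrow> f h)" for i
  define p where "p i = (case i of None \<Rightarrow> y | Some h \<Rightarrow> orb h w)" for i
  define k where "k i j = complex_of_real (exp (- t * dist (p i) (p j)))" for i j
  let ?I = "insert None (Some ` supp f)"
  have ks: "k i j = k j i" for i j by (simp add: k_def dist_commute)
  have kN: "k None None = 1" by (simp add: k_def)
  have a: "(\<Sum>h\<in>supp f. f h * k (Some h) None) = u" by (simp add: u_def U_def k_def p_def)
  have b: "(\<Sum>h\<in>supp f. cnj (f h) * k None (Some h)) = cnj u"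
    unfolding a[symmetric] cnj_sum by (simp add: ks[of None]) (simp add: k_def)
  have "(\<Sum>i\<in>?I. \<Sum>j\<in>?I. c i * cnj (c j) * k i j)
     = u * cnj u - u * (\<Sum>h\<in>supp f. cnj (f h) * k None (Some h)) - cnj u * (\<Sum>h\<in>supp f. f h * k (Some h) None)
       + (\<Sum>g\<in>supp f. \<Sum>h\<in>supp f. f g * cnj (f h) * k (Some g) (Some h))"
    using fin by (simp add: sum.reindex c_def kN sum.distrib sum_distrib_left algebra_simps sum_negf sum_subtractf)
  also have "\<dots> = (\<Sum>g\<in>supp f. \<Sum>h\<in>supp f. f g * cnj (f h) * k (Some g) (Some h)) - u * cnj u"
    unfolding a b by simp
  finally have "Re (\<Sum>i\<in>?I. \<Sum>j\<in>?I. c i * cnj (c j) * k i j) = Q f w - (cmod u)\<^sup>2"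
    unfolding complex_norm_square[symmetric] Q_def by (simp add: k_def p_def)
  moreover have "0 \<le> Re (\<Sum>i\<in>?I. \<Sum>j\<in>?I. c i * cnj (c j) * k i j)"
    unfolding k_def by (rule exp_neg_dist_posdef[OF med]) (use fin t in auto)
  ultimately show ?thesis by (simp add: u_def)
qed

lemma Q_diff:
  assumes "finite (supp f)" "finite (supp e)"
  shows "Q (\<lambda>g. f g - e g) w = Q f w + Q e w - 2 * Re (\<Sum>h\<in>supp e. cnj (e h) * U f w (orb h w))"
proof -
  let ?I = "supp f \<union> supp e"
  have I: "finite ?I" using assms by simp
  define k where "k g h = exp (- t * dist (orb g w) (orb h w))" for g h
  have ks: "k g h = k h g" for g h by (simp add: k_def dist_commute)
  have "(\<Sum>h\<in>supp e. cnj (e h) * U f w (orb h w)) = (\<Sum>h\<in>?I. cnj (e h) * U f w (orb h w))"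
    by (rule sum.mono_neutral_left[OF I]) (auto simp: supp_def)
  also have "\<dots> = (\<Sum>h\<in>?I. \<Sum>g\<in>?I. f g * cnj (e h) * of_real (k g h))"
    by (intro sum.cong refl) (subst U_superset[OF I], auto simp: sum_distrib_left k_def mult_ac)
  also have "\<dots> = (\<Sum>g\<in>?I. \<Sum>h\<in>?I. f g * cnj (e h) * of_real (k g h))" by (rule sum.swap)
  finally have "Re (\<Sum>h\<in>supp e. cnj (e h) * U f w (orb h w)) = Re (\<Sum>g\<in>?I. \<Sum>h\<in>?I. f g * cnj (e h) * of_real (k g h))"
    by simp
  then have c: "Re (\<Sum>h\<in>supp e. cnj (e h) * U f w (orb h w)) = (\<Sum>g\<in>?I. \<Sum>h\<in>?I. Re (f g * cnj (e h)) * k g h)"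
    by simp
  have c': "(\<Sum>g\<in>?I. \<Sum>h\<in>?I. Re (e g * cnj (f h)) * k g h) = (\<Sum>g\<in>?I. \<Sum>h\<in>?I. Re (f g * cnj (e h)) * k g h)"
    by (subst sum.swap, intro sum.cong refl) (simp add: ks mult_ac)
  have "Q (\<lambda>g. f g - e g) w = (\<Sum>g\<in>?I. \<Sum>h\<in>?I. Re ((f g - e g) * cnj (f h - e h)) * k g h)"
    using Q_superset[OF I supp_diff] by (simp add: k_def)
  also have "\<dots> = (\<Sum>g\<in>?I. \<Sum>h\<in>?I. Re (f g * cnj (f h)) * k g h + Re (e g * cnj (e h)) * k g h
      - Re (f g * cnj (e h)) * k g h - Re (e g * cnj (f h)) * k g h)"
    by (intro sum.cong refl) (simp add: algebra_simps)
  also have "\<dots> = (\<Sum>g\<in>?I. \<Sum>h\<in>?I. Re (f g * cnj (f h)) * k g h) + (\<Sum>g\<in>?I. \<Sum>h\<in>?I. Re (e g * cnj (e h)) * k g h)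
      - (\<Sum>g\<in>?I. \<Sum>h\<in>?I. Re (f g * cnj (e h)) * k g h) - (\<Sum>g\<in>?I. \<Sum>h\<in>?I. Re (e g * cnj (f h)) * k g h)"
    by (simp only: sum.distrib sum_subtractf)
  finally show ?thesis
    unfolding c c' using Q_superset[OF I, of f w] Q_superset[OF I, of e w] by (simp add: k_def)
qed

lemma supp_shift: "supp (\<lambda>h. f (- g + h)) = (+) g ` supp f"
proof (intro Set.set_eqI iffI)
  fix h assume "h \<in> supp (\<lambda>h. f (- g + h))"
  then have "- g + h \<in> supp f" by (simp add: supp_def)
  moreover have "h = g + (- g + h)" by (simp add: add.assoc[symmetric])
  ultimately show "h \<in> (+) g ` supp f" by blast
next
  fix h assume "h \<in> (+) g ` supp f"
  then show "h \<in> supp (\<lambda>h. f (- g + h))" by (auto simp: supp_def add.assoc[symmetric])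
qed

lemma U_shift:
  assumes "w \<in> space \<Omega>"
  shows "U (\<lambda>h. f (- g + h)) (act g w) (\<alpha> g w y) = U f w y"
proof -
  have "U (\<lambda>h. f (- g + h)) (act g w) (\<alpha> g w y)
      = (\<Sum>h\<in>supp f. f h * of_real (exp (- t * dist (orb (g + h) (act g w)) (\<alpha> g w y))))"
    unfolding U_def supp_shift by (simp add: sum.reindex inj_on_def add.assoc[symmetric])
  also have "\<dots> = U f w y"
    unfolding U_def using assms by (simp add: \<alpha>_orb[symmetric] \<alpha>_isometry)
  finally show ?thesis .
qed

lemma Q_measurable [measurable]: "Q f \<in> borel_measurable \<Omega>"
  unfolding Q_def by measurable

lemma U_orb_measurable [measurable]: "(\<lambda>w. U f w (orb h w)) \<in> borel_measurable \<Omega>"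
  unfolding U_def by measurable

definition \<phi> :: "'w set \<Rightarrow> 'g \<Rightarrow> real" where
  "\<phi> E g = (\<integral>w. indicator E w * exp (- t * disp g w) \<partial>\<Omega>)"

lemma exp_bounds: "0 \<le> a \<Longrightarrow> 0 < exp (- t * a) \<and> exp (- t * a) \<le> 1"
  using t by simp

lemma integrable_ind_exp:
  assumes "E \<in> sets \<Omega>" "f \<in> borel_measurable \<Omega>" "\<And>w. 0 \<le> f w"
  shows "integrable \<Omega> (\<lambda>w. indicator E w * exp (- t * f w))"
proof (rule integrable_const_bound[where B = 1])
  show "AE w in \<Omega>. norm (indicator E w * exp (- t * f w)) \<le> 1"
    using exp_bounds[OF assms(3)] by (intro AE_I2) (simp add: indicator_def)
qed (use assms in measurable)

lemma integral_kernel: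
  assumes E: "almost_invariant E"
  shows "(\<integral>w. indicator E w * exp (- t * dist (orb g w) (orb h w)) \<partial>\<Omega>) = \<phi> E (- g + h)"
proof -
  have Em [measurable]: "E \<in> sets \<Omega>" using E by (simp add: almost_invariant_def)
  have "AE w in \<Omega>. act (- g) w \<in> E \<longleftrightarrow> w \<in> E" using E unfolding almost_invariant_def by blast
  then have "AE w in \<Omega>. indicator E w * exp (- t * dist (orb g w) (orb h w))
      = indicator E (act (- g) w) * exp (- t * disp (- g + h) (act (- g) w))"
  proof (rule AE_mp, intro AE_I2 impI)
    fix w assume w: "w \<in> space \<Omega>" "act (- g) w \<in> E \<longleftrightarrow> w \<in> E"
    then show "indicator E w * exp (- t * dist (orb g w) (orb h w))
      = indicator E (act (- g) w) * exp (- t * disp (- g + h) (act (- g) w))"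
      unfolding dist_orb[OF w(1)] indicator_def by simp
  qed
  then have "(\<integral>w. indicator E w * exp (- t * dist (orb g w) (orb h w)) \<partial>\<Omega>)
      = (\<integral>w. indicator E (act (- g) w) * exp (- t * disp (- g + h) (act (- g) w)) \<partial>\<Omega>)"
    by (intro integral_cong_AE) measurable
  also have "\<dots> = \<phi> E (- g + h)" unfolding \<phi>_def
    by (rule integral_act[of "\<lambda>w. indicator E w * exp (- t * disp (- g + h) w)"]) measurable
  finally show ?thesis .
qed

lemma integral_form:
  assumes E: "almost_invariant E" and I: "finite I"
  shows "(\<integral>w. indicator E w * (\<Sum>g\<in>I. \<Sum>h\<in>I. Re (c g * cnj (c h)) * exp (- t * dist (orb g w) (orb h w))) \<partial>\<Omega>)
    = Re (\<Sum>g\<in>I. \<Sum>h\<in>I. c g * cnj (c h) * of_real (\<phi> E (- g + h)))" (is "?L = ?R")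
    and "integrable \<Omega> (\<lambda>w. indicator E w * (\<Sum>g\<in>I. \<Sum>h\<in>I. Re (c g * cnj (c h)) * exp (- t * dist (orb g w) (orb h w))))"
proof -
  have Em: "E \<in> sets \<Omega>" using E by (simp add: almost_invariant_def)
  have i: "integrable \<Omega> (\<lambda>w. indicator E w * exp (- t * dist (orb g w) (orb h w)))" for g h
    by (rule integrable_ind_exp[OF Em]) simp_all
  have eq: "indicator E w * (\<Sum>g\<in>I. \<Sum>h\<in>I. Re (c g * cnj (c h)) * exp (- t * dist (orb g w) (orb h w)))
    = (\<Sum>g\<in>I. \<Sum>h\<in>I. Re (c g * cnj (c h)) * (indicator E w * exp (- t * dist (orb g w) (orb h w))))" for w
    by (simp only: sum_distrib_left mult.left_commute)
  show "integrable \<Omega> (\<lambda>w. indicator E w * (\<Sum>g\<in>I. \<Sum>h\<in>I. Re (c g * cnj (c h)) * exp (- t * dist (orb g w) (orb h w))))"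
    unfolding eq by (intro Bochner_Integration.integrable_sum integrable_mult_right i)
  have "?L = (\<Sum>g\<in>I. \<Sum>h\<in>I. Re (c g * cnj (c h)) * \<phi> E (- g + h))"
  proof -
    have j: "(\<integral>w. r * (indicator E w * exp (- t * dist (orb g w) (orb h w))) \<partial>\<Omega>) = r * \<phi> E (- g + h)" for r g h
      unfolding integral_mult_right_zero integral_kernel[OF E] ..
    show ?thesis unfolding eq
      by (simp only: Bochner_Integration.integral_sum Bochner_Integration.integrable_sum integrable_mult_right[OF i] j)
  qed
  also have "\<dots> = ?R" by simp
  finally show "?L = ?R" .
qed

text \<open>
  Almost invariance of \<open>E\<close> turns the averaged kernel into a function of \<open>- g + h\<close> (\<open>integral_kernel\<close>);
  continuity comes from \<open>\<tau>_small\<close>.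
\<close>

lemma \<phi>_positive_definite:
  assumes E: "almost_invariant E"
  shows "positive_definite_function (\<phi> E)"
proof
  fix I :: "'g set" and c :: "'g \<Rightarrow> complex" assume I: "finite I"
  have "0 \<le> (\<Sum>g\<in>I. \<Sum>h\<in>I. Re (c g * cnj (c h)) * exp (- t * dist (orb g w) (orb h w)))" for w
    using exp_neg_dist_posdef[OF med I, of t c "\<lambda>h. orb h w"] t by simp
  then show "0 \<le> Re (\<Sum>g\<in>I. \<Sum>h\<in>I. c g * cnj (c h) * of_real (\<phi> E (- g + h)))"
    unfolding integral_form(1)[OF E I, symmetric] by (intro integral_nonneg_AE AE_I2) simp
next
  show "\<phi> E (- g) = \<phi> E g" for g
    using integral_kernel[OF E, of g 0] integral_kernel[OF E, of 0 g] by (simp add: dist_commute)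
next
  have Em: "E \<in> sets \<Omega>" using E by (simp add: almost_invariant_def)
  have bound: "\<bar>\<phi> E h - \<phi> E g\<bar> \<le> \<tau> (- g + h)" for g h
  proof -
    have "\<phi> E h - \<phi> E g = (\<integral>w. indicator E w * exp (- t * disp h w) - indicator E w * exp (- t * disp g w) \<partial>\<Omega>)"
      unfolding \<phi>_def by (intro Bochner_Integration.integral_diff[symmetric] integrable_ind_exp[OF Em]) simp_all
    also have "\<bar>\<dots>\<bar> \<le> (\<integral>w. \<bar>indicator E w * exp (- t * disp h w) - indicator E w * exp (- t * disp g w)\<bar> \<partial>\<Omega>)"
      by (rule integral_abs_bound)
    also have "\<dots> \<le> (\<integral>w. min 1 (dist (orb g w) (orb h w)) \<partial>\<Omega>)"
    proof (rule integral_mono)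
      show "integrable \<Omega> (\<lambda>w. \<bar>indicator E w * exp (- t * disp h w) - indicator E w * exp (- t * disp g w)\<bar>)"
        by (intro integrable_abs Bochner_Integration.integrable_diff integrable_ind_exp[OF Em]) simp_all
      fix w
      have lip: "exp (- t * a) - exp (- t * b) \<le> b - a" if "0 \<le> a" "a \<le> b" for a b :: real
      proof -
        have "exp (- t * b) = exp (- t * a) * exp (- t * (b - a))" by (simp add: mult_exp_exp algebra_simps)
        moreover have "1 + (- t * (b - a)) \<le> exp (- t * (b - a))" by (rule exp_ge_add_one_self)
        ultimately have "exp (- t * a) - exp (- t * b) \<le> exp (- t * a) * (t * (b - a))"
          using mult_left_mono[of "1 + (- t * (b - a))" "exp (- t * (b - a))" "exp (- t * a)"] by (simp add: algebra_simps)
        also have "\<dots> \<le> 1 * (1 * (b - a))"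
          using exp_bounds[OF that(1)] that t by (intro mult_mono) auto
        finally show ?thesis by simp
      qed
      have "\<bar>exp (- t * disp h w) - exp (- t * disp g w)\<bar> \<le> \<bar>disp h w - disp g w\<bar>"
        using lip[of "disp h w" "disp g w"] lip[of "disp g w" "disp h w"] exp_le_cancel_iff[of "- t * disp h w" "- t * disp g w"] t
        by (cases "disp h w \<le> disp g w") (simp_all add: abs_if)
      also have "\<dots> \<le> dist (orb g w) (orb h w)"
        unfolding disp_def using dist_triangle[of x0 "orb h w" "orb g w"] dist_triangle2[of x0 "orb g w" "orb h w"] by simp
      finally have "\<bar>exp (- t * disp h w) - exp (- t * disp g w)\<bar> \<le> dist (orb g w) (orb h w)" .
      moreover have "\<bar>exp (- t * disp h w) - exp (- t * disp g w)\<bar> \<le> 1"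
        using exp_bounds[OF disp_nonneg[of h w]] exp_bounds[OF disp_nonneg[of g w]] by linarith
      ultimately show "\<bar>indicator E w * exp (- t * disp h w) - indicator E w * exp (- t * disp g w)\<bar> \<le> min 1 (dist (orb g w) (orb h w))"
        by (simp add: indicator_def)
    qed simp
    also have "\<dots> = \<tau> (- g + h)" by (rule integral_dist_orb)
    finally show ?thesis .
  qed
  have "(\<phi> E \<longlongrightarrow> \<phi> E g) (at g)" for g
  proof (rule tendstoI)
    fix r :: real assume "0 < r"
    from \<tau>_small[OF this] obtain V where V: "open V" "0 \<in> V" "\<And>v. v \<in> V \<Longrightarrow> \<tau> v < r" by blast
    have "open ((\<lambda>h. - g + h) -` V)" using V(1) by (intro open_vimage continuous_intros)
    moreover have "dist (\<phi> E h) (\<phi> E g) < r" if "h \<in> (\<lambda>h. - g + h) -` V" for h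
      using bound[of h g] V(3)[of "- g + h"] that by (simp add: dist_real_def)
    ultimately show "\<forall>\<^sub>F h in at g. dist (\<phi> E h) (\<phi> E g) < r"
      unfolding eventually_at_topological using V(2) by (intro exI[of _ "(\<lambda>h. - g + h) -` V"]) auto
  qed
  then show "continuous_on UNIV (\<phi> E)" by (simp add: continuous_on_def)
qed

lemma kernel_form_eq:
  assumes E: "almost_invariant E" and f: "finite (supp f)"
  shows "kernel_form (\<phi> E) f = (\<integral>w. indicator E w * Q f w \<partial>\<Omega>)" "integrable \<Omega> (\<lambda>w. indicator E w * Q f w)"
  using integral_form[OF E f, of f] unfolding kernel_form_def Q_def supp_def by simp_all

end


section \<open>Invariant functions and their level sets\<close>

text \<open>
  The conclusion of the theorem, restricted to an almost invariant part of the probability space.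
\<close>

definition (in isometric_cocycle) carries_field :: "'w set \<Rightarrow> ('w \<Rightarrow> 'x set) \<Rightarrow> bool" where
  "carries_field S F \<longleftrightarrow> almost_invariant S \<and> (\<forall>w\<in>S. F w \<in> Bdd) \<and>
     (\<forall>g. AE w in \<Omega>. w \<in> S \<longrightarrow> \<alpha> g w ` F w = F (act g w)) \<and>
     {(w, x). w \<in> S \<and> x \<in> F w} \<in> sets (\<Omega> \<Otimes>\<^sub>M borel)"

text \<open>
  The coefficients \<open>f\<close> that property (T) provides, together with the indices \<open>r\<close> of a subsequence that
  converges fast enough for almost sure convergence.
\<close>

locale invariant_coefficients = median_cocycle \<Omega> act \<alpha> x0 t
  for \<Omega> :: "'w measure"
    and act :: "'g::{topological_group_add, t2_space, second_countable_topology} \<Rightarrow> 'w \<Rightarrow> 'w"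
    and \<alpha> :: "'g \<Rightarrow> 'w \<Rightarrow> 'x::metric_space \<Rightarrow> 'x"
    and x0 :: 'x and t :: real +
  fixes E :: "'w set" and f :: "nat \<Rightarrow> 'g \<Rightarrow> complex" and r :: "nat \<Rightarrow> nat"
  assumes E: "almost_invariant E" and fin: "\<And>i. finite (supp (f i))"
    and cauchy: "\<And>\<epsilon>. 0 < \<epsilon> \<Longrightarrow> \<exists>N. \<forall>m\<ge>N. \<forall>n\<ge>N. kernel_form (\<phi> E) (\<lambda>g. f m g - f n g) < \<epsilon>"
    and inv: "\<And>g. (\<lambda>i. kernel_form (\<phi> E) (\<lambda>h. f i (- g + h) - f i h)) \<longlonglongrightarrow> 0"
    and nz: "\<not> (\<lambda>i. kernel_form (\<phi> E) (f i)) \<longlonglongrightarrow> 0"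
    and r_ge: "\<And>i. i \<le> r i"
    and rate: "\<And>i. kernel_form (\<phi> E) (\<lambda>g. f (r (Suc i)) g - f (r i) g) \<le> 1 / 4 ^ i"
begin

definition F :: "nat \<Rightarrow> 'g \<Rightarrow> complex" where "F i = f (r i)"

definition inc :: "nat \<Rightarrow> 'w \<Rightarrow> real" where "inc i w = Q (\<lambda>g. F (Suc i) g - F i g) w"

text \<open>
  A weighted bound on the increments, from which uniform convergence follows. The constant is a natural
  number, so that measurability is immediate.
\<close>

definition tame :: "'w \<Rightarrow> bool" where "tame w \<longleftrightarrow> (\<exists>C :: nat. \<forall>i. 2 ^ i * inc i w \<le> real C)"

definition u :: "'w \<Rightarrow> 'x \<Rightarrow> complex" where "u w y = lim (\<lambda>i. U (F i) w y)"

lemma Em [measurable]: "E \<in> sets \<Omega>" using E by (simp add: almost_invariant_def)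

lemma finF: "finite (supp (F i))" using fin by (simp add: F_def)

lemma fin_diff: "finite (supp a) \<Longrightarrow> finite (supp b) \<Longrightarrow> finite (supp (\<lambda>g. a g - b g))"
  by (rule finite_subset[OF supp_diff]) simp

lemma inc_measurable [measurable]: "inc i \<in> borel_measurable \<Omega>"
  unfolding inc_def by (rule Q_measurable)

lemma inc_nonneg: "0 \<le> inc i w" unfolding inc_def by (intro Q_nonneg fin_diff finF)

text \<open>
  The weighted increments have integral at most \<open>(1 / 2) ^ i\<close>, so their sum is finite almost everywhere.
\<close>

lemma AE_tame: "AE w in \<Omega>. w \<in> E \<longrightarrow> tame w"
proof -
  define G where "G i w = 2 ^ i * (indicator E w * inc i w)" for i w
  have G0: "0 \<le> G i w" for i w unfolding G_def by (simp add: inc_nonneg)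
  have Gi: "integrable \<Omega> (G i)" and GI: "(\<integral>w. G i w \<partial>\<Omega>) \<le> (1 / 2) ^ i" for i
  proof -
    note k = kernel_form_eq[OF E fin_diff[OF finF[of "Suc i"] finF[of i]]]
    show "integrable \<Omega> (G i)" unfolding G_def inc_def by (intro integrable_mult_right k(2))
    have "(\<integral>w. G i w \<partial>\<Omega>) = 2 ^ i * kernel_form (\<phi> E) (\<lambda>g. F (Suc i) g - F i g)"
      unfolding G_def inc_def k(1) by simp
    also have "\<dots> \<le> 2 ^ i * (1 / 4 ^ i)" unfolding F_def by (intro mult_left_mono rate) simp
    also have "\<dots> = (2 / 4) ^ i" by (simp only: power_divide mult_1_right times_divide_eq_right)
    finally show "(\<integral>w. G i w \<partial>\<Omega>) \<le> (1 / 2) ^ i" by simp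
  qed
  have Gm: "G i \<in> borel_measurable \<Omega>" for i using Gi by (rule borel_measurable_integrable)
  have "(\<integral>\<^sup>+w. (suminf (\<lambda>i. ennreal (G i w))) \<partial>\<Omega>) = suminf (\<lambda>i. \<integral>\<^sup>+w. ennreal (G i w) \<partial>\<Omega>)"
    using Gm by (intro nn_integral_suminf) measurable
  also have "\<dots> \<le> suminf (\<lambda>i. ennreal ((1 / 2) ^ i))"
  proof (rule suminf_le)
    fix i
    have "(\<integral>\<^sup>+w. ennreal (G i w) \<partial>\<Omega>) = ennreal (\<integral>w. G i w \<partial>\<Omega>)"
      using Gi G0 by (intro nn_integral_eq_integral) auto
    then show "(\<integral>\<^sup>+w. ennreal (G i w) \<partial>\<Omega>) \<le> ennreal ((1 / 2) ^ i)" using GI by (simp add: ennreal_leI)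
  qed auto
  also have "\<dots> = ennreal (suminf (\<lambda>i. (1 / 2) ^ i))" by (intro suminf_ennreal2) (auto intro: summable_geometric)
  finally have "(\<integral>\<^sup>+w. (suminf (\<lambda>i. ennreal (G i w))) \<partial>\<Omega>) \<noteq> \<infinity>" by (auto simp: top_unique)
  then have "AE w in \<Omega>. (suminf (\<lambda>i. ennreal (G i w))) \<noteq> \<infinity>"
    using Gm by (intro nn_integral_noteq_infinite) measurable
  then show ?thesis
  proof (rule AE_mp, intro AE_I2 impI)
    fix w assume w: "(suminf (\<lambda>i. ennreal (G i w))) \<noteq> \<infinity>" "w \<in> E"
    define s where "s = enn2real (suminf (\<lambda>i. ennreal (G i w)))"
    have s: "ennreal s = (suminf (\<lambda>i. ennreal (G i w)))" unfolding s_def using w(1) by (simp add: less_top)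
    have "2 ^ i * inc i w \<le> real (nat \<lceil>s\<rceil>)" for i
    proof -
      have "(\<Sum>i\<in>{i}. ennreal (G i w)) \<le> (suminf (\<lambda>i. ennreal (G i w)))" by (rule sum_le_suminf) auto
      then have "ennreal (G i w) \<le> ennreal s" unfolding s by simp
      then have "G i w \<le> s" by (rule ennreal_le_iff[THEN iffD1, rotated]) (simp add: s_def)
      then show ?thesis using w(2) by (simp add: G_def) linarith
    qed
    then show "tame w" unfolding tame_def by blast
  qed
qed

lemma uniform_limit_u:
  assumes "tame w"
  shows "uniform_limit UNIV (\<lambda>i. U (F i) w) (u w) sequentially"
proof -
  obtain C :: nat where C: "\<And>i. 2 ^ i * inc i w \<le> real C" using assms unfolding tame_def by blast
  define d where "d i y = U (F (Suc i)) w y - U (F i) w y" for i y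
  have bound: "cmod (d i y) \<le> sqrt (real C) * sqrt (1 / 2) ^ i" for i y
  proof -
    have "(cmod (d i y))\<^sup>2 \<le> inc i w"
      unfolding d_def inc_def U_diff[OF finF finF, symmetric] by (intro U_le_Q fin_diff finF)
    also have "\<dots> \<le> real C / 2 ^ i" using C[of i] by (simp add: field_simps)
    also have "\<dots> = (sqrt (real C) * sqrt (1 / 2) ^ i)\<^sup>2"
    proof -
      have "(sqrt (1 / 2) ^ i)\<^sup>2 = (sqrt (1 / 2) * sqrt (1 / 2)) ^ i" by (simp only: power2_eq_square power_mult_distrib)
      also have "\<dots> = (1 / 2) ^ i" by simp
      finally have e: "(sqrt (1 / 2) ^ i)\<^sup>2 = (1 / 2) ^ i" .
      show ?thesis unfolding power_mult_distrib e by (simp add: power_one_over)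
    qed
    finally show ?thesis by (rule power2_le_imp_le) simp
  qed
  have sq: "sqrt (1 / 2 :: real) < 1" by (simp add: real_sqrt_lt_1_iff)
  have "summable (\<lambda>i. sqrt (real C) * sqrt (1 / 2) ^ i)"
    using sq by (intro summable_mult summable_geometric) simp
  then have "uniform_limit UNIV (\<lambda>n y. \<Sum>i<n. d i y) (\<lambda>y. suminf (\<lambda>i. d i y)) sequentially"
    using bound by (intro Weierstrass_m_test) auto
  then have "uniform_limit UNIV (\<lambda>n y. (\<Sum>i<n. d i y) + U (F 0) w y) (\<lambda>y. suminf (\<lambda>i. d i y) + U (F 0) w y) sequentially"
    by (intro uniform_limit_add uniform_limit_const)
  moreover have "(\<Sum>i<n. d i y) + U (F 0) w y = U (F n) w y" for n y
    unfolding d_def by (subst sum_lessThan_telescope) simp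
  ultimately have ul: "uniform_limit UNIV (\<lambda>n. U (F n) w) (\<lambda>y. suminf (\<lambda>i. d i y) + U (F 0) w y) sequentially"
    by simp
  have "u w y = suminf (\<lambda>i. d i y) + U (F 0) w y" for y
    unfolding u_def by (rule limI[OF tendsto_uniform_limitI[OF ul]]) simp
  then have "u w = (\<lambda>y. suminf (\<lambda>i. d i y) + U (F 0) w y)" by blast
  then show ?thesis using ul by simp
qed

lemma tendsto_u: "tame w \<Longrightarrow> (\<lambda>i. U (F i) w y) \<longlonglongrightarrow> u w y"
  using tendsto_uniform_limitI[OF uniform_limit_u] by simp

lemma continuous_u: assumes "tame w" shows "continuous_on UNIV (u w)"
proof (rule uniform_limit_theorem[OF _ uniform_limit_u[OF assms]])
  have "continuous_on UNIV (U (F i) w)" for i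
    unfolding U_def by (intro continuous_intros)
  then show "\<forall>\<^sub>F n in sequentially. continuous_on UNIV (U (F n) w)" by simp
qed simp

lemma u_approx: assumes "tame w" "0 < \<delta>" shows "\<exists>i. \<forall>y. cmod (u w y) < cmod (U (F i) w y) + \<delta>"
proof -
  have "\<forall>\<^sub>F i in sequentially. \<forall>y\<in>UNIV. dist (U (F i) w y) (u w y) < \<delta>"
    using uniform_limitD[OF uniform_limit_u[OF assms(1)] assms(2)] .
  then obtain i where i: "\<And>y. dist (U (F i) w y) (u w y) < \<delta>"
    unfolding eventually_sequentially by blast
  have "cmod (u w y) < cmod (U (F i) w y) + \<delta>" for y
    using i[of y] norm_triangle_ineq2[of "u w y" "U (F i) w y"] by (simp add: dist_norm norm_minus_commute)
  then show ?thesis by blast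
qed

lemma u_bounded: assumes "tame w" shows "\<exists>M. \<forall>y. cmod (u w y) \<le> M"
proof -
  obtain i where "\<And>y. cmod (u w y) < cmod (U (F i) w y) + 1" using u_approx[OF assms, of 1] by auto
  then have "cmod (u w y) \<le> (\<Sum>h\<in>supp (F i). cmod (F i h)) + 1" for y
    using U_bound[of "F i" w y] less_imp_le order_trans[OF _ add_right_mono] by meson
  then show ?thesis by blast
qed

text \<open>
  Up to \<open>\<delta> / 2\<close>, the function \<open>u w\<close> is a finite sum of kernel functions, and these decay away from finitely
  many orbit points.
\<close>

lemma u_level_bounded: assumes w: "tame w" and \<delta>: "0 < \<delta>" shows "bounded {y. \<delta> < cmod (u w y)}"
proof -
  obtain i where i: "\<And>y. cmod (u w y) < cmod (U (F i) w y) + \<delta> / 2"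
    using u_approx[OF w, of "\<delta> / 2"] \<delta> by auto
  define M where "M = (\<Sum>h\<in>supp (F i). cmod (F i h))"
  \<comment> \<open>Chosen so that \<open>M * exp (- t * R) \<le> \<delta> / 2\<close>, by \<open>1 + s \<le> exp s\<close>.\<close>
  define R where "R = (2 * M / \<delta> + 1) / t"
  have M0: "0 \<le> M" unfolding M_def by (rule sum_nonneg) simp
  have "{y. \<delta> < cmod (u w y)} \<subseteq> (\<Union>h\<in>supp (F i). cball (orb h w) R)"
  proof
    fix y assume "y \<in> {y. \<delta> < cmod (u w y)}"
    then have big: "\<delta> / 2 < cmod (U (F i) w y)" using i[of y] by simp
    show "y \<in> (\<Union>h\<in>supp (F i). cball (orb h w) R)"
    proof (rule ccontr)
      assume "y \<notin> (\<Union>h\<in>supp (F i). cball (orb h w) R)"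
      then have far: "R < dist (orb h w) y" if "h \<in> supp (F i)" for h using that by (simp add: not_le)
      have "cmod (U (F i) w y) \<le> (\<Sum>h\<in>supp (F i). cmod (F i h) * exp (- t * R))"
        unfolding U_def
      proof (rule sum_norm_le)
        fix h assume "h \<in> supp (F i)"
        then have "exp (- t * dist (orb h w) y) \<le> exp (- t * R)" using far[of h] t by simp
        then show "cmod (F i h * of_real (exp (- t * dist (orb h w) y))) \<le> cmod (F i h) * exp (- t * R)"
          by (simp add: norm_mult mult_left_mono)
      qed
      also have "\<dots> = M * exp (- t * R)" by (simp add: M_def sum_distrib_right)
      also have "\<dots> \<le> \<delta> / 2"
      proof -
        have "t * R = 2 * M / \<delta> + 1" unfolding R_def using t by simp
        then have "2 * M / \<delta> \<le> exp (t * R)" using exp_ge_add_one_self[of "t * R"] by linarith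
        then have "M \<le> \<delta> / 2 * exp (t * R)" using \<delta> by (simp add: field_simps)
        then have "M * exp (- t * R) \<le> \<delta> / 2 * exp (t * R) * exp (- t * R)" by (intro mult_right_mono) auto
        also have "\<dots> = \<delta> / 2" by (simp add: mult.assoc mult_exp_exp)
        finally show ?thesis .
      qed
      finally show False using big by simp
    qed
  qed
  moreover have "bounded (\<Union>h\<in>supp (F i). cball (orb h w) R)" using finF by auto
  ultimately show ?thesis by (rule bounded_subset[rotated])
qed

lemma r_at_top: "filterlim r at_top sequentially"
  unfolding filterlim_at_top by (metis eventually_sequentially le_trans r_ge)

text \<open>
  The translated coefficients give the translated function (\<open>U_shift\<close>), and their difference from the
  original ones is null in mean, hence pointwise along a subsequence (\<open>U_le_Q\<close>).
\<close>

lemma AE_u_invariant: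
  "AE w in \<Omega>. w \<in> E \<longrightarrow> act g w \<in> E \<and> tame w \<and> tame (act g w) \<and> (\<forall>y. u (act g w) (\<alpha> g w y) = u w y)"
proof -
  define D where "D i w = indicator E w * Q (\<lambda>h. F i (- g + h) - F i h) w" for i w
  have fs: "finite (supp (\<lambda>h. F i (- g + h)))" for i unfolding supp_shift using finF by simp
  have fd: "finite (supp (\<lambda>h. F i (- g + h) - F i h))" for i by (rule fin_diff[OF fs finF])
  have D0: "0 \<le> D i w" for i w unfolding D_def by (simp add: Q_nonneg[OF fd])
  have Di: "integrable \<Omega> (D i)" for i unfolding D_def by (rule kernel_form_eq(2)[OF E fd])
  have "(\<lambda>i. \<integral>w. norm (D i w) \<partial>\<Omega>) \<longlonglongrightarrow> 0"
  proof -
    have "(\<integral>w. norm (D i w) \<partial>\<Omega>) = kernel_form (\<phi> E) (\<lambda>h. f (r i) (- g + h) - f (r i) h)" for i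
      using D0 kernel_form_eq(1)[OF E fd, of i] by (simp add: D_def F_def)
    then show ?thesis using filterlim_compose[OF inv r_at_top, of g] by simp
  qed
  from tendsto_L1_AE_subseq[OF Di this] obtain s where s: "strict_mono s" "AE w in \<Omega>. (\<lambda>n. D (s n) w) \<longlonglongrightarrow> 0"
    by blast
  have "AE w in \<Omega>. act g w \<in> E \<longleftrightarrow> w \<in> E" using E unfolding almost_invariant_def by blast
  with AE_act[OF s(2), of g] AE_act[OF AE_tame, of g] AE_tame AE_space show ?thesis
  proof eventually_elim
    case (elim w)
    show ?case
    proof
      assume wE: "w \<in> E"
      then have tw: "tame w" "tame (act g w)" "act g w \<in> E" using elim by auto
      have "u (act g w) (\<alpha> g w y) = u w y" for y
      proof -
        have le: "(cmod (U (F i) w y - U (F i) (act g w) (\<alpha> g w y)))\<^sup>2 \<le> D i (act g w)" for i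
        proof -
          have "U (F i) w y - U (F i) (act g w) (\<alpha> g w y) = U (\<lambda>h. F i (- g + h) - F i h) (act g w) (\<alpha> g w y)"
            using U_shift[OF elim(4), of "F i" g y] by (simp add: U_diff[OF fs finF])
          then show ?thesis using U_le_Q[OF fd[of i], of "act g w" "\<alpha> g w y"] tw(3) by (simp add: D_def)
        qed
        have "(\<lambda>i. (cmod (U (F i) w y - U (F i) (act g w) (\<alpha> g w y)))\<^sup>2) \<longlonglongrightarrow> (cmod (u w y - u (act g w) (\<alpha> g w y)))\<^sup>2"
          by (intro tendsto_intros tendsto_u tw)
        from LIMSEQ_subseq_LIMSEQ[OF this s(1)]
        have "(\<lambda>n. (cmod (U (F (s n)) w y - U (F (s n)) (act g w) (\<alpha> g w y)))\<^sup>2) \<longlonglongrightarrow> (cmod (u w y - u (act g w) (\<alpha> g w y)))\<^sup>2"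
          by (simp add: o_def)
        then have "(cmod (u w y - u (act g w) (\<alpha> g w y)))\<^sup>2 \<le> 0"
          by (rule LIMSEQ_le[OF _ elim(1)]) (use le in auto)
        then show ?thesis by simp
      qed
      then show "act g w \<in> E \<and> tame w \<and> tame (act g w) \<and> (\<forall>y. u (act g w) (\<alpha> g w y) = u w y)" using tw by blast
    qed
  qed
qed

text \<open>
  A countable set of group elements that is dense and contains all supports.
\<close>

definition G0 :: "'g set" where "G0 = range dense_sequence \<union> (\<Union>i. supp (f i))"
definition \<gamma> :: "nat \<Rightarrow> 'g" where "\<gamma> = from_nat_into G0"

lemma range_\<gamma>: "range \<gamma> = G0"
proof -
  have "countable G0" unfolding G0_def using fin by (intro countable_Un countable_UN) (auto intro: countable_finite)
  moreover have "G0 \<noteq> {}" by (auto simp: G0_def)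
  ultimately show ?thesis unfolding \<gamma>_def by (intro range_from_nat_into)
qed

lemma supp_\<gamma>: "h \<in> supp (f i) \<Longrightarrow> \<exists>n. h = \<gamma> n"
proof -
  assume "h \<in> supp (f i)"
  then have "h \<in> G0" by (auto simp: G0_def)
  then show ?thesis using range_\<gamma> by blast
qed

lemma \<gamma>_dense: assumes "open X" "X \<noteq> {}" shows "\<exists>n. \<gamma> n \<in> X"
proof -
  obtain m where m: "dense_sequence m \<in> X" using dense_sequence[OF assms] by blast
  have "dense_sequence m \<in> range \<gamma>" unfolding range_\<gamma> G0_def by blast
  then obtain n where "dense_sequence m = \<gamma> n" by blast
  then show ?thesis using m by metis
qed

text \<open>
  The supremum of \<open>|u w|\<close> over the orbit, taken over countably many orbit points for measurability. As
  \<open>AE_orb_le_c\<close> shows, this loses nothing: by \<open>\<tau>_small\<close> each orbit point is almost surely a limit of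
  countably many fixed ones, and \<open>u w\<close> is continuous.
\<close>

definition c :: "'w \<Rightarrow> ennreal" where "c w = (SUP n. ennreal (cmod (u w (orb (\<gamma> n) w))))"

lemma AE_orb_le_c: "AE w in \<Omega>. tame w \<longrightarrow> ennreal (cmod (u w (orb k w))) \<le> c w"
proof -
  have "\<exists>n. \<tau> (- k + \<gamma> n) < 1 / (real i + 1)" for i
  proof -
    obtain V where V: "open V" "0 \<in> V" "\<And>v. v \<in> V \<Longrightarrow> \<tau> v < 1 / (real i + 1)"
      using \<tau>_small[of "1 / (real i + 1)"] by auto
    have "open ((\<lambda>h. - k + h) -` V)" using V(1) by (intro open_vimage continuous_intros)
    moreover have "k \<in> (\<lambda>h. - k + h) -` V" using V(2) by simp
    ultimately obtain n where "\<gamma> n \<in> (\<lambda>h. - k + h) -` V" using \<gamma>_dense by blast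
    then show ?thesis using V(3) by auto
  qed
  then have "\<forall>i. \<exists>n. \<tau> (- k + \<gamma> n) < 1 / (real i + 1)" by blast
  from choice[OF this] obtain m where m: "\<And>i. \<tau> (- k + \<gamma> (m i)) < 1 / (real i + 1)" by blast
  define D where "D i w = min 1 (dist (orb k w) (orb (\<gamma> (m i)) w))" for i w
  have Di: "integrable \<Omega> (D i)" for i unfolding D_def by (rule integrable_min) simp_all
  have lim0: "(\<lambda>i. 1 / (real i + 1)) \<longlonglongrightarrow> 0" by real_asymp
  have "(\<lambda>i. \<integral>w. norm (D i w) \<partial>\<Omega>) \<longlonglongrightarrow> 0"
  proof (rule tendsto_sandwich[OF _ _ tendsto_const lim0])
    have eq: "(\<integral>w. norm (D i w) \<partial>\<Omega>) = \<tau> (- k + \<gamma> (m i))" for i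
    proof -
      have "norm (D i w) = min 1 (dist (orb k w) (orb (\<gamma> (m i)) w))" for w by (simp add: D_def)
      then show ?thesis by (simp only: integral_dist_orb)
    qed
    show "\<forall>\<^sub>F i in sequentially. 0 \<le> (\<integral>w. norm (D i w) \<partial>\<Omega>)" by simp
    show "\<forall>\<^sub>F i in sequentially. (\<integral>w. norm (D i w) \<partial>\<Omega>) \<le> 1 / (real i + 1)"
      unfolding eq using m by (simp add: less_imp_le)
  qed
  from tendsto_L1_AE_subseq[OF Di this] obtain s where s: "strict_mono s" "AE w in \<Omega>. (\<lambda>n. D (s n) w) \<longlonglongrightarrow> 0" by blast
  from s(2) show ?thesis
  proof (rule AE_mp, intro AE_I2 impI)
    fix w assume w: "(\<lambda>n. D (s n) w) \<longlonglongrightarrow> 0" "tame w"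
    have "(\<lambda>n. orb (\<gamma> (m (s n))) w) \<longlonglongrightarrow> orb k w"
    proof (rule tendstoI)
      fix e :: real assume "0 < e"
      then have "\<forall>\<^sub>F n in sequentially. D (s n) w < min 1 e" by (intro order_tendstoD(2)[OF w(1)]) simp
      then show "\<forall>\<^sub>F n in sequentially. dist (orb (\<gamma> (m (s n))) w) (orb k w) < e"
        by (rule eventually_mono) (auto simp: D_def dist_commute min_def split: if_splits)
    qed
    then have "(\<lambda>n. u w (orb (\<gamma> (m (s n))) w)) \<longlonglongrightarrow> u w (orb k w)"
      using continuous_u[OF w(2)] by (intro continuous_on_tendsto_compose[of UNIV "u w"]) auto
    then have A: "(\<lambda>n. ennreal (cmod (u w (orb (\<gamma> (m (s n))) w)))) \<longlonglongrightarrow> ennreal (cmod (u w (orb k w)))"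
      using tendsto_ennrealI[OF tendsto_norm] by blast
    have "ennreal (cmod (u w (orb (\<gamma> (m (s n))) w))) \<le> c w" for n
      unfolding c_def by (rule SUP_upper) simp
    then show "ennreal (cmod (u w (orb k w))) \<le> c w" by (intro LIMSEQ_le_const2[OF A]) blast
  qed
qed

lemma AE_c_le: "AE w in \<Omega>. w \<in> E \<longrightarrow> c w \<le> c (act g w)"
proof -
  have "AE w in \<Omega>. \<forall>j. tame w \<longrightarrow> ennreal (cmod (u w (orb (g + \<gamma> j) w))) \<le> c w"
    unfolding AE_all_countable using AE_orb_le_c by blast
  from AE_act[OF this, of g] AE_u_invariant[of g] AE_space show ?thesis
  proof eventually_elim
    case (elim w)
    show ?case
    proof
      assume "w \<in> E"
      then have w: "tame (act g w)" "\<And>y. u (act g w) (\<alpha> g w y) = u w y" using elim(2) by auto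
      have "ennreal (cmod (u w (orb (\<gamma> j) w))) \<le> c (act g w)" for j
        using elim(1) w(1) w(2)[of "orb (\<gamma> j) w"] \<alpha>_orb[OF elim(3), of g "\<gamma> j"] by metis
      then show "c w \<le> c (act g w)" unfolding c_def[of w] by (intro SUP_least)
    qed
  qed
qed

lemma AE_c_eq: "AE w in \<Omega>. w \<in> E \<longrightarrow> c (act g w) = c w"
proof -
  have "AE w in \<Omega>. act g w \<in> E \<longleftrightarrow> w \<in> E" using E unfolding almost_invariant_def by blast
  with AE_c_le[of g] AE_act[OF AE_c_le[of "- g"], of g] AE_space show ?thesis
    by eventually_elim auto
qed

lemma c_finite: assumes "tame w" shows "c w < \<infinity>"
proof -
  obtain M where M: "\<And>y. cmod (u w y) \<le> M" using u_bounded[OF assms] by blast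
  have "c w \<le> ennreal M" unfolding c_def using M by (intro SUP_least ennreal_leI)
  then show ?thesis using ennreal_less_top le_less_trans by (metis infinity_ennreal_def)
qed

lemma u_orb_measurable [measurable]: "(\<lambda>w. u w (orb h w)) \<in> borel_measurable \<Omega>"
  unfolding u_def by (intro borel_measurable_lim_metric U_orb_measurable)

lemma c_measurable [measurable]: "c \<in> borel_measurable \<Omega>"
  unfolding c_def by measurable

lemma tame_measurable [measurable]: "Measurable.pred \<Omega> tame"
  unfolding tame_def by measurable

definition S0 :: "'w set" where "S0 = {w \<in> space \<Omega>. w \<in> E \<and> tame w \<and> 0 < c w}"

lemma S0_sets [measurable]: "S0 \<in> sets \<Omega>" unfolding S0_def by measurable

text \<open>
  Suppose \<open>u\<close> vanishes on the orbit almost everywhere on \<open>E\<close>. Then the cross term in \<open>Q (F i - f j)\<close> tends to 0,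
  so that Fatou's lemma bounds the norm of \<open>f j\<close> by the distances to the later coefficients. These are
  small for large \<open>j\<close>, and the sequence \<open>f\<close> would be null.
\<close>

lemma S0_positive: "0 < measure \<Omega> S0"
proof (rule ccontr)
  assume "\<not> 0 < measure \<Omega> S0"
  then have "measure \<Omega> S0 = 0" using measure_nonneg[of \<Omega> S0] by linarith
  then have "S0 \<in> null_sets \<Omega>" by (intro null_setsI) (simp_all add: emeasure_eq_measure)
  then have "AE w in \<Omega>. w \<notin> S0" by (rule AE_not_in)
  with AE_tame AE_space have c0: "AE w in \<Omega>. w \<in> E \<longrightarrow> tame w \<and> c w = 0"
    by eventually_elim (auto simp: S0_def zero_less_iff_neq_zero)
  have kf0: "0 \<le> kernel_form (\<phi> E) (f j)" for j
    unfolding kernel_form_eq(1)[OF E fin] by (intro integral_nonneg_AE AE_I2) (simp add: Q_nonneg[OF fin])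
  have key: "kernel_form (\<phi> E) (f j) \<le> \<epsilon>" if \<epsilon>: "0 < \<epsilon>" and N: "\<And>i. N \<le> i \<Longrightarrow> kernel_form (\<phi> E) (\<lambda>g. f i g - f j g) < \<epsilon>" for \<epsilon> j N
  proof -
    have fd: "finite (supp (\<lambda>g. F i g - f j g))" for i by (rule fin_diff[OF finF fin])
    define A where "A i w = indicator E w * Q (\<lambda>g. F i g - f j g) w" for i w
    have A0: "0 \<le> A i w" for i w unfolding A_def by (simp add: Q_nonneg[OF fd])
    have Am: "A i \<in> borel_measurable \<Omega>" for i unfolding A_def by measurable
    have AI: "(\<integral>\<^sup>+w. ennreal (A i w) \<partial>\<Omega>) = ennreal (kernel_form (\<phi> E) (\<lambda>g. F i g - f j g))" for i
      using nn_integral_eq_integral[OF kernel_form_eq(2)[OF E fd, of i]] A0[unfolded A_def]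
      by (simp add: A_def kernel_form_eq(1)[OF E fd])
    have "ennreal (kernel_form (\<phi> E) (f j)) = (\<integral>\<^sup>+w. ennreal (indicator E w * Q (f j) w) \<partial>\<Omega>)"
      using nn_integral_eq_integral[OF kernel_form_eq(2)[OF E fin[of j]]] Q_nonneg[OF fin[of j]]
      by (simp add: kernel_form_eq(1)[OF E fin])
    also have "\<dots> \<le> (\<integral>\<^sup>+w. liminf (\<lambda>i. ennreal (A i w)) \<partial>\<Omega>)"
    proof (rule nn_integral_mono_AE, use c0 in eventually_elim)
      case (elim w)
      show "ennreal (indicator E w * Q (f j) w) \<le> liminf (\<lambda>i. ennreal (A i w))"
      proof (cases "w \<in> E")
        case False then show ?thesis by simp
      next
        case True
        then have tw: "tame w" and cw: "c w = 0" using elim by auto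
        have u0: "u w (orb h w) = 0" if h: "h \<in> supp (f j)" for h
        proof -
          obtain n where n: "h = \<gamma> n" using supp_\<gamma>[OF h] by blast
          have "ennreal (cmod (u w (orb (\<gamma> n) w))) \<le> c w" unfolding c_def by (rule SUP_upper) simp
          then show ?thesis unfolding n cw by (simp add: ennreal_eq_0_iff)
        qed
        define B where "B i = Q (f j) w - 2 * Re (\<Sum>h\<in>supp (f j). cnj (f j h) * U (F i) w (orb h w))" for i
        have "B \<longlonglongrightarrow> Q (f j) w - 2 * Re (\<Sum>h\<in>supp (f j). cnj (f j h) * u w (orb h w))"
          unfolding B_def by (intro tendsto_intros tendsto_u tw)
        then have "B \<longlonglongrightarrow> Q (f j) w" by (simp add: u0)
        then have "(\<lambda>i. ennreal (B i)) \<longlonglongrightarrow> ennreal (Q (f j) w)" by (rule tendsto_ennrealI)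
        then have "ennreal (Q (f j) w) = liminf (\<lambda>i. ennreal (B i))" by (intro lim_imp_Liminf[symmetric]) simp_all
        also have "\<dots> \<le> liminf (\<lambda>i. ennreal (A i w))"
        proof (intro Liminf_mono always_eventually allI ennreal_leI)
          fix i show "B i \<le> A i w"
            using True Q_diff[OF finF fin, of i j w] Q_nonneg[OF finF, of i w] by (simp add: A_def B_def)
        qed
        finally show ?thesis using True by simp
      qed
    qed
    also have "\<dots> \<le> liminf (\<lambda>i. \<integral>\<^sup>+w. ennreal (A i w) \<partial>\<Omega>)" using Am by (intro nn_integral_liminf) measurable
    also have "\<dots> \<le> liminf (\<lambda>i :: nat. ennreal \<epsilon>)"
    proof (rule Liminf_mono)
      have "(\<integral>\<^sup>+w. ennreal (A i w) \<partial>\<Omega>) \<le> ennreal \<epsilon>" if "N \<le> i" for i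
        unfolding AI F_def using N[of "r i"] that r_ge[of i] by (intro ennreal_leI) simp
      then show "\<forall>\<^sub>F i in sequentially. (\<integral>\<^sup>+w. ennreal (A i w) \<partial>\<Omega>) \<le> ennreal \<epsilon>"
        unfolding eventually_sequentially by blast
    qed
    also have "\<dots> = ennreal \<epsilon>" by (simp add: Liminf_const)
    finally show ?thesis using \<epsilon> by (simp add: ennreal_le_iff)
  qed
  have "(\<lambda>i. kernel_form (\<phi> E) (f i)) \<longlonglongrightarrow> 0"
  proof (rule LIMSEQ_I)
    fix \<epsilon> :: real assume \<epsilon>: "0 < \<epsilon>"
    then have e2: "0 < \<epsilon> / 2" by simp
    then obtain N where N: "\<And>m n. N \<le> m \<Longrightarrow> N \<le> n \<Longrightarrow> kernel_form (\<phi> E) (\<lambda>g. f m g - f n g) < \<epsilon> / 2"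
      using cauchy[OF e2] by blast
    have "kernel_form (\<phi> E) (f j) \<le> \<epsilon> / 2" if "N \<le> j" for j using key[OF e2, of N j] N that by blast
    then have "norm (kernel_form (\<phi> E) (f j) - 0) < \<epsilon>" if "N \<le> j" for j using that kf0[of j] \<epsilon> by fastforce
    then show "\<exists>N. \<forall>j\<ge>N. norm (kernel_form (\<phi> E) (f j) - 0) < \<epsilon>" by blast
  qed
  then show False using nz by blast
qed

end

context invariant_coefficients begin

lemma orbit_countably_approximated:
  "\<exists>d :: nat \<Rightarrow> 'x. AE w in \<Omega>. \<forall>n. orb (\<gamma> n) w \<in> closure (range d)"
proof -
  have "\<forall>n. \<exists>D. countable D \<and> (AE w in \<Omega>. orb (\<gamma> n) w \<in> closure D)"
    using orb_essentially_separable by blast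
  from choice[OF this] obtain D where D: "\<And>n. countable (D n)" "\<And>n. AE w in \<Omega>. orb (\<gamma> n) w \<in> closure (D n)"
    by blast
  let ?D = "insert x0 (\<Union>n. D n)"
  have r: "range (from_nat_into ?D) = ?D" by (rule range_from_nat_into) (use D(1) in auto)
  have "AE w in \<Omega>. \<forall>n. orb (\<gamma> n) w \<in> closure (D n)" unfolding AE_all_countable using D(2) by blast
  then have "AE w in \<Omega>. \<forall>n. orb (\<gamma> n) w \<in> closure (range (from_nat_into ?D))"
  proof (rule AE_mp, intro AE_I2 impI allI)
    fix w n assume "\<forall>n. orb (\<gamma> n) w \<in> closure (D n)"
    moreover have "closure (D n) \<subseteq> closure ?D" by (rule closure_mono) blast
    ultimately show "orb (\<gamma> n) w \<in> closure (range (from_nat_into ?D))" unfolding r by blast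
  qed
  then show ?thesis by blast
qed

text \<open>
  The distance on a nonseparable space need not be measurable for the product of the Borel sigma-algebras. On
  a separable part it is, since it is an infimum of sums of functions of one variable.
\<close>

lemma dist_eq_INF:
  fixes d :: "nat \<Rightarrow> 'x"
  assumes "a \<in> closure (range d)"
  shows "(INF k. dist a (d k) + dist (d k) y) = dist a y"
proof (rule antisym)
  have bdd: "bdd_below (range (\<lambda>k. dist a (d k) + dist (d k) y))" by (rule bdd_belowI[of _ 0]) auto
  show "dist a y \<le> (INF k. dist a (d k) + dist (d k) y)" by (rule cINF_greatest) (auto intro: dist_triangle)
  show "(INF k. dist a (d k) + dist (d k) y) \<le> dist a y"
  proof (rule field_le_epsilon)
    fix e :: real assume e: "0 < e"
    then have "0 < e / 2" by simp
    then obtain k where k: "dist (d k) a < e / 2" using assms unfolding closure_approachable by blast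
    have "(INF k. dist a (d k) + dist (d k) y) \<le> dist a (d k) + dist (d k) y" by (rule cINF_lower[OF bdd]) simp
    also have "\<dots> \<le> dist a y + e"
      using k dist_triangle[of "d k" y a] by (simp add: dist_commute[of a "d k"])
    finally show "(INF k. dist a (d k) + dist (d k) y) \<le> dist a y + e" .
  qed
qed

text \<open>
  The threshold is half of the supremum over the orbit, so the level set meets the orbit and is bounded. A
  null set is removed on which the orbit is not separable.
\<close>

lemma level_sets_carry_field:
  "\<exists>S Fd. S \<subseteq> E \<and> 0 < measure \<Omega> S \<and> carries_field S Fd"
proof -
  obtain d :: "nat \<Rightarrow> 'x" where d: "AE w in \<Omega>. \<forall>n. orb (\<gamma> n) w \<in> closure (range d)"
    using orbit_countably_approximated by blast
  from AE_E[OF d] obtain N where N: "{w \<in> space \<Omega>. \<not> (\<forall>n. orb (\<gamma> n) w \<in> closure (range d))} \<subseteq> N"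
    "emeasure \<Omega> N = 0" "N \<in> sets \<Omega>" by blast
  have nullN: "N \<in> null_sets \<Omega>" using N by blast
  define S where "S = S0 - N"
  define Fd where "Fd w = {y. enn2real (c w) / 2 < cmod (u w y)}" for w
  have Sm [measurable]: "S \<in> sets \<Omega>" unfolding S_def using N(3) by simp
  have SD: "w \<in> space \<Omega>" "w \<in> E" "tame w" "0 < c w" "\<And>n. orb (\<gamma> n) w \<in> closure (range d)" if "w \<in> S" for w
    using that N(1) unfolding S_def S0_def by auto
  have notN: "AE w in \<Omega>. w \<notin> N" using nullN by (rule AE_not_in)
  have cr: "0 < enn2real (c w)" "c w = ennreal (enn2real (c w))" if "w \<in> S" for w
    using c_finite[OF SD(3)[OF that]] SD(4)[OF that] by (simp_all add: enn2real_positive_iff less_top)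
  have "measure \<Omega> S = measure \<Omega> S0" unfolding S_def using N by (intro measure_Diff_null_set) auto
  then have pos: "0 < measure \<Omega> S" using S0_positive by simp
  have inv: "AE w in \<Omega>. act g w \<in> S \<longleftrightarrow> w \<in> S" for g
  proof -
    have "AE w in \<Omega>. act g w \<in> E \<longleftrightarrow> w \<in> E" using E unfolding almost_invariant_def by blast
    with AE_tame AE_act[OF AE_tame, of g] AE_c_eq[of g] notN AE_act[OF notN, of g] AE_space show ?thesis
      by eventually_elim (auto simp: S_def S0_def)
  qed
  have Bdd: "Fd w \<in> Bdd" if "w \<in> S" for w
  proof -
    have "ennreal (enn2real (c w) / 2) < c w" using cr[OF that] by (metis ennreal_less_iff field_sum_of_halves less_add_same_cancel1 half_gt_zero less_imp_le)
    then obtain n where "ennreal (enn2real (c w) / 2) < ennreal (cmod (u w (orb (\<gamma> n) w)))"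
      unfolding c_def[of w] less_SUP_iff by blast
    then have "orb (\<gamma> n) w \<in> Fd w" unfolding Fd_def by (simp add: ennreal_less_iff)
    moreover have "bounded (Fd w)" unfolding Fd_def using u_level_bounded[OF SD(3)[OF that], of "enn2real (c w) / 2"] cr(1)[OF that] by simp
    ultimately show ?thesis unfolding Bdd_def by blast
  qed
  have eqv: "AE w in \<Omega>. w \<in> S \<longrightarrow> \<alpha> g w ` Fd w = Fd (act g w)" for g
    using AE_u_invariant[of g] AE_c_eq[of g]
  proof eventually_elim
    case (elim w)
    show ?case
    proof
      assume w: "w \<in> S"
      have cw: "c (act g w) = c w" and uw: "\<And>y. u (act g w) (\<alpha> g w y) = u w y" using elim SD[OF w] by auto
      have iff: "\<alpha> g w y \<in> Fd (act g w) \<longleftrightarrow> y \<in> Fd w" for y unfolding Fd_def by (simp add: cw uw)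
      show "\<alpha> g w ` Fd w = Fd (act g w)"
      proof (intro Set.set_eqI iffI)
        fix z assume z: "z \<in> Fd (act g w)"
        obtain y where "z = \<alpha> g w y" using \<alpha>_isometry(1)[OF SD(1)[OF w], of g] by (metis bij_pointE)
        then show "z \<in> \<alpha> g w ` Fd w" using z iff by blast
      qed (use iff in blast)
    qed
  qed
  define G where "G h z = (INF k. dist (orb h (fst z)) (d k) + dist (d k) (snd z))" for h z
  have Gm [measurable]: "G h \<in> borel_measurable (\<Omega> \<Otimes>\<^sub>M borel)" for h
  proof -
    have a: "(\<lambda>z. dist (orb h (fst z)) (d k)) \<in> borel_measurable (\<Omega> \<Otimes>\<^sub>M (borel :: 'x measure))" for k
      by (rule measurable_compose[OF measurable_compose[OF measurable_fst orb_measurable]])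
        (intro borel_measurable_continuous_onI continuous_intros)
    have b: "(\<lambda>z. dist (d k) (snd z)) \<in> borel_measurable (\<Omega> \<Otimes>\<^sub>M (borel :: 'x measure))" for k
      by (rule measurable_compose[OF measurable_snd]) (intro borel_measurable_continuous_onI continuous_intros)
    show ?thesis unfolding G_def
    proof (rule borel_measurable_cINF)
      show "bdd_below ((\<lambda>k. dist (orb h (fst z)) (d k) + dist (d k) (snd z)) ` UNIV)" for z
        by (rule bdd_belowI[of _ 0]) auto
    qed (use a b in \<open>auto intro: borel_measurable_add\<close>)
  qed
  define v where "v z = lim (\<lambda>i. \<Sum>h\<in>supp (F i). F i h * of_real (exp (- t * G h z)))" for z
  have vm: "v \<in> borel_measurable (\<Omega> \<Otimes>\<^sub>M borel)"
    unfolding v_def by (intro borel_measurable_lim_metric) measurable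
  have v: "v (w, y) = u w y" if w: "w \<in> S" for w y
  proof -
    have "G h (w, y) = dist (orb h w) y" if "h \<in> supp (F i)" for h i
    proof -
      obtain n where "h = \<gamma> n" using supp_\<gamma> \<open>h \<in> supp (F i)\<close> unfolding F_def by blast
      then show ?thesis unfolding G_def using dist_eq_INF[OF SD(5)[OF w, of n]] by simp
    qed
    then show ?thesis unfolding v_def u_def U_def by simp
  qed
  have "{(w, y). w \<in> S \<and> y \<in> Fd w}
    = {z \<in> space (\<Omega> \<Otimes>\<^sub>M borel). fst z \<in> S \<and> enn2real (c (fst z)) / 2 < cmod (v z)}"
    using SD(1) by (auto simp: space_pair_measure Fd_def v)
  also have "\<dots> \<in> sets (\<Omega> \<Otimes>\<^sub>M borel)" using vm by measurable
  finally have graph: "{(w, y). w \<in> S \<and> y \<in> Fd w} \<in> sets (\<Omega> \<Otimes>\<^sub>M borel)" .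
  have "carries_field S Fd" unfolding carries_field_def almost_invariant_def using inv Bdd eqv graph Sm by blast
  moreover have "S \<subseteq> E" using SD(2) by blast
  ultimately show ?thesis using pos by blast
qed

end


section \<open>Exhausting the probability space\<close>

context isometric_cocycle begin

text \<open>
  The functions \<open>p n\<close> increase pointwise to the measure of \<open>E\<close>. By compactness of \<open>K\<close> (Dini's argument) one
  of them exceeds on all of \<open>K\<close> the bound that \<open>kazhdan_invariant_coefficients\<close> requires.
\<close>

lemma field_on_positive_part:
  assumes med: "median_space TYPE('x)" and T: "property_T TYPE('g)"
    and E: "almost_invariant E" and pos: "0 < measure \<Omega> E"
  shows "\<exists>S Fd. S \<subseteq> E \<and> 0 < measure \<Omega> S \<and> carries_field S Fd"
proof -
  obtain K :: "'g set" and \<epsilon> where K: "compact K" "0 < \<epsilon>" "kazhdan_pair K \<epsilon>"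
    using T unfolding property_T_def by blast
  have Em [measurable]: "E \<in> sets \<Omega>" using E by (simp add: almost_invariant_def)
  define p where "p n g = (\<integral>w. indicator E w * exp (- (1 / (real n + 1)) * disp g w) \<partial>\<Omega>)" for n g
  have loc: "median_cocycle \<Omega> act \<alpha> (1 / (real n + 1))" for n
    by unfold_locales (use med in auto)
  have cont: "continuous_on UNIV (p n)" for n
  proof -
    interpret M: median_cocycle \<Omega> act \<alpha> x0 "1 / (real n + 1)" by (rule loc)
    have "p n = M.\<phi> E" by (simp add: fun_eq_iff p_def M.\<phi>_def)
    then show ?thesis using positive_definite_function.cont[OF M.\<phi>_positive_definite[OF E]] by simp
  qed
  have int: "integrable \<Omega> (\<lambda>w. indicator E w * exp (- (1 / (real n + 1)) * disp g w))" for n g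
  proof -
    interpret M: median_cocycle \<Omega> act \<alpha> x0 "1 / (real n + 1)" by (rule loc)
    show ?thesis by (rule M.integrable_ind_exp) simp_all
  qed
  have mono: "p m g \<le> p n g" if "m \<le> n" for m n g
    unfolding p_def
  proof (rule integral_mono[OF int int])
    fix w
    have "1 / (real n + 1) * disp g w \<le> 1 / (real m + 1) * disp g w"
      using that by (intro mult_right_mono divide_left_mono) auto
    then show "indicator E w * exp (- (1 / (real m + 1)) * disp g w) \<le> indicator E w * exp (- (1 / (real n + 1)) * disp g w)"
      by (intro mult_left_mono) auto
  qed
  have lim: "(\<lambda>n. p n g) \<longlonglongrightarrow> measure \<Omega> E" for g
  proof -
    have "(\<lambda>n. p n g) \<longlonglongrightarrow> (\<integral>w. indicator E w \<partial>\<Omega>)"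
      unfolding p_def
    proof (rule integral_dominated_convergence[where w = "\<lambda>_. 1"])
      show "AE w in \<Omega>. (\<lambda>n. indicator E w * exp (- (1 / (real n + 1)) * disp g w)) \<longlonglongrightarrow> indicator E w"
      proof (rule AE_I2)
        fix w
        have a: "(\<lambda>n. 1 / (real n + 1)) \<longlonglongrightarrow> 0" by real_asymp
        have "(\<lambda>n. indicator E w * exp (- (1 / (real n + 1)) * disp g w)) \<longlonglongrightarrow> indicator E w * exp (- 0 * disp g w)"
          by (intro tendsto_intros a)
        then show "(\<lambda>n. indicator E w * exp (- (1 / (real n + 1)) * disp g w)) \<longlonglongrightarrow> indicator E w" by simp
      qed
      show "AE w in \<Omega>. norm (indicator E w * exp (- (1 / (real n + 1)) * disp g w)) \<le> 1" for n
        by (intro AE_I2) (simp add: indicator_def)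
    qed simp_all
    then show ?thesis by simp
  qed
  define b where "b = measure \<Omega> E - \<epsilon>\<^sup>2 * measure \<Omega> E / 2"
  have b: "b < measure \<Omega> E" unfolding b_def using pos K(2) by simp
  define O' where "O' n = {k. b < p n k}" for n
  have op: "open (O' n)" for n unfolding O'_def
    by (rule open_Collect_less[OF continuous_on_const cont])
  have cov: "K \<subseteq> (\<Union>n\<in>UNIV. O' n)"
  proof
    fix k
    have "\<forall>\<^sub>F n in sequentially. b < p n k" using order_tendstoD(1)[OF lim b] .
    then show "k \<in> (\<Union>n\<in>UNIV. O' n)" unfolding eventually_sequentially O'_def by blast
  qed
  obtain C where C: "finite C" "K \<subseteq> (\<Union>n\<in>C. O' n)"
    by (rule compactE_image[OF K(1) op cov])
  define n where "n = Max (insert 0 C)"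
  have Kn: "b < p n k" if "k \<in> K" for k
  proof -
    obtain m where "m \<in> C" "b < p m k" using C(2) \<open>k \<in> K\<close> unfolding O'_def by blast
    moreover have "m \<le> n" unfolding n_def using C(1) \<open>m \<in> C\<close> by (intro Max_ge) auto
    ultimately show ?thesis using mono[of m n k] by linarith
  qed
  interpret M: median_cocycle \<Omega> act \<alpha> x0 "1 / (real n + 1)" by (rule loc)
  have p: "M.\<phi> E = p n" by (simp add: fun_eq_iff p_def M.\<phi>_def)
  have p0: "p n 0 = measure \<Omega> E"
  proof -
    have "p n 0 = (\<integral>w. indicator E w \<partial>\<Omega>)"
      unfolding p_def by (rule Bochner_Integration.integral_cong) (simp_all add: disp_def orb_zero)
    then show ?thesis by simp
  qed
  have half: "2 * (a - x) < c" if "a - c / 2 < x" for a x c :: real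
    using that by (simp add: field_simps)
  have "\<exists>f. (\<forall>i. finite {g. f i g \<noteq> 0})
      \<and> (\<forall>r>0. \<exists>N. \<forall>m\<ge>N. \<forall>n\<ge>N. kernel_form (M.\<phi> E) (\<lambda>g. f m g - f n g) < r)
      \<and> (\<forall>g. (\<lambda>i. kernel_form (M.\<phi> E) (\<lambda>h. f i (- g + h) - f i h)) \<longlonglongrightarrow> 0)
      \<and> \<not> (\<lambda>i. kernel_form (M.\<phi> E) (f i)) \<longlonglongrightarrow> 0"
  proof (rule positive_definite_function.kazhdan_invariant_coefficients[OF M.\<phi>_positive_definite[OF E] K(3,2)])
    show "0 < M.\<phi> E 0" unfolding p p0 by (rule pos)
    show "2 * (M.\<phi> E 0 - M.\<phi> E k) < \<epsilon>\<^sup>2 * M.\<phi> E 0" if "k \<in> K" for k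
      unfolding p p0 using half[OF Kn[OF that, unfolded b_def]] .
  qed
  then obtain f where fin: "\<And>i. finite {g. f i g \<noteq> 0}"
    and cauchy: "\<And>r. 0 < r \<Longrightarrow> \<exists>N. \<forall>m\<ge>N. \<forall>n\<ge>N. kernel_form (M.\<phi> E) (\<lambda>g. f m g - f n g) < r"
    and inv: "\<And>g. (\<lambda>i. kernel_form (M.\<phi> E) (\<lambda>h. f i (- g + h) - f i h)) \<longlonglongrightarrow> 0"
    and nz: "\<not> (\<lambda>i. kernel_form (M.\<phi> E) (f i)) \<longlonglongrightarrow> 0" by blast
  have "\<forall>i. \<exists>N. \<forall>m\<ge>N. \<forall>n\<ge>N. kernel_form (M.\<phi> E) (\<lambda>g. f m g - f n g) < 1 / 4 ^ i"
    by (intro allI cauchy) simp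
  from choice[OF this] obtain N where
    N: "\<And>i m n. N i \<le> m \<Longrightarrow> N i \<le> n \<Longrightarrow> kernel_form (M.\<phi> E) (\<lambda>g. f m g - f n g) < 1 / 4 ^ i" by blast
  \<comment> \<open>The sum makes \<open>r i\<close> exceed the thresholds of all indices up to \<open>i\<close>, so that two consecutive terms obey the
    bound for \<open>i\<close>.\<close>
  define r where "r i = (\<Sum>k\<le>i. N k) + i" for i
  have rN: "N i \<le> r j" if "i \<le> j" for i j
    unfolding r_def using member_le_sum[of i "{..j}" N] that by (simp add: trans_le_add1)
  interpret I: invariant_coefficients \<Omega> act \<alpha> x0 "1 / (real n + 1)" E f r
  proof unfold_locales
    show "finite (M.supp (f i))" for i using fin by (simp add: M.supp_def)
    show "i \<le> r i" for i by (simp add: r_def)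
    show "kernel_form (M.\<phi> E) (\<lambda>g. f (r (Suc i)) g - f (r i) g) \<le> 1 / 4 ^ i" for i
      using N[OF rN[of i "Suc i"] rN[of i i]] by simp
  qed (use E cauchy inv nz in auto)
  show ?thesis by (rule I.level_sets_carry_field)
qed

text \<open>
  On overlaps the field with the least index is taken; almost invariance of all parts makes that index
  almost surely invariant.
\<close>

lemma carries_field_UN:
  assumes S: "\<And>n :: nat. carries_field (S n) (Fd n)"
  shows "\<exists>Fd. carries_field (\<Union>n. S n) Fd"
proof -
  define idx where "idx w = (LEAST n. w \<in> S n)" for w
  have idx: "w \<in> S (idx w)" if "w \<in> (\<Union>n. S n)" for w
    unfolding idx_def using that by (auto intro: LeastI)
  have Sm: "S n \<in> sets \<Omega>" for n using S by (simp add: carries_field_def almost_invariant_def)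
  have inv: "AE w in \<Omega>. \<forall>n. act g w \<in> S n \<longleftrightarrow> w \<in> S n" for g
    unfolding AE_all_countable using S by (simp add: carries_field_def almost_invariant_def)
  have eqv: "AE w in \<Omega>. \<forall>n. w \<in> S n \<longrightarrow> \<alpha> g w ` Fd n w = Fd n (act g w)" for g
    unfolding AE_all_countable using S by (simp add: carries_field_def)
  have graph: "{(w, x). w \<in> S n \<and> x \<in> Fd n w} \<in> sets (\<Omega> \<Otimes>\<^sub>M borel)" for n
    using S by (simp add: carries_field_def)
  have "carries_field (\<Union>n. S n) (\<lambda>w. Fd (idx w) w)"
    unfolding carries_field_def almost_invariant_def
  proof (intro conjI allI ballI)
    show "(\<Union>n. S n) \<in> sets \<Omega>" using Sm by blast
    show "AE w in \<Omega>. act g w \<in> (\<Union>n. S n) \<longleftrightarrow> w \<in> (\<Union>n. S n)" for g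
      using inv[of g] by eventually_elim blast
    show "Fd (idx w) w \<in> Bdd" if "w \<in> (\<Union>n. S n)" for w
      using S[of "idx w"] idx[OF that] by (simp add: carries_field_def)
    show "AE w in \<Omega>. w \<in> (\<Union>n. S n) \<longrightarrow> \<alpha> g w ` Fd (idx w) w = Fd (idx (act g w)) (act g w)" for g
      using inv[of g] eqv[of g]
    proof eventually_elim
      case (elim w)
      then have "idx (act g w) = idx w" by (simp add: idx_def)
      then show ?case using elim idx by simp
    qed
    have "{(w, x). w \<in> (\<Union>n. S n) \<and> x \<in> Fd (idx w) w}
      = (\<Union>n. {(w, x). w \<in> S n \<and> x \<in> Fd n w} - (\<Union>m<n. S m \<times> UNIV))"
    proof (intro Set.set_eqI iffI)
      fix z assume z: "z \<in> {(w, x). w \<in> (\<Union>n. S n) \<and> x \<in> Fd (idx w) w}"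
      obtain w x where wx: "z = (w, x)" by (cases z)
      have "w \<in> S (idx w)" "x \<in> Fd (idx w) w" using z idx wx by auto
      moreover have "w \<notin> S m" if "m < idx w" for m using not_less_Least that unfolding idx_def by blast
      ultimately show "z \<in> (\<Union>n. {(w, x). w \<in> S n \<and> x \<in> Fd n w} - (\<Union>m<n. S m \<times> UNIV))"
        unfolding wx by blast
    next
      fix z assume z: "z \<in> (\<Union>n. {(w, x). w \<in> S n \<and> x \<in> Fd n w} - (\<Union>m<n. S m \<times> UNIV))"
      obtain w x where wx: "z = (w, x)" by (cases z)
      obtain n where n: "w \<in> S n" "x \<in> Fd n w" "\<And>m. m < n \<Longrightarrow> w \<notin> S m" using z unfolding wx by blast
      have "idx w = n" unfolding idx_def
        by (rule Least_equality) (use n not_le_imp_less in blast)+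
      then show "z \<in> {(w, x). w \<in> (\<Union>n. S n) \<and> x \<in> Fd (idx w) w}" using n wx by blast
    qed
    also have "\<dots> \<in> sets (\<Omega> \<Otimes>\<^sub>M borel)"
      using graph Sm by (intro sets.countable_UN' sets.Diff sets.finite_UN pair_measureI) auto
    finally show "{(w, x). w \<in> (\<Union>n. S n) \<and> x \<in> Fd (idx w) w} \<in> sets (\<Omega> \<Otimes>\<^sub>M borel)" .
  qed
  then show ?thesis by blast
qed

text \<open>
  The supremum of the measures of the parts that carry a field is attained, by a countable union. If it were
  less than 1, the complement would contain a further part.
\<close>

lemma carries_field_full:
  assumes step: "\<And>E. almost_invariant E \<Longrightarrow> 0 < measure \<Omega> E \<Longrightarrow> \<exists>S Fd. S \<subseteq> E \<and> 0 < measure \<Omega> S \<and> carries_field S Fd"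
  shows "\<exists>T Fd. measure \<Omega> T = 1 \<and> carries_field T Fd"
proof -
  define A where "A = {S. \<exists>Fd. carries_field S Fd}"
  define s where "s = (SUP S\<in>A. measure \<Omega> S)"
  have "{} \<in> A" by (simp add: A_def carries_field_def almost_invariant_def)
  then have A0: "A \<noteq> {}" by blast
  have bdd: "bdd_above (measure \<Omega> ` A)" by (rule bdd_aboveI[of _ 1]) auto
  have le_s: "measure \<Omega> S \<le> s" if "S \<in> A" for S unfolding s_def by (rule cSUP_upper[OF that bdd])
  have "\<exists>S\<in>A. s - 1 / (real n + 1) < measure \<Omega> S" for n
    using less_cSUP_iff[OF A0 bdd, of "s - 1 / (real n + 1)"] by (simp add: s_def)
  then have "\<forall>n. \<exists>S. S \<in> A \<and> s - 1 / (real n + 1) < measure \<Omega> S" by blast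
  from choice[OF this] obtain S where S: "\<And>n. S n \<in> A" "\<And>n. s - 1 / (real n + 1) < measure \<Omega> (S n)" by blast
  have Un: "(\<Union>n. R n) \<in> A" if "\<And>n. R n \<in> A" for R :: "nat \<Rightarrow> 'w set"
  proof -
    have "\<forall>n. \<exists>Fd. carries_field (R n) Fd" using that unfolding A_def by blast
    from choice[OF this] obtain Fd where "\<And>n. carries_field (R n) (Fd n)" by blast
    from carries_field_UN[OF this] show ?thesis by (simp add: A_def)
  qed
  have setsA: "R \<in> sets \<Omega>" if "R \<in> A" for R using that by (auto simp: A_def carries_field_def almost_invariant_def)
  define T where "T = (\<Union>n. S n)"
  have T: "T \<in> A" unfolding T_def using S(1) by (rule Un)
  have sT: "s \<le> measure \<Omega> T"
  proof (rule LIMSEQ_le_const2)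
    show "(\<lambda>n. s - 1 / (real n + 1)) \<longlonglongrightarrow> s" by real_asymp
    have "s - 1 / (real n + 1) \<le> measure \<Omega> T" for n
      using S(2)[of n] finite_measure_mono[of "S n" T] setsA[OF T] unfolding T_def by fastforce
    then show "\<exists>N. \<forall>n\<ge>N. s - 1 / (real n + 1) \<le> measure \<Omega> T" by blast
  qed
  have "measure \<Omega> T = 1"
  proof (rule ccontr)
    assume "measure \<Omega> T \<noteq> 1"
    then have "0 < measure \<Omega> (space \<Omega> - T)" using prob_compl[OF setsA[OF T]] prob_le_1[of T] by linarith
    moreover have "almost_invariant (space \<Omega> - T)" unfolding almost_invariant_def
    proof (intro conjI allI)
      show "space \<Omega> - T \<in> sets \<Omega>" using setsA[OF T] by blast
      have "AE w in \<Omega>. act g w \<in> T \<longleftrightarrow> w \<in> T" for g using T by (auto simp: A_def carries_field_def almost_invariant_def)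
      then show "AE w in \<Omega>. act g w \<in> space \<Omega> - T \<longleftrightarrow> w \<in> space \<Omega> - T" for g
        using AE_space by eventually_elim simp
    qed
    ultimately obtain S' where S': "S' \<subseteq> space \<Omega> - T" "0 < measure \<Omega> S'" "S' \<in> A" using step unfolding A_def by blast
    have "(\<Union>n :: nat. if n = 0 then T else S') \<in> A" by (rule Un) (use T S' in simp)
    moreover have "(\<Union>n :: nat. if n = 0 then T else S') = T \<union> S'" by (auto split: if_splits)
    ultimately have "measure \<Omega> (T \<union> S') \<le> s" using le_s by simp
    moreover have "measure \<Omega> (T \<union> S') = measure \<Omega> T + measure \<Omega> S'"
      using S' setsA[OF T] setsA[OF S'(3)] by (intro finite_measure_Union) auto
    ultimately show False using S'(2) sT by linarith
  qed
  then show ?thesis using T unfolding A_def by blast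
qed

text \<open>
  Off the set of full measure that carries a field, the base point serves as the value.
\<close>

theorem invariant_bounded_field:
  assumes "median_space TYPE('x)" "property_T TYPE('g)"
  shows "\<exists>f. (\<forall>\<omega>\<in>space \<Omega>. f \<omega> \<in> Bdd) \<and> invariant_section \<Omega> act \<alpha> f
    \<and> {(\<omega>, x). \<omega> \<in> space \<Omega> \<and> x \<in> f \<omega>} \<in> sets (\<Omega> \<Otimes>\<^sub>M borel)"
proof -
  obtain T Fd where T: "measure \<Omega> T = 1" "carries_field T Fd"
    using carries_field_full field_on_positive_part[OF assms] by blast
  have Tm: "T \<in> sets \<Omega>" using T(2) by (simp add: carries_field_def almost_invariant_def)
  define f where "f w = (if w \<in> T then Fd w else {x0})" for w
  have "f w \<in> Bdd" for w using T(2) by (simp add: f_def carries_field_def Bdd_def)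
  moreover have "invariant_section \<Omega> act \<alpha> f"
    unfolding invariant_section_def
  proof
    fix g
    have aT: "AE w in \<Omega>. w \<in> T" using T(1) Tm by (simp add: prob_eq_1)
    have "AE w in \<Omega>. act g w \<in> T \<longleftrightarrow> w \<in> T" "AE w in \<Omega>. w \<in> T \<longrightarrow> \<alpha> g w ` Fd w = Fd (act g w)"
      using T(2) by (simp_all add: carries_field_def almost_invariant_def)
    with aT show "AE w in \<Omega>. \<alpha> g w ` f w = f (act g w)" by eventually_elim (simp add: f_def)
  qed
  moreover have "{(w, x). w \<in> space \<Omega> \<and> x \<in> f w} \<in> sets (\<Omega> \<Otimes>\<^sub>M borel)"
  proof -
    have "{(w, x). w \<in> space \<Omega> \<and> x \<in> f w} = {(w, x). w \<in> T \<and> x \<in> Fd w} \<union> (space \<Omega> - T) \<times> {x0}"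
      using sets.sets_into_space[OF Tm] by (auto simp: f_def split: if_splits)
    moreover have "{(w, x). w \<in> T \<and> x \<in> Fd w} \<in> sets (\<Omega> \<Otimes>\<^sub>M borel)" using T(2) by (simp add: carries_field_def)
    moreover have "(space \<Omega> - T) \<times> {x0} \<in> sets (\<Omega> \<Otimes>\<^sub>M borel)" using Tm by (intro pair_measureI) auto
    ultimately show ?thesis by simp
  qed
  ultimately show ?thesis by blast
qed

end

theorem theorem7:
  fixes \<Omega> :: "'w measure"
    and act :: "'g::{topological_group_add, t2_space, second_countable_topology} \<Rightarrow> 'w \<Rightarrow> 'w"
    and \<alpha> :: "'g \<Rightarrow> 'w \<Rightarrow> 'x::complete_space \<Rightarrow> 'x"
  assumes "median_space TYPE('x)"
    and "locally_compact_space (euclidean :: 'g topology)"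
    and "property_T TYPE('g)"
    and "standard_probability_space \<Omega>"
    and "mp_action \<Omega> act"
    and "ergodic_action \<Omega> act"
    and "isom_cocycle \<Omega> act \<alpha>"
  shows "\<exists>f. (\<forall>\<omega>\<in>space \<Omega>. f \<omega> \<in> Bdd) \<and>
             invariant_section \<Omega> act \<alpha> f \<and>
             {(\<omega>, x). \<omega> \<in> space \<Omega> \<and> x \<in> f \<omega>} \<in> sets (\<Omega> \<Otimes>\<^sub>M borel)"
proof -
  \<comment> \<open>Any base point will do.\<close>
  interpret isometric_cocycle \<Omega> act \<alpha> undefined
    by (rule isometric_cocycle.intro) (use assms in simp_all)
  show ?thesis using invariant_bounded_field[OF assms(1,3)] .
qed

end
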